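(* The \textsc{Unsplittable Flow} problem (as defined in the context) is W[1]-hard when parameterized by the combined parameter $\mathrm{tw}+\Delta+\ell$, where $\mathrm{tw}$ is the treewidth of the input graph, $\Delta$ its maximum degree, and $\ell$ the length bound on admissible flow routes.
   Context: \textsc{Unsplittable Flow} (decision version): an instance $\mathbb{I}$ consists of a simple undirected graph $G=(V,E)$; a capacity function $\gamma:E\to\mathbb{N}$, encoded in unary; a set $\mathcal{T}$ of tasks, each task being a tuple $(s,t,d,w)\in V\times V\times\mathbb{N}\times\mathbb{N}$ with endpoints $s,t$, demand $d$ and profit $w$; a profit target $\tau\in\mathbb{N}$; and an integer length bound $\ell$. For a subset $T'\subseteq\mathcal{T}$, a flow routing assigns to each task $(s,t,d,w)\in T'$ an $s$-$t$ path in $G$ of length at most $\ell$ such that for every edge $e\in E$ the sum of the demands of the tasks in $T'$ whose assigned path uses $e$ is at most $\gamma(e)$. The question is whether there is a subset $T'$ admitting a flow routing whose total profit $\sum_{(s,t,d,w)\in T'} w$ is at least $\tau$. *)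

theory Defs
  imports Main
begin

section \<open>Machine model\<close>

text \<open>
  Running times refer to Jones' WHILE language over binary trees (Computability and Complexity
  from a Programming Perspective, 1997). Copying, comparing or testing a tree is charged its full
  size, so a run of time \<open>t\<close> creates trees of size at most \<open>t\<close>; with this cost measure the model
  and multi-tape Turing machines simulate each other with polynomial overhead. Hence
  polynomial time, fpt time and computability have their usual meaning.
\<close>

datatype tree = Leaf | Node tree tree

fun tsize :: "tree \<Rightarrow> nat" where
  "tsize Leaf = 1"
| "tsize (Node l r) = 1 + tsize l + tsize r"

datatype exp = EVar nat | ELeaf | ECons exp exp | EHd exp | ETl exp | EEq exp exp

fun hd_tree :: "tree \<Rightarrow> tree" where
  "hd_tree Leaf = Leaf"
| "hd_tree (Node l r) = l"

fun tl_tree :: "tree \<Rightarrow> tree" where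
  "tl_tree Leaf = Leaf"
| "tl_tree (Node l r) = r"

type_synonym state = "nat \<Rightarrow> tree"

fun eval_exp :: "exp \<Rightarrow> state \<Rightarrow> tree" where
  "eval_exp (EVar x) s = s x"
| "eval_exp ELeaf s = Leaf"
| "eval_exp (ECons a b) s = Node (eval_exp a s) (eval_exp b s)"
| "eval_exp (EHd a) s = hd_tree (eval_exp a s)"
| "eval_exp (ETl a) s = tl_tree (eval_exp a s)"
| "eval_exp (EEq a b) s = (if eval_exp a s = eval_exp b s then Node Leaf Leaf else Leaf)"

fun cost_exp :: "exp \<Rightarrow> state \<Rightarrow> nat" where
  "cost_exp (EVar x) s = tsize (s x)"
| "cost_exp ELeaf s = 1"
| "cost_exp (ECons a b) s = 1 + cost_exp a s + cost_exp b s"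
| "cost_exp (EHd a) s = 1 + cost_exp a s"
| "cost_exp (ETl a) s = 1 + cost_exp a s"
| "cost_exp (EEq a b) s = 1 + cost_exp a s + cost_exp b s"

datatype com = Assign nat exp | Seq com com | If exp com com | While exp com

text \<open>\<open>exec c s t s'\<close>: started in \<open>s\<close>, the program \<open>c\<close> halts in \<open>s'\<close> after time \<open>t\<close>.
  \<open>Leaf\<close> is the truth value false, every other tree is true.\<close>

inductive exec :: "com \<Rightarrow> state \<Rightarrow> nat \<Rightarrow> state \<Rightarrow> bool" where
  Assign: "exec (Assign x e) s (1 + cost_exp e s) (s(x := eval_exp e s))"
| Seq: "exec c1 s t1 s' \<Longrightarrow> exec c2 s' t2 s'' \<Longrightarrow> exec (Seq c1 c2) s (t1 + t2) s''"
| IfTrue: "eval_exp e s \<noteq> Leaf \<Longrightarrow> exec c1 s t s' \<Longrightarrow>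
    exec (If e c1 c2) s (1 + cost_exp e s + t) s'"
| IfFalse: "eval_exp e s = Leaf \<Longrightarrow> exec c2 s t s' \<Longrightarrow>
    exec (If e c1 c2) s (1 + cost_exp e s + t) s'"
| WhileFalse: "eval_exp e s = Leaf \<Longrightarrow> exec (While e c) s (1 + cost_exp e s) s"
| WhileTrue: "eval_exp e s \<noteq> Leaf \<Longrightarrow> exec c s t1 s' \<Longrightarrow> exec (While e c) s' t2 s'' \<Longrightarrow>
    exec (While e c) s (1 + cost_exp e s + t1 + t2) s''"

text \<open>Input and output are passed in variable 0; all other variables are initially \<open>Leaf\<close>.\<close>

definition runs :: "com \<Rightarrow> tree \<Rightarrow> nat \<Rightarrow> tree \<Rightarrow> bool" where
  "runs c x t y \<longleftrightarrow> (\<exists>s. exec c ((\<lambda>_. Leaf)(0 := x)) t s \<and> s 0 = y)"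


section \<open>Encodings\<close>

fun enc_list :: "('a \<Rightarrow> tree) \<Rightarrow> 'a list \<Rightarrow> tree" where
  "enc_list f [] = Leaf"
| "enc_list f (x # xs) = Node (f x) (enc_list f xs)"

fun unary :: "nat \<Rightarrow> tree" where
  "unary 0 = Leaf"
| "unary (Suc n) = Node Leaf (unary n)"

text \<open>Binary numerals, least significant bit first, without leading zeros.\<close>

fun binary :: "nat \<Rightarrow> tree" where
  "binary n = (if n = 0 then Leaf
     else Node (if odd n then Node Leaf Leaf else Leaf) (binary (n div 2)))"

declare binary.simps [simp del]


section \<open>Parameterized problems and fpt-reductions\<close>

text \<open>
  A parameterized problem is a pair of a language and a parameterization. The latter need not be
  polynomial-time computable, which admits structural parameters such as treewidth.
\<close>

type_synonym pproblem = "tree set \<times> (tree \<Rightarrow> nat)"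

text \<open>
  The problem over a type of instances: \<open>enc\<close> must be injective on the \<open>valid\<close> instances. Trees
  that encode no valid instance are no-instances with parameter 0.
\<close>

definition pproblem_of ::
    "('i \<Rightarrow> tree) \<Rightarrow> ('i \<Rightarrow> bool) \<Rightarrow> ('i \<Rightarrow> bool) \<Rightarrow> ('i \<Rightarrow> nat) \<Rightarrow> pproblem" where
  "pproblem_of enc valid yes param =
    ({enc I | I. valid I \<and> yes I},
     \<lambda>x. if \<exists>I. valid I \<and> enc I = x then param (THE I. valid I \<and> enc I = x) else 0)"

definition computable :: "(nat \<Rightarrow> nat) \<Rightarrow> bool" where
  "computable f \<longleftrightarrow> (\<exists>c. \<forall>n. \<exists>t. runs c (unary n) t (unary (f n)))"

definition fpt_reducible :: "pproblem \<Rightarrow> pproblem \<Rightarrow> bool"  (infix "\<le>\<^sub>f\<^sub>p\<^sub>t" 50) where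
  "P \<le>\<^sub>f\<^sub>p\<^sub>t Q \<longleftrightarrow>
    (\<exists>R :: tree \<Rightarrow> tree. \<exists>c f p g. computable f \<and> computable g \<and>
      (\<forall>x. (R x \<in> fst Q \<longleftrightarrow> x \<in> fst P) \<and>
           snd Q (R x) \<le> g (snd P x) \<and>
           (\<exists>t. runs c x t (R x) \<and> t \<le> f (snd P x) * tsize x ^ p)))"


section \<open>Boolean circuits and the W-hierarchy\<close>

text \<open>
  The hierarchy is defined through weighted satisfiability of circuits of bounded weft and depth,
  as in Cygan et al., Parameterized Algorithms, 2015. Negations count towards the depth, and a
  node is large if its in-degree exceeds 2.
  A circuit is a directed acyclic graph, given as a topologically sorted list of labelled nodes
  together with its output node. Nodes are positions in the list; a label lists the in-neighbours.
\<close>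

datatype gate = Input | Neg nat | Conj "nat list" | Disj "nat list"

type_synonym circuit = "gate list \<times> nat"

fun preds :: "gate \<Rightarrow> nat list" where
  "preds Input = []"
| "preds (Neg j) = [j]"
| "preds (Conj js) = js"
| "preds (Disj js) = js"

fun wf_gate :: "nat \<Rightarrow> gate \<Rightarrow> bool" where
  "wf_gate i Input \<longleftrightarrow> True"
| "wf_gate i (Neg j) \<longleftrightarrow> j < i"
| "wf_gate i (Conj js) \<longleftrightarrow> 2 \<le> length js \<and> distinct js \<and> (\<forall>j \<in> set js. j < i)"
| "wf_gate i (Disj js) \<longleftrightarrow> 2 \<le> length js \<and> distinct js \<and> (\<forall>j \<in> set js. j < i)"

fun wf_circuit :: "circuit \<Rightarrow> bool" where
  "wf_circuit (gs, out) \<longleftrightarrow>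
    (\<forall>i < length gs. wf_gate i (gs ! i)) \<and>
    out < length gs \<and> (\<forall>g \<in> set gs. out \<notin> set (preds g))"

fun io_path :: "circuit \<Rightarrow> nat list \<Rightarrow> bool" where
  "io_path (gs, out) p \<longleftrightarrow>
    p \<noteq> [] \<and> set p \<subseteq> {..<length gs} \<and>
    (\<forall>i. Suc i < length p \<longrightarrow> p ! i \<in> set (preds (gs ! (p ! Suc i)))) \<and>
    gs ! hd p = Input \<and> last p = out"

definition depth_le :: "nat \<Rightarrow> circuit \<Rightarrow> bool" where
  "depth_le d C \<longleftrightarrow> (\<forall>p. io_path C p \<longrightarrow> length p - 1 \<le> d)"

definition large :: "gate \<Rightarrow> bool" where
  "large g \<longleftrightarrow> 2 < length (preds g)"

definition weft_le :: "nat \<Rightarrow> circuit \<Rightarrow> bool" where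
  "weft_le t C \<longleftrightarrow> (\<forall>p. io_path C p \<longrightarrow> length (filter (\<lambda>i. large (fst C ! i)) p) \<le> t)"

definition inputs :: "circuit \<Rightarrow> nat set" where
  "inputs C = {i. i < length (fst C) \<and> fst C ! i = Input}"

text \<open>\<open>S\<close> is the set of input nodes assigned true; \<open>vs\<close> are the values of the preceding nodes.\<close>

fun gate_val :: "nat set \<Rightarrow> bool list \<Rightarrow> gate \<Rightarrow> bool" where
  "gate_val S vs Input \<longleftrightarrow> length vs \<in> S"
| "gate_val S vs (Neg j) \<longleftrightarrow> \<not> vs ! j"
| "gate_val S vs (Conj js) \<longleftrightarrow> (\<forall>j \<in> set js. vs ! j)"
| "gate_val S vs (Disj js) \<longleftrightarrow> (\<exists>j \<in> set js. vs ! j)"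

definition node_vals :: "nat set \<Rightarrow> gate list \<Rightarrow> bool list" where
  "node_vals S gs = foldl (\<lambda>vs g. vs @ [gate_val S vs g]) [] gs"

definition satisfies :: "nat set \<Rightarrow> circuit \<Rightarrow> bool" where
  "satisfies S C \<longleftrightarrow> node_vals S (fst C) ! snd C"

fun enc_gate :: "gate \<Rightarrow> tree" where
  "enc_gate Input = Node (unary 0) Leaf"
| "enc_gate (Neg j) = Node (unary 1) (unary j)"
| "enc_gate (Conj js) = Node (unary 2) (enc_list unary js)"
| "enc_gate (Disj js) = Node (unary 3) (enc_list unary js)"

fun enc_wcs :: "circuit \<times> nat \<Rightarrow> tree" where
  "enc_wcs ((gs, out), k) = Node (Node (enc_list enc_gate gs) (unary out)) (unary k)"

text \<open>Weighted Circuit Satisfiability for circuits of weft at most \<open>t\<close> and depth at most \<open>d\<close>.\<close>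

definition WCS :: "nat \<Rightarrow> nat \<Rightarrow> pproblem" where
  "WCS t d = pproblem_of enc_wcs
    (\<lambda>(C, k). wf_circuit C \<and> weft_le t C \<and> depth_le d C)
    (\<lambda>(C, k). \<exists>S \<subseteq> inputs C. card S = k \<and> satisfies S C)
    (\<lambda>(C, k). k)"

definition W :: "nat \<Rightarrow> pproblem set" where
  "W t = {P. \<exists>d \<ge> 1. P \<le>\<^sub>f\<^sub>p\<^sub>t WCS t d}"

definition W_hard :: "nat \<Rightarrow> pproblem \<Rightarrow> bool" where
  "W_hard t P \<longleftrightarrow> (\<forall>Q \<in> W t. Q \<le>\<^sub>f\<^sub>p\<^sub>t P)"


section \<open>Graphs\<close>

record 'v ugraph =
  verts :: "'v set"
  edges :: "'v set set"

definition simple_graph :: "'v ugraph \<Rightarrow> bool" where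
  "simple_graph G \<longleftrightarrow> finite (verts G) \<and> (\<forall>e \<in> edges G. e \<subseteq> verts G \<and> card e = 2)"

definition path_edges :: "'v list \<Rightarrow> 'v set set" where
  "path_edges p = {{p ! i, p ! Suc i} | i. Suc i < length p}"

definition is_path :: "'v ugraph \<Rightarrow> 'v \<Rightarrow> 'v list \<Rightarrow> 'v \<Rightarrow> bool" where
  "is_path G s p t \<longleftrightarrow> p \<noteq> [] \<and> hd p = s \<and> last p = t \<and> distinct p \<and>
    set p \<subseteq> verts G \<and> path_edges p \<subseteq> edges G"

definition path_length :: "'v list \<Rightarrow> nat" where
  "path_length p = length p - 1"

definition connected :: "'v ugraph \<Rightarrow> bool" where
  "connected G \<longleftrightarrow> verts G \<noteq> {} \<and> (\<forall>u \<in> verts G. \<forall>v \<in> verts G. \<exists>p. is_path G u p v)"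

definition has_cycle :: "'v ugraph \<Rightarrow> bool" where
  "has_cycle G \<longleftrightarrow> (\<exists>u p v. is_path G u p v \<and> 3 \<le> length p \<and> {v, u} \<in> edges G)"

definition is_tree :: "'v ugraph \<Rightarrow> bool" where
  "is_tree G \<longleftrightarrow> simple_graph G \<and> connected G \<and> \<not> has_cycle G"

definition induced :: "'v ugraph \<Rightarrow> 'v set \<Rightarrow> 'v ugraph" where
  "induced G X = \<lparr>verts = verts G \<inter> X, edges = {e \<in> edges G. e \<subseteq> X}\<rparr>"

definition tree_decomposition :: "'v ugraph \<Rightarrow> nat ugraph \<Rightarrow> (nat \<Rightarrow> 'v set) \<Rightarrow> bool" where
  "tree_decomposition G T B \<longleftrightarrow>
    is_tree T \<and>
    (\<Union>x \<in> verts T. B x) = verts G \<and>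
    (\<forall>e \<in> edges G. \<exists>x \<in> verts T. e \<subseteq> B x) \<and>
    (\<forall>v \<in> verts G. connected (induced T {x. v \<in> B x}))"

definition decomposition_width :: "nat ugraph \<Rightarrow> (nat \<Rightarrow> 'v set) \<Rightarrow> nat" where
  "decomposition_width T B = Max ((\<lambda>x. card (B x)) ` verts T) - 1"

definition treewidth :: "'v ugraph \<Rightarrow> nat" where
  "treewidth G = (LEAST k. \<exists>T B. tree_decomposition G T B \<and> decomposition_width T B = k)"

definition max_degree :: "'v ugraph \<Rightarrow> nat" where
  "max_degree G = Max (insert 0 ((\<lambda>v. card {e \<in> edges G. v \<in> e}) ` verts G))"


section \<open>Unsplittable Flow\<close>

type_synonym 'v task = "'v \<times> 'v \<times> nat \<times> nat"

definition flow_routing ::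
    "'v ugraph \<Rightarrow> ('v set \<Rightarrow> nat) \<Rightarrow> nat \<Rightarrow> 'v task set \<Rightarrow> ('v task \<Rightarrow> 'v list) \<Rightarrow> bool" where
  "flow_routing G \<gamma> l T' \<rho> \<longleftrightarrow>
    (\<forall>(s, t, d, w) \<in> T'. is_path G s (\<rho> (s, t, d, w)) t \<and> path_length (\<rho> (s, t, d, w)) \<le> l) \<and>
    (\<forall>e \<in> edges G. (\<Sum>(s, t, d, w) \<in> {a \<in> T'. e \<in> path_edges (\<rho> a)}. d) \<le> \<gamma> e)"

record 'v uf_instance =
  uf_graph :: "'v ugraph"
  uf_cap :: "'v set \<Rightarrow> nat"
  uf_tasks :: "'v task set"
  uf_target :: nat
  uf_bound :: nat

definition uf_instance :: "'v uf_instance \<Rightarrow> bool" where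
  "uf_instance I \<longleftrightarrow> simple_graph (uf_graph I) \<and> finite (uf_tasks I) \<and>
    (\<forall>(s, t, d, w) \<in> uf_tasks I. s \<in> verts (uf_graph I) \<and> t \<in> verts (uf_graph I))"

definition uf_yes :: "'v uf_instance \<Rightarrow> bool" where
  "uf_yes I \<longleftrightarrow> (\<exists>T' \<subseteq> uf_tasks I. (\<exists>\<rho>. flow_routing (uf_graph I) (uf_cap I) (uf_bound I) T' \<rho>) \<and>
    uf_target I \<le> (\<Sum>(s, t, d, w) \<in> T'. w))"

definition uf_param :: "'v uf_instance \<Rightarrow> nat" where
  "uf_param I = treewidth (uf_graph I) + max_degree (uf_graph I) + uf_bound I"

text \<open>
  As an input, an instance on the vertices \<open>0, \<dots>, n - 1\<close> is presented by \<open>n\<close>, the list of edges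
  \<open>(u, v, \<gamma> {u, v})\<close>, the list of tasks, the profit target and the length bound. Vertices and
  capacities are encoded in unary, the other numbers in binary.
\<close>

type_synonym uf_code = "nat \<times> (nat \<times> nat \<times> nat) list \<times> nat task list \<times> nat \<times> nat"

fun uf_of_code :: "uf_code \<Rightarrow> nat uf_instance" where
  "uf_of_code (n, es, ts, \<tau>, l) =
    \<lparr>uf_graph = \<lparr>verts = {..<n}, edges = (\<lambda>(u, v, c). {u, v}) ` set es\<rparr>,
     uf_cap = (\<lambda>e. case map_of (map (\<lambda>(u, v, c). ({u, v}, c)) es) e of None \<Rightarrow> 0 | Some c \<Rightarrow> c),
     uf_tasks = set ts, uf_target = \<tau>, uf_bound = l\<rparr>"

fun uf_valid :: "uf_code \<Rightarrow> bool" where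
  "uf_valid (n, es, ts, \<tau>, l) \<longleftrightarrow>
    uf_instance (uf_of_code (n, es, ts, \<tau>, l)) \<and>
    distinct (map (\<lambda>(u, v, c). {u, v}) es) \<and> distinct ts"

fun enc_edge :: "nat \<times> nat \<times> nat \<Rightarrow> tree" where
  "enc_edge (u, v, c) = Node (unary u) (Node (unary v) (unary c))"

fun enc_task :: "nat task \<Rightarrow> tree" where
  "enc_task (s, t, d, w) = Node (unary s) (Node (unary t) (Node (binary d) (binary w)))"

fun enc_uf :: "uf_code \<Rightarrow> tree" where
  "enc_uf (n, es, ts, \<tau>, l) =
    Node (unary n) (Node (enc_list enc_edge es) (Node (enc_list enc_task ts)
      (Node (binary \<tau>) (binary l))))"

definition unsplittable_flow :: pproblem where
  "unsplittable_flow =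
    pproblem_of enc_uf uf_valid (\<lambda>I. uf_yes (uf_of_code I)) (\<lambda>I. uf_param (uf_of_code I))"


section \<open>The encodings are injective\<close>

lemma enc_list_inj: "inj f \<Longrightarrow> inj (enc_list f)"
proof (rule injI)
  fix xs ys assume f: "inj f" and "enc_list f xs = enc_list f ys"
  from this(2) show "xs = ys"
  proof (induction xs arbitrary: ys)
    case Nil then show ?case by (cases ys) auto
  next
    case (Cons x xs) then show ?case using f by (cases ys) (auto dest: injD)
  qed
qed

lemma unary_inj: "inj unary"
proof (rule injI)
  fix m n assume "unary m = unary n"
  then show "m = n"
  proof (induction m arbitrary: n)
    case 0 then show ?case by (cases n) auto
  next
    case (Suc m) then show ?case by (cases n) auto
  qed
qed

lemma binary_inj: "inj binary"
proof (rule injI)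
  fix m n assume "binary m = binary n"
  then show "m = n"
  proof (induction m arbitrary: n rule: less_induct)
    case (less m)
    show ?case
    proof (cases "m = 0 \<or> n = 0")
      case True
      then show ?thesis
        using less.prems by (auto simp: binary.simps[of m] binary.simps[of n] split: if_splits)
    next
      case False
      then have "odd m = odd n" "binary (m div 2) = binary (n div 2)"
        using less.prems by (auto simp: binary.simps[of m] binary.simps[of n] split: if_splits)
      moreover from this(2) have "m div 2 = n div 2"
        using False less.IH by simp
      ultimately show ?thesis by presburger
    qed
  qed
qed

lemma enc_gate_inj: "inj enc_gate"
proof (rule injI)
  fix g h assume "enc_gate g = enc_gate h"
  then show "g = h"
    using injD[OF unary_inj] injD[OF enc_list_inj[OF unary_inj]]
    by (cases g; cases h) (auto simp: numeral_eq_Suc)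
qed

lemma enc_wcs_inj: "inj enc_wcs"
  using injD[OF unary_inj] injD[OF enc_list_inj[OF enc_gate_inj]] by (auto intro!: injI)

lemma enc_edge_inj: "inj enc_edge"
  using injD[OF unary_inj] by (auto intro!: injI)

lemma enc_task_inj: "inj enc_task"
  using injD[OF unary_inj] injD[OF binary_inj] by (auto intro!: injI)

lemma enc_uf_inj: "inj enc_uf"
  using injD[OF unary_inj] injD[OF binary_inj]
    injD[OF enc_list_inj[OF enc_edge_inj]] injD[OF enc_list_inj[OF enc_task_inj]]
  by (auto intro!: injI)

lemma snd_pproblem_of:
  assumes "inj enc" "valid I"
  shows "snd (pproblem_of enc valid yes param) (enc I) = param I"
proof -
  have "(THE J. valid J \<and> enc J = enc I) = I"
    using assms by (auto dest: injD)
  then show ?thesis using assms(2) by (auto simp: pproblem_of_def)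
qed

end

theory Submission
  imports Defs
begin

text \<open>
  A weft-1 circuit of bounded depth is true iff one of polynomially many conjunctions holds, and
  each of them fails only through conjunctions of boundedly many input literals. Choosing the
  conjunction and the \<open>k\<close> true inputs, sorted, is therefore a constraint problem with polynomially
  many values and constraints of bounded arity, hence a binary one over tuples of the original
  variables. Binary constraints on \<open>m\<close> variables are laid out on an \<open>m \<times> m\<close> grid whose cells are
  the leaf edges of a star. Row and column tasks carry the values from cell to cell as digits of
  their demands, a cell task completes each permitted pair of values to the capacity, and the
  profit target forces every edge to be saturated. The star has \<open>m\<^sup>2 + 1\<close> vertices, where \<open>m\<close>
  depends on \<open>k\<close> only, which bounds treewidth, degree and route length.
\<close>


section \<open>Polynomial time on encoded data\<close>

text \<open>The circuit depth \<open>d\<close> is fixed with the source problem, so everything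
  exponential in \<open>d\<close> is a constant: normal forms stay polynomial, and the tuples have
  the constant length \<open>2 * 2 ^ d + 1\<close>. That number counts the facts needed to expose a
  contradiction: a conjunction of at most \<open>2 ^ d\<close> literals, each settled by at most two
  consecutive slots, together with the slot naming the chosen alternative. The parameter may depend
  on \<open>k\<close> and \<open>d\<close> alone, so the number of values, which grows with the
  circuit, must not influence the graph; it enters only through the tasks and the capacities. Unary
  capacities do no harm, because five digits in a base polynomial in the number of values suffice. A
  star offers only one route per task, so all choices lie in the selection of tasks. Running time
  refers to a concrete language, so the reduction is assembled from functions shown polynomial by
  closure rules instead of being written as one program.\<close>

definition polyb :: "(nat \<Rightarrow> nat) \<Rightarrow> bool" where
  "polyb f \<longleftrightarrow> (\<exists>p. \<forall>n. f n \<le> p * (n + 1) ^ p)"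

lemma poly_bound_mono:
  assumes "p \<le> q" "m \<le> n"
  shows "p * (m + 1) ^ p \<le> q * (n + 1) ^ (q::nat)"
proof -
  have "(m + 1) ^ p \<le> (n + 1) ^ p" using assms by (simp add: power_mono)
  also have "\<dots> \<le> (n + 1) ^ q" using assms by (intro power_increasing) auto
  finally show ?thesis using assms by (intro mult_mono) auto
qed

text \<open>Bounds get evaluated at mere upper estimates of sizes, which calls for a monotone
  majorant; \<open>polyb\<close> alone admits oscillating functions.\<close>

lemma polybE:
  assumes "polyb f"
  obtains g where "polyb g" "mono g" "\<And>n. f n \<le> g n"
proof -
  obtain p where p: "f n \<le> p * (n + 1) ^ p" for n using assms by (auto simp: polyb_def)
  show thesis
  proof (rule that)
    show "polyb (\<lambda>n. p * (n + 1) ^ p)" by (auto simp: polyb_def)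
    show "mono (\<lambda>n. p * (n + 1) ^ p)" using poly_bound_mono[of p p] by (auto intro!: monoI)
  qed (rule p)
qed

lemma polyb_le: "polyb g \<Longrightarrow> (\<And>n. f n \<le> g n) \<Longrightarrow> polyb f"
  unfolding polyb_def by (meson order_trans)

lemma polyb_const: "polyb (\<lambda>_. c)"
proof -
  have "c \<le> c * (n + 1) ^ c" for n :: nat by simp
  then show ?thesis unfolding polyb_def by blast
qed

lemma polyb_id: "polyb (\<lambda>n. n)"
  unfolding polyb_def by (rule exI[of _ 1]) auto

lemma polyb_add: assumes "polyb f" "polyb g" shows "polyb (\<lambda>n. f n + g n)"
proof -
  obtain p q where p: "\<And>n. f n \<le> p * (n + 1) ^ p" and q: "\<And>n. g n \<le> q * (n + 1) ^ q"
    using assms by (auto simp: polyb_def)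
  have "f n + g n \<le> (p + q) * (n + 1) ^ (p + q)" for n
  proof -
    have "f n + g n \<le> p * (n + 1) ^ p + q * (n + 1) ^ q" using p q by (simp add: add_mono)
    also have "\<dots> \<le> p * (n + 1) ^ (p + q) + q * (n + 1) ^ (p + q)"
      by (intro add_mono mult_left_mono power_increasing) auto
    finally show ?thesis by (simp add: algebra_simps)
  qed
  then show ?thesis unfolding polyb_def by blast
qed

lemma polyb_mult: assumes "polyb f" "polyb g" shows "polyb (\<lambda>n. f n * g n)"
proof -
  obtain p q where p: "\<And>n. f n \<le> p * (n + 1) ^ p" and q: "\<And>n. g n \<le> q * (n + 1) ^ q"
    using assms by (auto simp: polyb_def)
  have "f n * g n \<le> (p * q + p + q) * (n + 1) ^ (p * q + p + q)" for n
  proof -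
    have "f n * g n \<le> (p * (n + 1) ^ p) * (q * (n + 1) ^ q)" using p q by (simp add: mult_mono)
    also have "\<dots> = (p * q) * (n + 1) ^ (p + q)" by (simp add: power_add)
    also have "\<dots> \<le> (p * q + p + q) * (n + 1) ^ (p * q + p + q)"
      by (intro mult_mono power_increasing) auto
    finally show ?thesis .
  qed
  then show ?thesis unfolding polyb_def by blast
qed

lemma polyb_power: assumes "polyb f" shows "polyb (\<lambda>n. f n ^ k)"
  using assms by (induction k) (auto intro: polyb_mult polyb_const)

lemma polyb_comp: assumes "polyb f" "polyb g" shows "polyb (\<lambda>n. f (g n))"
proof -
  obtain p where p: "\<And>n. f n \<le> p * (n + 1) ^ p" using assms by (auto simp: polyb_def)
  have "polyb (\<lambda>n. p * (g n + 1) ^ p)"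
    by (intro polyb_mult polyb_power polyb_add polyb_const assms)
  then show ?thesis by (rule polyb_le) (rule p)
qed

lemma polyb_Suc: "polyb f \<Longrightarrow> polyb (\<lambda>n. Suc (f n))"
  using polyb_add[of f "\<lambda>_. 1"] polyb_const by simp

lemmas polyb_intros = polyb_Suc[OF polyb_id] polyb_Suc polyb_const polyb_id polyb_add polyb_mult polyb_power


section \<open>Types encoded as trees\<close>

class encodable =
  fixes tr :: "'a \<Rightarrow> tree"
  assumes tr_inj: "tr x = tr y \<Longrightarrow> x = y"

abbreviation sz :: "'a::encodable \<Rightarrow> nat" where "sz a \<equiv> tsize (tr a)"

instantiation tree :: encodable
begin
definition tr_tree :: "tree \<Rightarrow> tree" where [simp]: "tr_tree t = t"
instance by standard simp
end

instantiation unit :: encodable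
begin
definition tr_unit :: "unit \<Rightarrow> tree" where [simp]: "tr_unit u = Leaf"
instance by standard simp
end

instantiation bool :: encodable
begin
definition tr_bool :: "bool \<Rightarrow> tree" where [simp]: "tr_bool b = (if b then Node Leaf Leaf else Leaf)"
instance by standard (auto split: if_splits)
end

text \<open>Unary, so polynomial time on numbers means polynomial in their value; this agrees with
  the encoding of vertices and capacities.\<close>

instantiation nat :: encodable
begin
definition tr_nat :: "nat \<Rightarrow> tree" where [simp]: "tr_nat = unary"
instance by standard (auto dest: injD[OF unary_inj])
end

instantiation prod :: (encodable, encodable) encodable
begin
definition tr_prod :: "'a \<times> 'b \<Rightarrow> tree" where [simp]: "tr_prod p = Node (tr (fst p)) (tr (snd p))"
instance by standard (auto simp: prod_eq_iff dest: tr_inj)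
end

instantiation list :: (encodable) encodable
begin
definition tr_list :: "'a list \<Rightarrow> tree" where [simp]: "tr_list = enc_list tr"
instance
proof
  have "inj (tr :: 'a \<Rightarrow> tree)" by (auto intro: injI tr_inj)
  then show "tr (x :: 'a list) = tr y \<Longrightarrow> x = y" for x y
    by (auto dest: injD[OF enc_list_inj])
qed
end

instantiation gate :: encodable
begin
definition tr_gate :: "gate \<Rightarrow> tree" where [simp]: "tr_gate = enc_gate"
instance by standard (auto dest: injD[OF enc_gate_inj])
end

lemma tsize_pos [simp]: "0 < tsize t" by (cases t) auto

lemma tsize_unary [simp]: "tsize (unary n) = 2 * n + 1" by (induction n) auto

lemma length_le_tsize: "length xs \<le> tsize (enc_list f xs)"
  by (induction xs) auto

lemma tsize_enc_list: "tsize (enc_list f xs) = 1 + (\<Sum>x\<leftarrow>xs. tsize (f x) + 1)"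
  by (induction xs) auto

lemma tsize_eval_exp: "tsize (eval_exp e s) \<le> cost_exp e s"
proof (induction e)
  case (EHd e) then show ?case by (cases "eval_exp e s") auto
next
  case (ETl e) then show ?case by (cases "eval_exp e s") auto
next
  case (EEq a b)
  have "0 < cost_exp e s" for e by (induction e) auto
  from this[of a] this[of b] show ?case by simp
qed auto

text \<open>Evaluating an expression costs at least the size of its value. This converts bounds on
  running time into bounds on size.\<close>

lemma tsize_exec: "exec c s t s' \<Longrightarrow> tsize (s' v) \<le> tsize (s v) + t"
proof (induction rule: exec.induct)
  case (Assign x e s)
  then show ?case using tsize_eval_exp[of e s] by auto
qed auto

section \<open>Total correctness with time budgets\<close>

definition run :: "com \<Rightarrow> state \<Rightarrow> nat \<Rightarrow> (state \<Rightarrow> bool) \<Rightarrow> bool" where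
  "run c s b P \<longleftrightarrow> (\<exists>t s'. exec c s t s' \<and> t \<le> b \<and> P s')"

lemma run_conseq: "run c s b P \<Longrightarrow> b \<le> b' \<Longrightarrow> (\<And>s'. P s' \<Longrightarrow> Q s') \<Longrightarrow> run c s b' Q"
  unfolding run_def by fastforce

lemma run_Assign: "P (s(x := eval_exp e s)) \<Longrightarrow> run (Assign x e) s (1 + cost_exp e s) P"
  unfolding run_def using exec.Assign by blast

lemma run_Seq: "run c1 s b1 (\<lambda>s'. run c2 s' b2 P) \<Longrightarrow> run (Seq c1 c2) s (b1 + b2) P"
  unfolding run_def by (meson add_mono exec.Seq)

lemma run_Seq_Assign:
  "run c (s(x := eval_exp e s)) b P \<Longrightarrow> run (Seq (Assign x e) c) s (1 + cost_exp e s + b) P"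
  by (intro run_Seq run_Assign)

lemma run_If:
  assumes "eval_exp e s \<noteq> Leaf \<Longrightarrow> run c1 s b P" "eval_exp e s = Leaf \<Longrightarrow> run c2 s b P"
  shows "run (If e c1 c2) s (1 + cost_exp e s + b) P"
proof (cases "eval_exp e s = Leaf")
  case True
  from assms(2)[OF True] obtain t s' where r: "exec c2 s t s'" "t \<le> b" "P s'" by (auto simp: run_def)
  with exec.IfFalse[OF True r(1)] show ?thesis unfolding run_def by fastforce
next
  case False
  from assms(1)[OF False] obtain t s' where r: "exec c1 s t s'" "t \<le> b" "P s'" by (auto simp: run_def)
  with exec.IfTrue[OF False r(1)] show ?thesis unfolding run_def by fastforce
qed

lemma run_While_False: "eval_exp e s = Leaf \<Longrightarrow> P s \<Longrightarrow> run (While e c) s (1 + cost_exp e s) P"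
  unfolding run_def using exec.WhileFalse by blast

lemma run_While_True:
  assumes "eval_exp e s \<noteq> Leaf" "run c s b1 (\<lambda>s'. run (While e c) s' b2 P)"
  shows "run (While e c) s (1 + cost_exp e s + b1 + b2) P"
proof -
  from assms(2) obtain t1 s' t2 s'' where r: "exec c s t1 s'" "t1 \<le> b1"
    "exec (While e c) s' t2 s''" "t2 \<le> b2" "P s''" by (auto simp: run_def)
  show ?thesis unfolding run_def
    by (intro exI conjI, rule exec.WhileTrue[OF assms(1) r(1,3)]) (use r in auto)
qed

text \<open>The start state is arbitrary except for variable 0, and variables from \<open>K\<close> on survive:
  this makes programs composable without clearing scratch variables.\<close>

definition pt :: "('a::encodable \<Rightarrow> 'b::encodable) \<Rightarrow> bool" where
  "pt f \<longleftrightarrow> (\<exists>c K b. 1 \<le> K \<and> polyb b \<and> (\<forall>a s. s 0 = tr a \<longrightarrow>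
     run c s (b (sz a)) (\<lambda>s'. s' 0 = tr (f a) \<and> (\<forall>v\<ge>K. s' v = s v))))"

section \<open>Closure rules for polynomial time\<close>

named_theorems pt_intros

lemma ptI:
  assumes "1 \<le> K" "polyb b"
    "\<And>a s. s 0 = tr a \<Longrightarrow> run c s (b (sz a)) (\<lambda>s'. s' 0 = tr (f a) \<and> (\<forall>v\<ge>K. s' v = s v))"
  shows "pt f"
  unfolding pt_def using assms by blast

lemma ptE:
  assumes "pt f"
  obtains c K b where "1 \<le> K" "polyb b" "mono b"
    "\<And>a s. s 0 = tr a \<Longrightarrow> run c s (b (sz a)) (\<lambda>s'. s' 0 = tr (f a) \<and> (\<forall>v\<ge>K. s' v = s v))"
proof -
  from assms obtain c K b where r: "1 \<le> K" "polyb b"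
    "\<And>a s. s 0 = tr a \<Longrightarrow> run c s (b (sz a)) (\<lambda>s'. s' 0 = tr (f a) \<and> (\<forall>v\<ge>K. s' v = s v))"
    unfolding pt_def by blast
  obtain g where g: "polyb g" "mono g" "\<And>n. b n \<le> g n" using r(2) by (rule polybE) blast
  show thesis
    by (rule that[OF r(1) g(1,2)]) (rule run_conseq[OF r(3) g(3)], auto)
qed

text \<open>By \<open>tsize_exec\<close>, variable 0 grows by at most the running time. Composition
  depends on this, since the second program is charged for the size of an intermediate
  result.\<close>

lemma pt_size:
  assumes "pt f"
  obtains b where "polyb b" "mono b" "\<And>a. sz (f a) \<le> b (sz a)"
proof -
  obtain c K b where r: "polyb b" "mono b"
    "\<And>a s. s 0 = tr a \<Longrightarrow> run c s (b (sz a)) (\<lambda>s'. s' 0 = tr (f a) \<and> (\<forall>v\<ge>K. s' v = s v))"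
    using assms by (rule ptE) blast
  show thesis
  proof (rule that)
    show "polyb (\<lambda>n. n + b n)" by (intro polyb_intros r)
    show "mono (\<lambda>n. n + b n)" using r(2) by (auto simp: mono_def add_mono)
    fix a :: 'a
    let ?s = "(\<lambda>_. Leaf)(0 := tr a) :: state"
    have "?s 0 = tr a" by simp
    from r(3)[of ?s a, OF this] obtain t s' where "exec c ?s t s'" "t \<le> b (sz a)" "s' 0 = tr (f a)"
      by (auto simp: run_def)
    with tsize_exec[OF this(1), of 0] show "sz (f a) \<le> sz a + b (sz a)" by simp
  qed
qed

lemma pt_exp:
  fixes f :: "'a::encodable \<Rightarrow> 'b::encodable"
  assumes "polyb b" "\<And>a s. s 0 = tr a \<Longrightarrow> eval_exp e s = tr (f a)"
    "\<And>a s. s 0 = tr (a :: 'a) \<Longrightarrow> cost_exp e s \<le> b (sz a)"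
  shows "pt f"
proof (rule ptI[where K = 1 and b = "\<lambda>n. 1 + b n"])
  show "polyb (\<lambda>n. 1 + b n)" by (intro polyb_intros assms)
  show "run (Assign 0 e) s (1 + b (sz a)) (\<lambda>s'. s' 0 = tr (f a) \<and> (\<forall>v\<ge>1. s' v = s v))"
    if "s 0 = tr a" for s :: state and a :: 'a
    by (rule run_conseq[OF run_Assign[where P = "\<lambda>s'. s' 0 = tr (f a) \<and> (\<forall>v\<ge>1. s' v = s v)"]])
       (use that assms in auto)
qed simp

text \<open>Some operations change only the type and leave the tree as it is: consing is pairing,
  and a unary number is a list of units.\<close>

lemma pt_recast: assumes "\<And>a. tr (f a) = tr a" shows "pt f"
  by (rule pt_exp[where e = "EVar 0" and b = "\<lambda>n. n"]) (auto simp: assms polyb_id)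

lemma pt_id [pt_intros]: "pt (\<lambda>a. a)" by (rule pt_recast) simp

fun const_exp :: "tree \<Rightarrow> exp" where
  "const_exp Leaf = ELeaf"
| "const_exp (Node l r) = ECons (const_exp l) (const_exp r)"

lemma eval_const_exp [simp]: "eval_exp (const_exp t) s = t" by (induction t) auto
lemma cost_const_exp [simp]: "cost_exp (const_exp t) s = tsize t" by (induction t) auto

lemma pt_const [pt_intros]: "pt (\<lambda>_. c)"
  by (rule pt_exp[where e = "const_exp (tr c)" and b = "\<lambda>_. sz c"]) (auto simp: polyb_const)

lemma pt_comp:
  fixes f :: "'a::encodable \<Rightarrow> 'b::encodable" and g :: "'b \<Rightarrow> 'c::encodable"
  assumes "pt g" "pt f"
  shows "pt (\<lambda>a. g (f a))"
proof -
  obtain c1 K1 b1 where 1: "1 \<le> K1" "polyb b1" "mono b1"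
    "\<And>a s. s 0 = tr a \<Longrightarrow> run c1 s (b1 (sz a)) (\<lambda>s'. s' 0 = tr (f a) \<and> (\<forall>v\<ge>K1. s' v = s v))"
    using \<open>pt f\<close> by (rule ptE) blast
  obtain c2 K2 b2 where 2: "1 \<le> K2" "polyb b2" "mono b2"
    "\<And>a s. s 0 = tr a \<Longrightarrow> run c2 s (b2 (sz a)) (\<lambda>s'. s' 0 = tr (g a) \<and> (\<forall>v\<ge>K2. s' v = s v))"
    using \<open>pt g\<close> by (rule ptE) blast
  obtain q where q: "polyb q" "mono q" "\<And>a. sz (f a) \<le> q (sz a)" using \<open>pt f\<close> by (rule pt_size) blast
  show ?thesis
  proof (rule ptI[where K = "K1 + K2" and b = "\<lambda>n. b1 n + b2 (q n)"])
    fix a :: 'a and s :: state assume s: "s 0 = tr a"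
    show "run (Seq c1 c2) s (b1 (sz a) + b2 (q (sz a)))
      (\<lambda>s'. s' 0 = tr (g (f a)) \<and> (\<forall>v\<ge>K1 + K2. s' v = s v))"
    proof (rule run_Seq, rule run_conseq[OF 1(4)[of s a, OF s] order_refl])
      fix s' assume s': "s' 0 = tr (f a) \<and> (\<forall>v\<ge>K1. s' v = s v)"
      show "run c2 s' (b2 (q (sz a))) (\<lambda>s'. s' 0 = tr (g (f a)) \<and> (\<forall>v\<ge>K1 + K2. s' v = s v))"
        by (rule run_conseq[OF 2(4)]) (use s' q(3) 2(3) in \<open>auto dest: monoD\<close>)
    qed
  qed (use 1 2 q in \<open>auto intro: polyb_intros polyb_comp\<close>)
qed

lemma pt_pair [pt_intros]:
  fixes f :: "'a::encodable \<Rightarrow> 'b::encodable" and g :: "'a \<Rightarrow> 'c::encodable"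
  assumes "pt f" "pt g"
  shows "pt (\<lambda>a. (f a, g a))"
proof -
  obtain c1 K1 b1 where 1: "1 \<le> K1" "polyb b1" "mono b1"
    "\<And>a s. s 0 = tr a \<Longrightarrow> run c1 s (b1 (sz a)) (\<lambda>s'. s' 0 = tr (f a) \<and> (\<forall>v\<ge>K1. s' v = s v))"
    using \<open>pt f\<close> by (rule ptE) blast
  obtain c2 K2 b2 where 2: "1 \<le> K2" "polyb b2" "mono b2"
    "\<And>a s. s 0 = tr a \<Longrightarrow> run c2 s (b2 (sz a)) (\<lambda>s'. s' 0 = tr (g a) \<and> (\<forall>v\<ge>K2. s' v = s v))"
    using \<open>pt g\<close> by (rule ptE) blast
  obtain q1 where q1: "polyb q1" "mono q1" "\<And>a. sz (f a) \<le> q1 (sz a)"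
    using \<open>pt f\<close> by (rule pt_size) blast
  obtain q2 where q2: "polyb q2" "mono q2" "\<And>a. sz (g a) \<le> q2 (sz a)"
    using \<open>pt g\<close> by (rule pt_size) blast
  \<comment> \<open>Above the scratch variables of both programs: \<open>K\<close> keeps the input
    while \<open>c1\<close> runs, and \<open>K + 1\<close> keeps the first result while
    \<open>c2\<close> runs.\<close>
  define K where "K = K1 + K2"
  define c where "c = Seq (Assign K (EVar 0)) (Seq c1 (Seq (Assign (K+1) (EVar 0))
    (Seq (Assign 0 (EVar K)) (Seq c2 (Assign 0 (ECons (EVar (K+1)) (EVar 0)))))))"
  show ?thesis
  proof (rule ptI[where K = "K + 2"])
    show "polyb (\<lambda>n. (1 + n) + (b1 n + ((1 + q1 n) + ((1 + n) + (b2 n + (2 + q1 n + q2 n))))))"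
      by (intro polyb_intros 1 2 q1 q2)
    fix a :: 'a and s :: state assume s: "s 0 = tr a"
    show "run c s ((1 + sz a) + (b1 (sz a) + ((1 + q1 (sz a)) + ((1 + sz a) + (b2 (sz a) +
         (2 + q1 (sz a) + q2 (sz a)))))))
        (\<lambda>s'. s' 0 = tr (f a, g a) \<and> (\<forall>v\<ge>K + 2. s' v = s v))" (is "run _ _ _ ?P")
      unfolding c_def
    proof (rule run_conseq[OF run_Seq_Assign])
      define s1 where "s1 = s(K := tr a)"
      have s1: "s1 0 = tr a" "s1 K = tr a" using s 1(1) by (auto simp: s1_def K_def)
      show "run (Seq c1 (Seq (Assign (K+1) (EVar 0))
          (Seq (Assign 0 (EVar K)) (Seq c2 (Assign 0 (ECons (EVar (K+1)) (EVar 0)))))))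
        (s(K := eval_exp (EVar 0) s)) (b1 (sz a) + ((1 + q1 (sz a)) + ((1 + sz a) + (b2 (sz a) +
         (2 + q1 (sz a) + q2 (sz a)))))) ?P"
      proof (rule run_Seq, rule run_conseq[OF 1(4) order_refl])
        show "(s(K := eval_exp (EVar 0) s)) 0 = tr a" using s1 s by (simp add: s1_def)
        fix s2 assume s2: "s2 0 = tr (f a) \<and> (\<forall>v\<ge>K1. s2 v = (s(K := eval_exp (EVar 0) s)) v)"
        then have s2K: "s2 K = tr a" "\<And>v. v \<ge> K + 2 \<Longrightarrow> s2 v = s v" using s by (auto simp: K_def)
        show "run (Seq (Assign (K+1) (EVar 0))
          (Seq (Assign 0 (EVar K)) (Seq c2 (Assign 0 (ECons (EVar (K+1)) (EVar 0)))))) s2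
          ((1 + q1 (sz a)) + ((1 + sz a) + (b2 (sz a) + (2 + q1 (sz a) + q2 (sz a))))) ?P"
        proof (rule run_conseq[OF run_Seq_Assign[OF run_Seq_Assign[OF run_Seq]]])
          show "run c2 (s2(K + 1 := eval_exp (EVar 0) s2, 0 := eval_exp (EVar K) (s2(K + 1 := eval_exp (EVar 0) s2))))
             (b2 (sz a)) (\<lambda>s'. run (Assign 0 (ECons (EVar (K+1)) (EVar 0))) s' (2 + q1 (sz a) + q2 (sz a)) ?P)"
          proof (rule run_conseq[OF 2(4) order_refl])
            fix s3 assume s3: "s3 0 = tr (g a) \<and> (\<forall>v\<ge>K2. s3 v = (s2(K + 1 := eval_exp (EVar 0) s2,
              0 := eval_exp (EVar K) (s2(K + 1 := eval_exp (EVar 0) s2)))) v)"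
            then have s3': "s3 (K+1) = tr (f a)" "\<And>v. v \<ge> K + 2 \<Longrightarrow> s3 v = s v"
              using s2 s2K by (auto simp: K_def)
            show "run (Assign 0 (ECons (EVar (K+1)) (EVar 0))) s3 (2 + q1 (sz a) + q2 (sz a)) ?P"
              by (rule run_conseq[OF run_Assign[where P = ?P]])
                 (use s3 s3' q1(3)[of a] q2(3)[of a] in auto)
          qed (use s2K in auto)
        qed (use s2 s2K q1(3)[of a] in auto)
      qed
    qed (use s in auto)
  qed simp
qed

lemma pt_fst: "pt fst"
  by (rule pt_exp[where e = "EHd (EVar 0)" and b = "\<lambda>n. 1 + n"]) (auto intro!: polyb_intros)

lemma pt_snd: "pt snd"
  by (rule pt_exp[where e = "ETl (EVar 0)" and b = "\<lambda>n. 1 + n"]) (auto intro!: polyb_intros)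

lemma pt_cons: "pt (\<lambda>p. fst p # snd p)"
  by (rule pt_recast) simp

lemma pt_eq: "pt (\<lambda>p. fst p = snd p)"
  by (rule pt_exp[where e = "EEq (EHd (EVar 0)) (ETl (EVar 0))" and b = "\<lambda>n. 3 + n + n"])
     (auto intro!: polyb_intros dest: tr_inj simp: eval_nat_numeral)

lemma pt_tree_Node: "pt (\<lambda>p. Node (fst p) (snd p))"
  by (rule pt_recast) simp

lemma pt_comp2:
  assumes "pt (\<lambda>p. g (fst p) (snd p))" "pt f1" "pt f2"
  shows "pt (\<lambda>a. g (f1 a) (f2 a))"
  using pt_comp[OF assms(1) pt_pair[OF assms(2,3)]] by simp

lemma pt_comp3:
  assumes "pt (\<lambda>p. g (fst p) (fst (snd p)) (snd (snd p)))" "pt f1" "pt f2" "pt f3"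
  shows "pt (\<lambda>a. g (f1 a) (f2 a) (f3 a))"
  using pt_comp[OF assms(1) pt_pair[OF assms(2) pt_pair[OF assms(3,4)]]] by simp

lemmas [pt_intros] = pt_comp[OF pt_fst] pt_comp[OF pt_snd] pt_comp2[OF pt_cons] pt_comp2[OF pt_eq]
  pt_comp2[OF pt_tree_Node]

lemma pt_case_prod [pt_intros]:
  "pt (\<lambda>a. h a (fst (g a)) (snd (g a))) \<Longrightarrow> pt (\<lambda>a. case_prod (h a) (g a))"
  by (simp add: case_prod_beta)

lemma pt_if [pt_intros]:
  fixes f :: "'a::encodable \<Rightarrow> 'b::encodable"
  assumes "pt c" "pt f" "pt g"
  shows "pt (\<lambda>a. if c a then f a else g a)"
proof -
  obtain c1 K1 b1 where 1: "1 \<le> K1" "polyb b1" "mono b1"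
    "\<And>a s. s 0 = tr a \<Longrightarrow> run c1 s (b1 (sz a)) (\<lambda>s'. s' 0 = tr (f a) \<and> (\<forall>v\<ge>K1. s' v = s v))"
    using \<open>pt f\<close> by (rule ptE) blast
  obtain c2 K2 b2 where 2: "1 \<le> K2" "polyb b2" "mono b2"
    "\<And>a s. s 0 = tr a \<Longrightarrow> run c2 s (b2 (sz a)) (\<lambda>s'. s' 0 = tr (g a) \<and> (\<forall>v\<ge>K2. s' v = s v))"
    using \<open>pt g\<close> by (rule ptE) blast
  \<comment> \<open>Pairing the test with the identity lets the argument outlive its
    evaluation.\<close>
  obtain c0 K0 b0 where 0: "1 \<le> K0" "polyb b0" "mono b0"
    "\<And>a s. s 0 = tr a \<Longrightarrow> run c0 s (b0 (sz a))
      (\<lambda>s'. s' 0 = tr ((\<lambda>a. (c a, a)) a) \<and> (\<forall>v\<ge>K0. s' v = s v))"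
    using pt_pair[OF \<open>pt c\<close> pt_id] by (rule ptE) blast
  define K where "K = K0 + K1 + K2"
  define p where "p = Seq c0 (Seq (Assign K (EHd (EVar 0))) (Seq (Assign 0 (ETl (EVar 0)))
      (If (EVar K) c1 c2)))"
  show ?thesis
  proof (rule ptI[where K = "K + 1"])
    show "polyb (\<lambda>n. b0 n + ((6 + n) + ((6 + n) + (4 + (b1 n + b2 n)))))"
      by (intro polyb_intros 0 1 2)
    fix a :: 'a and s :: state assume s: "s 0 = tr a"
    show "run p s (b0 (sz a) + ((6 + sz a) + ((6 + sz a) + (4 + (b1 (sz a) + b2 (sz a))))))
        (\<lambda>s'. s' 0 = tr (if c a then f a else g a) \<and> (\<forall>v\<ge>K + 1. s' v = s v))" (is "run _ _ _ ?P")
      unfolding p_def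
    proof (rule run_Seq, rule run_conseq[OF 0(4)[of s a, OF s] order_refl])
      fix s1 assume s1: "s1 0 = tr (c a, a) \<and> (\<forall>v\<ge>K0. s1 v = s v)"
      define s2 where "s2 = s1(K := tr (c a), 0 := tr a)"
      have s2: "s2 0 = tr a" "s2 K = tr (c a)" "\<And>v. v \<ge> K + 1 \<Longrightarrow> s2 v = s v"
        using s1 0(1) by (auto simp: s2_def K_def)
      have e: "s1(K := eval_exp (EHd (EVar 0)) s1,
          0 := eval_exp (ETl (EVar 0)) (s1(K := eval_exp (EHd (EVar 0)) s1))) = s2"
        using s1 0(1) by (auto simp: s2_def K_def)
      have tb: "tsize (tr (b :: bool)) \<le> 3" for b by simp
      have i: "run (If (EVar K) c1 c2) s2 (1 + cost_exp (EVar K) s2 + (b1 (sz a) + b2 (sz a))) ?P"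
      proof (rule run_If)
        assume "eval_exp (EVar K) s2 \<noteq> Leaf"
        then have "c a" using s2 by (auto split: if_splits)
        then show "run c1 s2 (b1 (sz a) + b2 (sz a)) ?P"
          by (intro run_conseq[OF 1(4)[of s2 a, OF s2(1)]]) (use s2 in \<open>auto simp: K_def\<close>)
      next
        assume "eval_exp (EVar K) s2 = Leaf"
        then have "\<not> c a" using s2 by (auto split: if_splits)
        then show "run c2 s2 (b1 (sz a) + b2 (sz a)) ?P"
          by (intro run_conseq[OF 2(4)[of s2 a, OF s2(1)]]) (use s2 in \<open>auto simp: K_def\<close>)
      qed
      show "run (Seq (Assign K (EHd (EVar 0))) (Seq (Assign 0 (ETl (EVar 0))) (If (EVar K) c1 c2))) s1
          ((6 + sz a) + ((6 + sz a) + (4 + (b1 (sz a) + b2 (sz a))))) ?P"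
      proof (rule run_conseq[OF run_Seq_Assign[OF run_Seq_Assign]])
        show "run (If (EVar K) c1 c2) (s1(K := eval_exp (EHd (EVar 0)) s1,
            0 := eval_exp (ETl (EVar 0)) (s1(K := eval_exp (EHd (EVar 0)) s1))))
            (4 + (b1 (sz a) + b2 (sz a))) ?P"
          unfolding e by (rule run_conseq[OF i]) (use s2(2) in auto)
      qed (use s1 0(1) in \<open>auto simp: K_def\<close>)
    qed
  qed simp
qed

lemma pt_Not [pt_intros]: "pt c \<Longrightarrow> pt (\<lambda>a. \<not> c a)"
  using pt_if[OF _ pt_const[of False] pt_const[of True], of c] by (simp add: if_bool_eq_conj)

lemma pt_conj [pt_intros]: "pt c \<Longrightarrow> pt d \<Longrightarrow> pt (\<lambda>a. c a \<and> d a)"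
  using pt_if[OF _ _ pt_const[of False], of c d] by (simp add: if_bool_eq_disj)

lemma pt_disj [pt_intros]: "pt c \<Longrightarrow> pt d \<Longrightarrow> pt (\<lambda>a. c a \<or> d a)"
  using pt_if[OF _ pt_const[of True], of c d] by (simp add: if_bool_eq_conj disj_imp)

lemma pt_imp [pt_intros]: "pt c \<Longrightarrow> pt d \<Longrightarrow> pt (\<lambda>a. c a \<longrightarrow> d a)"
  unfolding imp_conv_disj by (intro pt_disj pt_Not)


section \<open>Lists and natural numbers\<close>

lemma sz_elem: "y \<in> set zs \<Longrightarrow> sz y < sz zs"
  by (induction zs) auto

text \<open>Steps of polynomial cost alone do not make a polynomial loop, as iterated polynomial
  growth may explode. Hence all intermediate accumulators are bounded in the size of the initial
  argument.\<close>

lemma pt_foldl: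
  fixes h :: "'a::encodable \<Rightarrow> 'c::encodable \<Rightarrow> 'b::encodable \<Rightarrow> 'c"
  assumes ys: "pt ys" and z: "pt z" and h: "pt (\<lambda>p. h (fst p) (snd (snd p)) (fst (snd p)))"
    and q: "polyb q" and le: "\<And>a i. sz (foldl (h a) (z a) (take i (ys a))) \<le> q (sz a)"
  shows "pt (\<lambda>a. foldl (h a) (z a) (ys a))"
proof -
  obtain c0 K0 b0 where 0: "1 \<le> K0" "polyb b0" "mono b0"
    "\<And>a s. s 0 = tr a \<Longrightarrow> run c0 s (b0 (sz a))
      (\<lambda>s'. s' 0 = tr ((\<lambda>a. (a, ys a, z a)) a) \<and> (\<forall>v\<ge>K0. s' v = s v))"
    using pt_pair[OF pt_id pt_pair[OF ys z]] by (rule ptE) blast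
  obtain c1 K1 b1 where 1: "1 \<le> K1" "polyb b1" "mono b1"
    "\<And>p s. s 0 = tr p \<Longrightarrow> run c1 s (b1 (sz p))
      (\<lambda>s'. s' 0 = tr (h (fst p) (snd (snd p)) (fst (snd p))) \<and> (\<forall>v\<ge>K1. s' v = s v))"
    using h by (rule ptE) blast
  obtain qy where qy: "polyb qy" "mono qy" "\<And>a. sz (ys a) \<le> qy (sz a)"
    using ys by (rule pt_size) blast
  define K where "K = K0 + K1"
  define body where "body = Seq (Assign 0 (ECons (EVar K) (ECons (EHd (EVar (K+1))) (EVar (K+2)))))
    (Seq c1 (Seq (Assign (K+2) (EVar 0)) (Assign (K+1) (ETl (EVar (K+1))))))"
  \<comment> \<open>Cost of one round when the argument, the remaining list and the accumulator have
    size at most \<open>D\<close>; they live in \<open>K\<close>, \<open>K + 1\<close> and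
    \<open>K + 2\<close>.\<close>
  define B where "B D = (1 + D) + ((4 + 3 * D) + (b1 (3 * D + 2) + ((1 + D) + (2 + D))))" for D
  have K: "0 < K" "K1 \<le> K" using 1(1) by (auto simp: K_def)
  have loop: "run (While (EVar (K+1)) body) s ((length zs + 1) * B D)
      (\<lambda>s'. s' (K+2) = tr (foldl (h a) acc zs) \<and> (\<forall>v\<ge>K+3. s' v = s v))"
    if "s K = tr a" "s (K+1) = tr zs" "s (K+2) = tr acc" "sz a \<le> D" "sz zs \<le> D"
      "\<And>i. sz (foldl (h a) acc (take i zs)) \<le> D" for s a zs acc D
    using that
  proof (induction zs arbitrary: s acc)
    case Nil
    show ?case
      by (rule run_conseq[OF run_While_False[where P = "\<lambda>s'. s' (K+2) = tr (foldl (h a) acc []) \<and>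
            (\<forall>v\<ge>K+3. s' v = s v)"]])
         (use Nil in \<open>auto simp: B_def\<close>)
  next
    case (Cons y zs)
    let ?P = "\<lambda>s'. s' (K+2) = tr (foldl (h a) acc (y # zs)) \<and> (\<forall>v\<ge>K+3. s' v = s v)"
    let ?w = "While (EVar (K+1)) body"
    define acc' where "acc' = h a acc y"
    have accD: "sz acc \<le> D" using Cons.prems(6)[of 0] by simp
    have acc'D: "sz acc' \<le> D" using Cons.prems(6)[of 1] by (simp add: acc'_def)
    have yD: "sz y \<le> D" using Cons.prems(5) by simp
    have zsD: "sz zs \<le> D" using Cons.prems(5) by simp
    have IH: "run ?w s2 ((length zs + 1) * B D) ?P"
      if s2: "s2 K = tr a" "s2 (K+1) = tr zs" "s2 (K+2) = tr acc'" "\<forall>v\<ge>K+3. s2 v = s v" for s2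
    proof (rule run_conseq[OF Cons.IH[where acc = acc']])
      show "sz (foldl (h a) acc' (take i zs)) \<le> D" for i
        using Cons.prems(6)[of "Suc i"] by (simp add: acc'_def)
    qed (use s2 zsD Cons.prems(4) in \<open>auto simp: acc'_def\<close>)
    have "run body s ((4 + 3 * D) + (b1 (3 * D + 2) + ((1 + D) + (2 + D))))
        (\<lambda>s'. run ?w s' ((length zs + 1) * B D) ?P)" (is "run _ _ _ ?Q")
    proof (subst body_def, rule run_conseq[OF run_Seq_Assign[OF run_Seq]])
      let ?s1 = "s(0 := eval_exp (ECons (EVar K) (ECons (EHd (EVar (K+1))) (EVar (K+2)))) s)"
      show "run c1 ?s1 (b1 (3 * D + 2)) (\<lambda>s'. run (Seq (Assign (K+2) (EVar 0))
          (Assign (K+1) (ETl (EVar (K+1))))) s' ((1 + D) + (2 + D)) ?Q)"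
      proof (rule run_conseq[OF 1(4)[of ?s1 "(a, y, acc)"]])
        show "?s1 0 = tr (a, y, acc)" using Cons.prems by simp
        show "b1 (sz (a, y, acc)) \<le> b1 (3 * D + 2)"
          by (rule monoD[OF 1(3)]) (use yD accD Cons.prems(4) in auto)
        fix s3 assume s3: "s3 0 = tr (h (fst (a, y, acc)) (snd (snd (a, y, acc))) (fst (snd (a, y, acc))))
          \<and> (\<forall>v\<ge>K1. s3 v = ?s1 v)"
        then have s3': "s3 0 = tr acc'" "\<And>v. v \<ge> K \<Longrightarrow> s3 v = s v"
          using K by (auto simp: acc'_def)
        show "run (Seq (Assign (K+2) (EVar 0)) (Assign (K+1) (ETl (EVar (K+1))))) s3
            ((1 + D) + (2 + D)) ?Q"
        proof (rule run_conseq[OF run_Seq_Assign[OF run_Assign[where P = ?Q]]])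
          show "?Q (s3(K+2 := eval_exp (EVar 0) s3, K+1 := eval_exp (ETl (EVar (K+1)))
              (s3(K+2 := eval_exp (EVar 0) s3))))"
            by (rule IH) (use s3' Cons.prems in auto)
        qed (use s3' acc'D Cons.prems in auto)
      qed
    qed (use Cons.prems yD accD in auto)
    from run_While_True[OF _ this] show ?case
      by (rule run_conseq[where Q = ?P]) (use Cons.prems in \<open>auto simp: B_def algebra_simps\<close>)
  qed
  define c where "c = Seq c0 (Seq (Assign K (EHd (EVar 0))) (Seq (Assign (K+1) (EHd (ETl (EVar 0))))
    (Seq (Assign (K+2) (ETl (ETl (EVar 0)))) (Seq (While (EVar (K+1)) body) (Assign 0 (EVar (K+2)))))))"
  define D where "D n = n + qy n + q n" for n
  show ?thesis
  proof (rule ptI[where K = "K + 3"])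
    show "polyb (\<lambda>n. b0 n + ((5 + 3 * D n) + ((5 + 3 * D n) + ((5 + 3 * D n) +
        ((D n + 1) * B (D n) + (1 + D n))))))"
      unfolding B_def D_def by (intro polyb_intros 0 1 q qy polyb_comp[OF 1(2)])
    fix a :: 'a and s :: state assume s: "s 0 = tr a"
    let ?D = "D (sz a)"
    have D: "sz a \<le> ?D" "sz (ys a) \<le> ?D" "sz (foldl (h a) (z a) (take i (ys a))) \<le> ?D"
        "length (ys a) \<le> ?D" for i
      using le[of a i] qy(3)[of a] length_le_tsize[of "ys a" tr] by (auto simp: D_def)
    have zD: "sz (z a) \<le> ?D" using D(3)[of 0] by simp
    have rD: "sz (foldl (h a) (z a) (ys a)) \<le> ?D" using D(3)[of "length (ys a)"] by simp
    let ?P = "\<lambda>s'. s' 0 = tr (foldl (h a) (z a) (ys a)) \<and> (\<forall>v\<ge>K + 3. s' v = s v)"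
    show "run c s (b0 (sz a) + ((5 + 3 * ?D) + ((5 + 3 * ?D) + ((5 + 3 * ?D) +
        ((?D + 1) * B ?D + (1 + ?D)))))) ?P"
      unfolding c_def
    proof (rule run_Seq, rule run_conseq[OF 0(4)[of s a, OF s] order_refl])
      fix s1 assume s1: "s1 0 = tr (a, ys a, z a) \<and> (\<forall>v\<ge>K0. s1 v = s v)"
      let ?s2 = "s1(K := eval_exp (EHd (EVar 0)) s1)"
      let ?s3 = "?s2(K+1 := eval_exp (EHd (ETl (EVar 0))) ?s2)"
      let ?s4 = "?s3(K+2 := eval_exp (ETl (ETl (EVar 0))) ?s3)"
      have l: "run (Seq (While (EVar (K+1)) body) (Assign 0 (EVar (K+2)))) ?s4
          ((?D + 1) * B ?D + (1 + ?D)) ?P"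
      proof (rule run_Seq, rule run_conseq[OF loop[where a = a and zs = "ys a" and acc = "z a" and D = ?D]])
        fix s5 assume "s5 (K + 2) = tr (foldl (h a) (z a) (ys a)) \<and> (\<forall>v\<ge>K + 3. s5 v = ?s4 v)"
        then show "run (Assign 0 (EVar (K+2))) s5 (1 + ?D) ?P"
          by (intro run_conseq[OF run_Assign[where P = ?P]])
             (use s1 K rD in \<open>auto simp: K_def\<close>)
      qed (use s1 K D in auto)
      show "run (Seq (Assign K (EHd (EVar 0))) (Seq (Assign (K+1) (EHd (ETl (EVar 0))))
          (Seq (Assign (K+2) (ETl (ETl (EVar 0)))) (Seq (While (EVar (K+1)) body) (Assign 0 (EVar (K+2)))))))
          s1 ((5 + 3 * ?D) + ((5 + 3 * ?D) + ((5 + 3 * ?D) + ((?D + 1) * B ?D + (1 + ?D))))) ?P"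
        by (rule run_conseq[OF run_Seq_Assign[OF run_Seq_Assign[OF run_Seq_Assign[OF l]]]])
           (use s1 K D zD in auto)
    qed
  qed simp
qed

text \<open>Growth per step that is independent of the accumulator adds up to at most the number of
  steps times a polynomial. Most list functions below have this form.\<close>

lemma pt_foldl_grow:
  fixes h :: "'a::encodable \<Rightarrow> 'c::encodable \<Rightarrow> 'b::encodable \<Rightarrow> 'c"
  assumes ys: "pt ys" and z: "pt z" and h: "pt (\<lambda>p. h (fst p) (snd (snd p)) (fst (snd p)))"
    and q: "polyb q" and grow: "\<And>a acc y. sz (h a acc y) \<le> sz acc + q (sz a + sz y)"
  shows "pt (\<lambda>a. foldl (h a) (z a) (ys a))"
proof -
  obtain q' where q': "polyb q'" "mono q'" "\<And>n. q n \<le> q' n" using q by (rule polybE) blast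
  obtain qy where qy: "polyb qy" "mono qy" "\<And>a. sz (ys a) \<le> qy (sz a)"
    using ys by (rule pt_size) blast
  obtain qz where qz: "polyb qz" "mono qz" "\<And>a. sz (z a) \<le> qz (sz a)"
    using z by (rule pt_size) blast
  have bound: "sz (foldl (h a) acc zs) \<le> sz acc + length zs * q' (sz a + M)"
    if "\<And>y. y \<in> set zs \<Longrightarrow> sz y \<le> M" for a acc zs M
    using that
  proof (induction zs arbitrary: acc)
    case (Cons y zs)
    have "sz (h a acc y) \<le> sz acc + q (sz a + sz y)" by (rule grow)
    also have "q (sz a + sz y) \<le> q' (sz a + M)"
      using q'(3)[of "sz a + sz y"] monoD[OF q'(2), of "sz a + sz y" "sz a + M"] Cons.prems[of y] by simp
    finally have "sz (h a acc y) \<le> sz acc + q' (sz a + M)" by simp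
    moreover have "sz (foldl (h a) (h a acc y) zs) \<le> sz (h a acc y) + length zs * q' (sz a + M)"
      using Cons by simp
    ultimately show ?case by simp
  qed simp
  show ?thesis
  proof (rule pt_foldl[OF ys z h])
    show "polyb (\<lambda>n. qz n + qy n * q' (n + qy n))"
      by (intro polyb_intros qz qy polyb_comp[OF q'(1)])
    fix a :: 'a and i
    have "sz (foldl (h a) (z a) (take i (ys a))) \<le>
        sz (z a) + length (take i (ys a)) * q' (sz a + sz (ys a))"
      by (rule bound) (use sz_elem in \<open>force dest!: in_set_takeD\<close>)
    also have "\<dots> \<le> qz (sz a) + qy (sz a) * q' (sz a + qy (sz a))"
    proof (intro add_mono mult_mono monoD[OF q'(2)])
      show "length (take i (ys a)) \<le> qy (sz a)"
        using length_le_tsize[of "ys a" tr] qy(3)[of a] by simp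
    qed (use qy qz in auto)
    finally show "sz (foldl (h a) (z a) (take i (ys a))) \<le> qz (sz a) + qy (sz a) * q' (sz a + qy (sz a))" .
  qed
qed


lemma pt_size_pair:
  assumes "pt (\<lambda>p. h (fst p) (snd p))"
  obtains b where "polyb b" "\<And>a y. sz (h a y) \<le> b (sz a + sz y)"
proof -
  obtain b where b: "polyb b" "mono b" "\<And>p. sz (h (fst p) (snd p)) \<le> b (sz p)"
    using assms by (rule pt_size) blast
  show thesis
  proof (rule that)
    show "polyb (\<lambda>n. b (Suc n))" by (rule polyb_comp[OF b(1)]) (intro polyb_intros)
    show "sz (h a y) \<le> b (Suc (sz a + sz y))" for a y using b(3)[of "(a, y)"] by simp
  qed
qed

section \<open>List functions\<close>

lemma foldl_Cons_eq: "foldl (\<lambda>acc y. f y # acc) zs xs = rev (map f xs) @ zs"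
  by (induction xs arbitrary: zs) auto

lemma pt_rev [pt_intros]: "pt f \<Longrightarrow> pt (\<lambda>a. rev (f a))"
  using pt_foldl_grow[of f "\<lambda>_. []" "\<lambda>_ acc y. y # acc" "\<lambda>n. n + 1"]
  by (simp add: foldl_Cons_eq[of "\<lambda>x. x", simplified] pt_intros polyb_intros)

lemma pt_append [pt_intros]:
  assumes "pt f" "pt g" shows "pt (\<lambda>a. f a @ g a)"
proof -
  have "pt (\<lambda>a. foldl (\<lambda>acc y. y # acc) (g a) (rev (f a)))"
    by (rule pt_foldl_grow[where q = "\<lambda>n. n + 1"]) (intro pt_intros polyb_intros assms | simp)+
  then show ?thesis by (simp add: foldl_Cons_eq[of "\<lambda>x. x", simplified])
qed

lemma pt_map [pt_intros]:
  assumes f: "pt f" and h: "pt (\<lambda>p. h (fst p) (snd p))"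
  shows "pt (\<lambda>a. map (h a) (f a))"
proof -
  obtain b where b: "polyb b" "\<And>a y. sz (h a y) \<le> b (sz a + sz y)"
    using h by (rule pt_size_pair) blast
  have "pt (\<lambda>a. rev (foldl (\<lambda>acc y. h a y # acc) [] (f a)))"
  proof (intro pt_rev pt_foldl_grow[where q = "\<lambda>n. b n + 1"] f pt_const)
    show "pt (\<lambda>p. h (fst p) (fst (snd p)) # snd (snd p))"
      by (intro pt_intros pt_comp2[where g = h, OF h])
    show "polyb (\<lambda>n. b n + 1)" by (intro polyb_intros b)
    show "sz (h a y # acc) \<le> sz acc + (b (sz a + sz y) + 1)" for a acc y using b(2)[of a y] by simp
  qed
  then show ?thesis by (simp add: foldl_Cons_eq)
qed

lemma pt_filter [pt_intros]:
  assumes f: "pt f" and h: "pt (\<lambda>p. P (fst p) (snd p))"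
  shows "pt (\<lambda>a. filter (P a) (f a))"
proof -
  have "foldl (\<lambda>acc y. if Q y then y # acc else acc) zs xs = rev (filter Q xs) @ zs"
    for Q :: "'b \<Rightarrow> bool" and zs xs
    by (induction xs arbitrary: zs) auto
  moreover have "pt (\<lambda>a. rev (foldl (\<lambda>acc y. if P a y then y # acc else acc) [] (f a)))"
  proof (intro pt_rev pt_foldl_grow[where q = "\<lambda>n. n + 1"] f pt_const)
    show "pt (\<lambda>p. if P (fst p) (fst (snd p)) then fst (snd p) # snd (snd p) else snd (snd p))"
      by (intro pt_intros pt_comp2[where g = P, OF h])
  qed (auto intro!: polyb_intros)
  ultimately show ?thesis by simp
qed

lemma pt_Ball [pt_intros]:
  assumes f: "pt f" and h: "pt (\<lambda>p. P (fst p) (snd p))"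
  shows "pt (\<lambda>a. \<forall>y\<in>set (f a). P a y)"
proof -
  have "foldl (\<lambda>acc y. acc \<and> Q y) c xs \<longleftrightarrow> c \<and> (\<forall>y\<in>set xs. Q y)" for Q :: "'b \<Rightarrow> bool" and c xs
    by (induction xs arbitrary: c) auto
  moreover have "pt (\<lambda>a. foldl (\<lambda>acc y. acc \<and> P a y) True (f a))"
  proof (intro pt_foldl_grow[where q = "\<lambda>n. 3"] f pt_const)
    show "pt (\<lambda>p. snd (snd p) \<and> P (fst p) (fst (snd p)))"
      by (intro pt_intros pt_comp2[where g = P, OF h])
  qed (auto intro!: polyb_intros)
  ultimately show ?thesis by simp
qed

lemma pt_Bex [pt_intros]:
  assumes "pt f" "pt (\<lambda>p. P (fst p) (snd p))"
  shows "pt (\<lambda>a. \<exists>y\<in>set (f a). P a y)"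
  using pt_Not[OF pt_Ball[OF assms(1) pt_Not[OF assms(2)]]] by simp

lemma pt_concat [pt_intros]:
  fixes f :: "'a::encodable \<Rightarrow> 'b::encodable list list"
  assumes f: "pt f" shows "pt (\<lambda>a. concat (f a))"
proof -
  have "pt (\<lambda>a. foldl (@) [] (f a))"
    by (intro pt_foldl_grow[where q = "\<lambda>n. n"] f pt_intros polyb_intros) (simp add: tsize_enc_list)
  moreover have "foldl (@) ys xs = ys @ concat xs" for ys and xs :: "'b list list"
    by (induction xs arbitrary: ys) auto
  ultimately show ?thesis by simp
qed

lemma pt_hd_tree [pt_intros]: "pt f \<Longrightarrow> pt (\<lambda>a. hd_tree (f a))"
proof -
  have "pt hd_tree"
    by (rule pt_exp[where e = "EHd (EVar 0)" and b = "\<lambda>n. 1 + n"]) (auto intro!: polyb_intros)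
  then show "pt f \<Longrightarrow> pt (\<lambda>a. hd_tree (f a))" by (rule pt_comp)
qed

lemma pt_tl_tree [pt_intros]: "pt f \<Longrightarrow> pt (\<lambda>a. tl_tree (f a))"
proof -
  have "pt tl_tree"
    by (rule pt_exp[where e = "ETl (EVar 0)" and b = "\<lambda>n. 1 + n"]) (auto intro!: polyb_intros)
  then show "pt f \<Longrightarrow> pt (\<lambda>a. tl_tree (f a))" by (rule pt_comp)
qed

lemma pt_tr [pt_intros]: "pt f \<Longrightarrow> pt (\<lambda>a. tr (f a))"
  by (rule pt_comp[OF pt_recast]) simp

lemma pt_tl [pt_intros]:
  fixes f :: "'a::encodable \<Rightarrow> 'b::encodable list"
  assumes "pt f" shows "pt (\<lambda>a. tl (f a))"
proof -
  have "tl_tree (tr xs) = tr (tl xs)" for xs :: "'b list" by (cases xs) auto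
  then have "pt (tl :: 'b list \<Rightarrow> _)"
    by (intro pt_exp[where e = "ETl (EVar 0)" and b = "\<lambda>n. 1 + n"]) (auto intro!: polyb_intros)
  then show ?thesis using assms by (rule pt_comp)
qed

section \<open>Arithmetic on unary numbers\<close>

lemma pt_replicate_unit: assumes "pt f" shows "pt (\<lambda>a. replicate (f a) ())"
proof (rule pt_comp[OF pt_recast assms])
  show "tr (replicate n ()) = tr n" for n by (induction n) auto
qed

lemma pt_length [pt_intros]: "pt f \<Longrightarrow> pt (\<lambda>a. length (f a))"
proof -
  assume "pt f"
  then have "pt (\<lambda>a. map (\<lambda>_. ()) (f a))" by (intro pt_intros)
  moreover have "pt (length :: unit list \<Rightarrow> nat)"
  proof (rule pt_recast)
    show "tr (length xs) = tr xs" for xs :: "unit list" by (induction xs) auto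
  qed
  ultimately show ?thesis using pt_comp by fastforce
qed

lemma pt_Suc [pt_intros]: "pt f \<Longrightarrow> pt (\<lambda>a. Suc (f a))"
proof -
  have "pt (\<lambda>p::unit \<times> nat. Suc (snd p))" by (rule pt_recast) auto
  then show "pt f \<Longrightarrow> pt (\<lambda>a. Suc (f a))" using pt_comp2[of "\<lambda>_. Suc" "\<lambda>_. ()" f] pt_const by auto
qed

lemma foldl_unit: "foldl (\<lambda>acc _. g acc) z (replicate n ()) = (g ^^ n) z"
  by (induction n arbitrary: z) (auto simp: funpow_swap1)

text \<open>Bounded iteration is a fold over a list of units, which is the same tree as the unary
  iteration count.\<close>

lemma pt_iterate:
  fixes g :: "'a::encodable \<Rightarrow> 'b::encodable \<Rightarrow> 'b"
  assumes "pt f" "pt z" "pt (\<lambda>p. g (fst p) (snd p))" "polyb q"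
    "\<And>a acc. sz (g a acc) \<le> sz acc + q (sz a)"
  shows "pt (\<lambda>a. (g a ^^ f a) (z a))"
proof -
  obtain q' where q': "polyb q'" "mono q'" "\<And>n. q n \<le> q' n" using assms(4) by (rule polybE) blast
  have "pt (\<lambda>a. foldl (\<lambda>acc _. g a acc) (z a) (replicate (f a) ()))"
  proof (rule pt_foldl_grow[OF pt_replicate_unit[OF assms(1)] assms(2)])
    show "pt (\<lambda>p. g (fst p) (snd (snd p)))" by (intro pt_comp2[where g = g, OF assms(3)] pt_intros)
    show "sz (g a acc) \<le> sz acc + q' (sz a + sz y)" for a acc and y :: unit
      using assms(5)[of a acc] q'(3)[of "sz a"] monoD[OF q'(2), of "sz a" "sz a + sz y"] by simp
  qed (rule q')
  then show ?thesis by (simp add: foldl_unit)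
qed

lemma pt_plus [pt_intros]:
  fixes f g :: "'a::encodable \<Rightarrow> nat"
  assumes "pt f" "pt g" shows "pt (\<lambda>a. f a + g a)"
proof -
  have "pt (\<lambda>a. (Suc ^^ f a) (g a))"
    by (rule pt_iterate[where q = "\<lambda>_. 2"]) (intro assms pt_intros polyb_intros | simp)+
  then show ?thesis by simp
qed

lemma pt_times [pt_intros]:
  fixes f g :: "'a::encodable \<Rightarrow> nat"
  assumes "pt f" "pt g" shows "pt (\<lambda>a. f a * g a)"
proof -
  have e: "((\<lambda>x. x + m) ^^ n) 0 = n * m" for n m :: nat by (induction n) auto
  obtain b where b: "polyb b" "mono b" "\<And>a. sz (g a) \<le> b (sz a)" using \<open>pt g\<close> by (rule pt_size) blast
  have "pt (\<lambda>a. ((\<lambda>x. x + g a) ^^ f a) 0)"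
  proof (rule pt_iterate[OF assms(1) pt_const])
    show "pt (\<lambda>p. snd p + g (fst p))" by (intro pt_intros pt_comp[OF assms(2)])
    show "sz (acc + g a) \<le> sz acc + b (sz a)" for a acc using b(3)[of a] by simp
  qed (rule b)
  then show ?thesis by (simp add: e)
qed

lemma pt_power [pt_intros]:
  fixes f :: "'a::encodable \<Rightarrow> nat"
  assumes "pt f" shows "pt (\<lambda>a. f a ^ k)"
  by (induction k) (auto intro: pt_intros assms)

lemma pt_drop: 
  assumes "pt n" "pt f" shows "pt (\<lambda>a. drop (n a) (f a))"
proof -
  have e: "(tl ^^ n) xs = drop n xs" for n and xs :: "'b list"
    by (induction n arbitrary: xs) (auto simp: drop_Suc drop_tl)
  have le: "sz (tl xs) \<le> sz xs" for xs :: "'b list" by (cases xs) auto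
  have "pt (\<lambda>a. (tl ^^ n a) (f a))"
    by (rule pt_iterate[where q = "\<lambda>_. 0"]) (intro assms pt_intros polyb_intros | simp add: le del: tr_list_def)+
  then show ?thesis by (simp add: e)
qed

lemma pt_minus [pt_intros]:
  fixes f g :: "'a::encodable \<Rightarrow> nat"
  assumes "pt f" "pt g" shows "pt (\<lambda>a. f a - g a)"
  using pt_length[OF pt_drop[OF assms(2) pt_replicate_unit[OF assms(1)]]] by simp

lemma pt_le [pt_intros]:
  fixes f g :: "'a::encodable \<Rightarrow> nat"
  assumes "pt f" "pt g" shows "pt (\<lambda>a. f a \<le> g a)"
proof -
  have "pt (\<lambda>a. f a - g a = 0)" by (intro pt_intros assms)
  then show ?thesis by simp
qed

lemma pt_less [pt_intros]:
  fixes f g :: "'a::encodable \<Rightarrow> nat"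
  assumes "pt f" "pt g" shows "pt (\<lambda>a. f a < g a)"
  using pt_Not[OF pt_le[OF assms(2,1)]] by (simp add: not_le)

lemma pt_odd [pt_intros]:
  fixes f :: "'a::encodable \<Rightarrow> nat"
  assumes f: "pt f" shows "pt (\<lambda>a. odd (f a))"
proof -
  have e: "(Not ^^ n) False = odd n" for n by (induction n) auto
  have "pt (\<lambda>a. (Not ^^ f a) False)"
    by (rule pt_iterate[where q = "\<lambda>_. 3"]) (intro f pt_intros polyb_intros | simp)+
  then show ?thesis by (simp add: e)
qed

lemma pt_upt [pt_intros]: "pt f \<Longrightarrow> pt (\<lambda>a. [0..<f a])"
proof -
  assume f: "pt f"
  have e: "foldl (\<lambda>acc (_::unit). length acc # acc) [] (replicate n ()) = rev [0..<n]" for n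
  proof (induction n)
    case (Suc n)
    have "replicate (Suc n) () = replicate n () @ [()]" by (simp add: replicate_append_same)
    then show ?case using Suc by simp
  qed simp
  obtain b where b: "polyb b" "mono b" "\<And>a. sz (f a) \<le> b (sz a)" using f by (rule pt_size) blast
  have "pt (\<lambda>a. foldl (\<lambda>acc (_::unit). length acc # acc) [] (replicate (f a) ()))"
  proof (rule pt_foldl[OF pt_replicate_unit[OF f] pt_const])
    show "pt (\<lambda>p. length (snd (snd p)) # snd (snd p))" by (intro pt_intros)
    show "polyb (\<lambda>n. 1 + b n * (2 * b n + 2))" by (intro polyb_intros b)
    fix a :: 'a and i
    let ?m = "min i (f a)"
    have "sz (foldl (\<lambda>acc (_::unit). length acc # acc) [] (take i (replicate (f a) ()))) = sz (rev [0..<?m])"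
      by (simp add: e min_def del: tr_list_def)
    also have "\<dots> = 1 + (\<Sum>x\<leftarrow>rev [0..<?m]. 2 * x + 2)" by (simp add: tsize_enc_list)
    also have "(\<Sum>x\<leftarrow>rev [0..<?m]. 2 * x + 2) \<le> (\<Sum>x\<leftarrow>rev [0..<?m]. 2 * ?m + 2)"
      by (rule sum_list_mono) auto
    also have "\<dots> = ?m * (2 * ?m + 2)" by (simp only: sum_list_const_mult sum_list_triv length_rev length_upt) simp
    also have "\<dots> \<le> b (sz a) * (2 * b (sz a) + 2)"
    proof (rule mult_mono)
      show "?m \<le> b (sz a)" using b(3)[of a] by simp
      then show "2 * ?m + 2 \<le> 2 * b (sz a) + 2" by simp
    qed auto
    finally show "sz (foldl (\<lambda>acc (_::unit). length acc # acc) [] (take i (replicate (f a) ()))) \<le>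
      1 + b (sz a) * (2 * b (sz a) + 2)" by simp
  qed
  then have "pt (\<lambda>a. rev (foldl (\<lambda>acc (_::unit). length acc # acc) [] (replicate (f a) ())))"
    by (rule pt_rev)
  then show ?thesis by (simp add: e)
qed

text \<open>Out of range, \<open>xs ! i\<close> is unspecified and comes with no program; the
  default value makes indexing total.\<close>

definition nthd :: "'a \<Rightarrow> 'a list \<Rightarrow> nat \<Rightarrow> 'a" where
  "nthd d xs i = (if i < length xs then xs ! i else d)"

lemma nthd_nth [simp]: "i < length xs \<Longrightarrow> nthd d xs i = xs ! i" by (simp add: nthd_def)

lemma pt_nthd [pt_intros]:
  assumes "pt d" "pt f" "pt i" shows "pt (\<lambda>a. nthd (d a) (f a) (i a))"
proof -
  \<comment> \<open>The last element of the reversed remainder is the wanted entry; an empty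
    remainder leaves \<open>d\<close>.\<close>
  have e: "foldl (\<lambda>_ y. y) d (rev (drop i xs)) = nthd d xs i" for d :: 'b and i xs
    by (cases "i < length xs") (auto simp: nthd_def Cons_nth_drop_Suc[symmetric])
  have "pt (\<lambda>a. foldl (\<lambda>_ y. y) (d a) (rev (drop (i a) (f a))))"
    by (rule pt_foldl_grow[where q = "\<lambda>n. n"]) (intro assms pt_intros pt_drop polyb_intros | simp)+
  then show ?thesis by (simp add: e)
qed

lemma pt_member [pt_intros]: "pt f \<Longrightarrow> pt g \<Longrightarrow> pt (\<lambda>a. f a \<in> set (g a))"
proof -
  assume f: "pt f" and "pt g"
  then have "pt (\<lambda>a. \<exists>y\<in>set (g a). f a = y)" by (intro pt_intros pt_comp[OF f])
  then show ?thesis by simp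
qed

lemma pt_remdups [pt_intros]:
  fixes f :: "'a::encodable \<Rightarrow> 'b::encodable list"
  assumes f: "pt f" shows "pt (\<lambda>a. remdups (f a))"
proof -
  have s: "set (foldr (\<lambda>x acc. if x \<in> set acc then acc else x # acc) xs []) = set xs" for xs :: "'b list"
    by (induction xs) auto
  have e: "foldr (\<lambda>x acc. if x \<in> set acc then acc else x # acc) xs [] = remdups xs" for xs :: "'b list"
    by (induction xs) (auto simp: s)
  have "pt (\<lambda>a. foldl (\<lambda>acc x. if x \<in> set acc then acc else x # acc) [] (rev (f a)))"
    by (rule pt_foldl_grow[where q = "\<lambda>n. n + 1"]) (intro f pt_intros polyb_intros | simp)+
  then show ?thesis by (simp add: foldl_conv_foldr e)
qed

lemma pt_distinct [pt_intros]: "pt f \<Longrightarrow> pt (\<lambda>a. distinct (f a))"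
proof -
  assume f: "pt f"
  then have "pt (\<lambda>a. remdups (f a) = f a)" by (intro pt_intros)
  then show ?thesis by (simp add: distinct_remdups_id[symmetric])
qed

lemma pt_zip [pt_intros]: "pt f \<Longrightarrow> pt g \<Longrightarrow> pt (\<lambda>a. zip (f a) (g a))"
proof -
  assume fg: "pt f" "pt g"
  have e: "map (\<lambda>i. (nthd undefined xs i, nthd undefined ys i)) [0..<if length xs \<le> length ys then length xs else length ys] = zip xs ys"
    for xs :: "'b list" and ys :: "'c list"
    by (rule nth_equalityI) (auto split: if_splits)
  have "pt (\<lambda>a. map (\<lambda>i. (nthd undefined (f a) i, nthd undefined (g a) i))
      [0..<if length (f a) \<le> length (g a) then length (f a) else length (g a)])"
    by (intro pt_intros fg pt_comp[OF fg(1)] pt_comp[OF fg(2)])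
  then show ?thesis by (simp only: e)
qed

lemma pt_n_lists [pt_intros]: "pt f \<Longrightarrow> pt (\<lambda>a. List.n_lists k (f a))"
proof (induction k)
  case (Suc k)
  then show ?case by (simp, intro pt_intros pt_comp[OF \<open>pt f\<close>])
qed (auto intro: pt_intros)

section \<open>Tree spines and binary numerals\<close>

fun spine :: "tree \<Rightarrow> tree list" where
  "spine Leaf = []"
| "spine (Node l r) = l # spine r"

lemma spine_enc_list [simp]: "spine (enc_list f xs) = map f xs"
  by (induction xs) auto

lemma length_spine_unary [simp]: "length (spine (unary n)) = n"
  by (induction n) auto

lemma pt_spine [pt_intros]: assumes "pt f" shows "pt (\<lambda>a. spine (f a))"
proof (rule pt_comp[OF pt_recast assms])
  show "tr (spine t) = tr t" for t by (induction t rule: spine.induct) auto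
qed

fun inc :: "bool list \<Rightarrow> bool list" where
  "inc [] = [True]"
| "inc (b # bs) = (if b then False # inc bs else True # bs)"

lemma binary_Suc: "binary n = tr bs \<Longrightarrow> binary (Suc n) = tr (inc bs)"
proof (induction bs arbitrary: n)
  case Nil
  then have "n = 0" by (auto simp: binary.simps[of n] split: if_splits)
  then show ?case by (simp add: binary.simps)
next
  case (Cons b bs)
  then have n: "n \<noteq> 0" "odd n = b" "binary (n div 2) = tr bs"
    by (auto simp: binary.simps[of n] split: if_splits)
  then show ?case using Cons.IH[OF n(3)] by (cases b) (auto simp: binary.simps[of "Suc n"])
qed

lemma binary_eq: "binary n = tr ((inc ^^ n) [])"
proof (induction n)
  case (Suc n)
  then show ?case using binary_Suc by simp
qed (simp add: binary.simps)

lemma pt_inc: assumes "pt f" shows "pt (\<lambda>a. inc (f a))"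
proof -
  \<comment> \<open>Ripple carry in a single pass: the state consists of the carry and the reversed
    output.\<close>
  define st where "st = (\<lambda>p (b::bool). if fst p then (b, (\<not> b) # snd p) else (False, b # snd p))"
  have st: "st (c, out) b = (if c then (b, (\<not> b) # out) else (False, b # out))" for c out b
    by (simp add: st_def)
  have F: "foldl st (False, out) bs = (False, rev bs @ out)" for out bs
    by (induction bs arbitrary: out) (auto simp: st)
  have T: "rev (if fst (foldl st (True, out) bs) then True # snd (foldl st (True, out) bs)
      else snd (foldl st (True, out) bs)) = rev out @ inc bs" for out bs
  proof (induction bs arbitrary: out)
    case (Cons b bs)
    then show ?case using Cons.IH[of "False # out"]
      by (cases b; cases "fst (foldl st (True, False # out) bs)") (simp_all add: st F)
  qed simp
  have "pt (\<lambda>a. foldl st (True, []) (f a))" unfolding st_def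
    by (rule pt_foldl_grow[where q = "\<lambda>n. n + 6"]) (intro assms pt_intros polyb_intros | auto)+
  then have "pt (\<lambda>a. rev (if fst (foldl st (True, []) (f a)) then True # snd (foldl st (True, []) (f a))
      else snd (foldl st (True, []) (f a))))" by (intro pt_intros)
  then show ?thesis by (simp only: T) simp
qed

text \<open>Counting up with \<open>inc\<close> takes the place of division by two. Each increment
  adds at most 4 to the size, and the unary argument pays for the number of increments.\<close>

lemma pt_binary [pt_intros]: assumes "pt f" shows "pt (\<lambda>a. binary (f a))"
proof -
  have g: "sz (inc bs) \<le> sz bs + 4" for bs by (induction bs) auto
  have "pt (\<lambda>a. (inc ^^ f a) [])"
    by (rule pt_iterate[OF assms pt_const, where q = "\<lambda>_. 4"])
       (rule pt_inc g[unfolded tr_list_def] polyb_intros g | intro pt_intros)+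
  then show ?thesis unfolding binary_eq by (rule pt_tr)
qed


section \<open>Circuits\<close>

lemma pt_tr_cong: "pt h \<Longrightarrow> (\<And>a. tr (g a) = tr (h a)) \<Longrightarrow> pt g"
  unfolding pt_def by simp

section \<open>Decoding circuits\<close>

definition gtag :: "gate \<Rightarrow> nat" where
  "gtag g = (case g of Input \<Rightarrow> 0 | Neg _ \<Rightarrow> 1 | Conj _ \<Rightarrow> 2 | Disj _ \<Rightarrow> 3)"

lemma gtag_simps [simp]: "gtag Input = 0" "gtag (Neg i) = 1" "gtag (Conj is) = 2" "gtag (Disj is) = 3"
  by (simp_all add: gtag_def)

lemma pt_gtag [pt_intros]: assumes "pt f" shows "pt (\<lambda>a. gtag (f a))"
proof -
  have e: "gtag g = length (spine (hd_tree (tr g)))" for g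
    by (cases g) (auto simp: numeral_eq_Suc)
  show ?thesis unfolding e by (intro pt_intros assms)
qed

lemma pt_preds [pt_intros]: assumes "pt f" shows "pt (\<lambda>a. preds (f a))"
proof -
  have e: "preds g = (if gtag g = 0 then [] else if gtag g = 1 then [length (spine (tl_tree (tr g)))]
      else map (\<lambda>t. length (spine t)) (spine (tl_tree (tr g))))" for g
    by (cases g) (auto simp: comp_def)
  show ?thesis unfolding e by (intro pt_intros assms)
qed

lemma pt_large [pt_intros]: "pt f \<Longrightarrow> pt (\<lambda>a. large (f a))"
  unfolding large_def by (intro pt_intros)

definition nat_of :: "tree \<Rightarrow> nat" where "nat_of t = length (spine t)"

text \<open>Malformed trees decode to some gate as well; \<open>uf_reduction\<close> later rejects
  them by comparing the re-encoding with the input.\<close>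

definition gate_of :: "tree \<Rightarrow> gate" where
  "gate_of t = (let n = nat_of (hd_tree t); b = tl_tree t in
     if n = 0 then Input else if n = 1 then Neg (nat_of b)
     else if n = 2 then Conj (map nat_of (spine b)) else Disj (map nat_of (spine b)))"

lemma nat_of_unary [simp]: "nat_of (unary n) = n" by (simp add: nat_of_def)

lemma gate_of_enc_gate [simp]: "gate_of (enc_gate g) = g"
  by (cases g) (auto simp: gate_of_def numeral_eq_Suc nat_of_def comp_def)

lemma pt_nat_of [pt_intros]: "pt f \<Longrightarrow> pt (\<lambda>a. nat_of (f a))"
  unfolding nat_of_def by (intro pt_intros)

lemma pt_gate_of [pt_intros]: assumes "pt f" shows "pt (\<lambda>a. gate_of (f a))"
proof (rule pt_tr_cong)
  let ?n = "\<lambda>a. nat_of (hd_tree (f a))" and ?b = "\<lambda>a. tl_tree (f a)"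
  show "pt (\<lambda>a. if ?n a = 0 then ((0::nat), Leaf) else if ?n a = 1 then (1, tr (nat_of (?b a)))
     else if ?n a = 2 then (2, tr (map nat_of (spine (?b a)))) else (3, tr (map nat_of (spine (?b a)))))"
    by (intro pt_intros assms)
  have [simp]: "(tr :: nat \<Rightarrow> tree) = unary" by (rule ext) simp
  show "tr (gate_of (f a)) = tr (if ?n a = 0 then ((0::nat), Leaf) else if ?n a = 1 then (1, tr (nat_of (?b a)))
     else if ?n a = 2 then (2, tr (map nat_of (spine (?b a)))) else (3, tr (map nat_of (spine (?b a)))))" for a
    by (simp add: gate_of_def Let_def)
qed

definition gates_of :: "tree \<Rightarrow> gate list" where
  "gates_of t = map gate_of (spine (hd_tree (hd_tree t)))"
definition out_of :: "tree \<Rightarrow> nat" where "out_of t = nat_of (tl_tree (hd_tree t))"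
definition weight_of :: "tree \<Rightarrow> nat" where "weight_of t = nat_of (tl_tree t)"

lemma pt_gates_of [pt_intros]: "pt f \<Longrightarrow> pt (\<lambda>a. gates_of (f a))"
  and pt_out_of [pt_intros]: "pt f \<Longrightarrow> pt (\<lambda>a. out_of (f a))"
  and pt_weight_of [pt_intros]: "pt f \<Longrightarrow> pt (\<lambda>a. weight_of (f a))"
  unfolding gates_of_def out_of_def weight_of_def by (intro pt_intros | assumption)+

lemma of_enc_wcs [simp]:
  "gates_of (enc_wcs ((gs, out), k)) = gs" "out_of (enc_wcs ((gs, out), k)) = out"
  "weight_of (enc_wcs ((gs, out), k)) = k"
  by (simp_all add: gates_of_def out_of_def weight_of_def comp_def)

lemma pt_enc_wcs: assumes "pt gs" "pt out" "pt k" shows "pt (\<lambda>a. enc_wcs ((gs a, out a), k a))"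
proof -
  have "(tr :: gate \<Rightarrow> tree) = enc_gate" by (rule ext) simp
  then have e: "enc_wcs ((gs, out), k) = tr ((gs, out), k)" for gs out k by simp
  show ?thesis unfolding e by (intro pt_intros assms)
qed

section \<open>Deciding weft and depth bounds\<close>

abbreviation gate_at :: "gate list \<Rightarrow> nat \<Rightarrow> gate" where "gate_at \<equiv> nthd Input"

text \<open>The conditions on all paths become a recursion from a node towards the inputs, where
  \<open>d\<close> is the remaining depth and \<open>c\<close> the remaining number of large
  gates.\<close>

fun weft_depth :: "nat \<Rightarrow> nat \<Rightarrow> gate list \<Rightarrow> nat \<Rightarrow> bool" where
  "weft_depth 0 c gs j \<longleftrightarrow> preds (gate_at gs j) = []"
| "weft_depth (Suc d) c gs j \<longleftrightarrow>
    (if large (gate_at gs j) then c \<noteq> 0 \<and> (\<forall>i\<in>set (preds (gate_at gs j)). weft_depth d (c - 1) gs i)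
     else \<forall>i\<in>set (preds (gate_at gs j)). weft_depth d c gs i)"

text \<open>The recursion ignores shared nodes, yet it stays polynomial because its height
  \<open>d\<close> is constant.\<close>

lemma pt_weft_depth: "pt (\<lambda>p. weft_depth d c (fst p) (snd p))"
proof (induction d arbitrary: c)
  case (Suc d)
  show ?case unfolding weft_depth.simps
    by (intro pt_intros pt_comp2[where g = "weft_depth d c", OF Suc]
      pt_comp2[where g = "weft_depth d (c - 1)", OF Suc])
qed (unfold weft_depth.simps, intro pt_intros)

definition wf_gates :: "gate list \<Rightarrow> bool" where
  "wf_gates gs \<longleftrightarrow> (\<forall>i < length gs. wf_gate i (gs ! i))"

lemma wf_gate_iff: "wf_gate i g \<longleftrightarrow> gtag g = 0 \<or> gtag g = 1 \<and> (\<forall>j\<in>set (preds g). j < i) \<or>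
    2 \<le> gtag g \<and> 2 \<le> length (preds g) \<and> distinct (preds g) \<and> (\<forall>j\<in>set (preds g). j < i)"
  by (cases g) auto

lemma wf_gates_nth: "wf_gates gs \<Longrightarrow> j < length gs \<Longrightarrow> wf_gate j (gs ! j)"
  unfolding wf_gates_def by blast

lemma wf_preds: "wf_gates gs \<Longrightarrow> j < length gs \<Longrightarrow> i \<in> set (preds (gs ! j)) \<Longrightarrow> i < j"
  using wf_gates_nth[of gs j] by (cases "gs ! j") auto

lemma wf_Input: "wf_gates gs \<Longrightarrow> j < length gs \<Longrightarrow> preds (gs ! j) = [] \<longleftrightarrow> gs ! j = Input"
  using wf_gates_nth[of gs j] by (cases "gs ! j") auto

lemma pt_wf_gate [pt_intros]:
  assumes "pt i" "pt g" shows "pt (\<lambda>a. wf_gate (i a) (g a))"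
  unfolding wf_gate_iff by (intro pt_intros assms pt_comp[OF assms(1)] pt_comp[OF assms(2)])

lemma wf_circuit_iff: "wf_circuit (gs, out) \<longleftrightarrow>
    (\<forall>i\<in>set [0..<length gs]. wf_gate i (gate_at gs i)) \<and>
    out < length gs \<and> (\<forall>g \<in> set gs. out \<notin> set (preds g))"
  by auto

lemma pt_wf_circuit:
  assumes "pt gs" "pt out" shows "pt (\<lambda>a. wf_circuit (gs a, out a))"
  unfolding wf_circuit_iff by (intro pt_intros pt_comp[OF assms(1)] pt_comp[OF assms(2)])

text \<open>Paths are split at their last node because \<open>weft_depth\<close> descends from the
  output.\<close>

lemma io_path_snoc:
  assumes "wf_gates gs" "j < length gs"
  shows "io_path (gs, j) p \<longleftrightarrow> gs ! j = Input \<and> p = [j] \<or>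
    (\<exists>i\<in>set (preds (gs ! j)). \<exists>p'. io_path (gs, i) p' \<and> p = p' @ [j])" (is "_ \<longleftrightarrow> ?R")
proof
  assume p: "io_path (gs, j) p"
  then obtain p' where p': "p = p' @ [j]" by (cases p rule: rev_cases) auto
  show ?R
  proof (cases "p' = []")
    case True then show ?thesis using p p' by auto
  next
    case False
    have n: "p ! (length p' - 1) = last p'" "p ! length p' = j"
      using False p' by (auto simp: nth_append last_conv_nth)
    have "Suc (length p' - 1) < length p" "Suc (length p' - 1) = length p'" using False p' by auto
    then have i: "last p' \<in> set (preds (gs ! j))" using p n by (metis io_path.simps)
    moreover have "p' ! a \<in> set (preds (gs ! (p' ! Suc a)))" if "Suc a < length p'" for a
    proof -
      have "p ! a \<in> set (preds (gs ! (p ! Suc a)))" using p p' that by simp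
      then show ?thesis using that p' by (simp add: nth_append)
    qed
    then have "io_path (gs, last p') p'" using p p' False by auto
    ultimately show ?thesis using p' by blast
  qed
next
  assume ?R
  then show "io_path (gs, j) p"
  proof (elim disjE bexE exE conjE)
    fix i p' assume i: "i \<in> set (preds (gs ! j))" and p': "io_path (gs, i) p'" "p = p' @ [j]"
    have "p ! a \<in> set (preds (gs ! (p ! Suc a)))" if "Suc a < length p" for a
    proof (cases "Suc a < length p'")
      case True
      then show ?thesis using p' by (simp add: nth_append)
    next
      case False
      then have "a = length p' - 1" "p' \<noteq> []" using that p' by auto
      then show ?thesis using p' i by (simp add: nth_append last_conv_nth)
    qed
    then show ?thesis using p' assms by auto
  qed (use assms in auto)
qed

text \<open>A well-formed gate without in-neighbours is an input, so walking backwards ends at one.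
  A failure of the recursion needs such a path as its witness.\<close>

lemma io_path_ex:
  assumes "wf_gates gs" "j < length gs"
  shows "\<exists>p. io_path (gs, j) p"
  using assms(2)
proof (induction j rule: less_induct)
  case (less j)
  show ?case
  proof (cases "preds (gs ! j)")
    case Nil
    then show ?thesis using wf_Input[OF assms(1) less.prems] io_path_snoc[OF assms(1) less.prems] by auto
  next
    case (Cons i js)
    then have "i < j" using wf_preds[OF assms(1) less.prems] by simp
    then obtain p where p: "io_path (gs, i) p" using less by force
    have "i \<in> set (preds (gs ! j))" using Cons by simp
    then have "io_path (gs, j) (p @ [j])"
      using p io_path_snoc[OF assms(1) less.prems, of "p @ [j]"] by blast
    then show ?thesis by blast
  qed
qed

lemma weft_depth_iff:
  assumes wf: "wf_gates gs" and j: "j < length gs"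
  shows "weft_depth d c gs j \<longleftrightarrow> (\<forall>p. io_path (gs, j) p \<longrightarrow>
    length p \<le> Suc d \<and> length (filter (\<lambda>i. large (gs ! i)) p) \<le> c)"
  using j
proof (induction d arbitrary: c j)
  case 0
  show ?case
  proof (cases "preds (gs ! j)")
    case Nil
    then show ?thesis using io_path_snoc[OF wf 0] 0 by (auto simp: large_def)
  next
    case (Cons i js)
    then have "i < length gs" using wf_preds[OF wf 0, of i] 0 by simp
    then obtain p where p: "io_path (gs, i) p" using io_path_ex[OF wf] by blast
    have "i \<in> set (preds (gs ! j))" using Cons by simp
    then have "io_path (gs, j) (p @ [j])"
      using p io_path_snoc[OF wf 0, of "p @ [j]"] by blast
    moreover have "\<not> length (p @ [j]) \<le> Suc 0" using p by auto
    moreover have "\<not> weft_depth 0 c gs j" using Cons 0 by simp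
    ultimately show ?thesis by blast
  qed
next
  case (Suc d)
  have i: "i < length gs" if "i \<in> set (preds (gs ! j))" for i
    using wf_preds[OF wf Suc.prems that] Suc.prems by simp
  have e: "(\<forall>p. io_path (gs, j) p \<longrightarrow> Q p) \<longleftrightarrow> (gs ! j = Input \<longrightarrow> Q [j]) \<and>
      (\<forall>i\<in>set (preds (gs ! j)). \<forall>p. io_path (gs, i) p \<longrightarrow> Q (p @ [j]))" for Q
    unfolding io_path_snoc[OF wf Suc.prems] by blast
  have x: "\<exists>i. i \<in> set (preds (gs ! j))" if "large (gs ! j)" using that by (cases "preds (gs ! j)") (auto simp: large_def)
  have ex: "\<exists>p. io_path (gs, i) p" if "i \<in> set (preds (gs ! j))" for i
    using io_path_ex[OF wf i[OF that]] .
  show ?case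
  proof (cases "large (gs ! j)")
    case True
    have "weft_depth (Suc d) c gs j \<longleftrightarrow> c \<noteq> 0 \<and> (\<forall>i\<in>set (preds (gs ! j)). \<forall>p. io_path (gs, i) p \<longrightarrow>
      length p \<le> Suc d \<and> length (filter (\<lambda>i. large (gs ! i)) p) \<le> c - 1)"
      using True Suc.prems Suc.IH i by simp
    also have "\<dots> \<longleftrightarrow> (\<forall>i\<in>set (preds (gs ! j)). \<forall>p. io_path (gs, i) p \<longrightarrow>
      length p \<le> Suc d \<and> length (filter (\<lambda>i. large (gs ! i)) p) < c)"
    proof (cases c)
      case 0
      \<comment> \<open>With an empty budget the right-hand side has to fail, which takes an actual
        path.\<close>
      obtain i p where "i \<in> set (preds (gs ! j))" "io_path (gs, i) p" using x[OF True] ex by blast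
      then show ?thesis using 0 by (metis not_less_zero)
    qed (simp add: less_Suc_eq_le del: io_path.simps)
    finally have w: "weft_depth (Suc d) c gs j \<longleftrightarrow> \<dots>" .
    have "gs ! j \<noteq> Input" using True by (auto simp: large_def)
    then show ?thesis unfolding w e using True by (simp add: Suc_le_eq less_Suc_eq_le del: io_path.simps)
  next
    case False
    have "weft_depth (Suc d) c gs j \<longleftrightarrow> (\<forall>i\<in>set (preds (gs ! j)). \<forall>p. io_path (gs, i) p \<longrightarrow>
      length p \<le> Suc d \<and> length (filter (\<lambda>i. large (gs ! i)) p) \<le> c)"
      using False Suc.prems Suc.IH i by simp
    then show ?thesis unfolding e using False by (auto simp del: io_path.simps weft_depth.simps)
  qed
qed

lemma weft_depth_circuit:
  assumes "wf_circuit (gs, out)"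
  shows "weft_le c (gs, out) \<and> depth_le d (gs, out) \<longleftrightarrow> weft_depth d c gs out"
proof -
  have wf: "wf_gates gs" "out < length gs" using assms by (auto simp: wf_gates_def)
  show ?thesis unfolding weft_depth_iff[OF wf] weft_le_def depth_le_def by auto
qed


section \<open>Disjunctive normal forms\<close>

lemma length_foldl_append: "length (foldl (\<lambda>vs g. vs @ [h vs g]) vs gs) = length vs + length gs"
  by (induction gs arbitrary: vs) auto

lemma take_foldl_append:
  "i \<le> length vs \<Longrightarrow> take i (foldl (\<lambda>vs g. vs @ [h vs g]) vs gs) = take i vs"
  by (induction gs arbitrary: vs) auto

text \<open>The fold only appends, so later gates leave the first \<open>Suc j\<close> values
  unchanged.\<close>

lemma node_vals_nth:
  assumes "j < length gs"
  shows "node_vals S gs ! j = gate_val S (take j (node_vals S gs)) (gs ! j)"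
proof -
  define F where "F = foldl (\<lambda>vs g. vs @ [gate_val S vs g])"
  have nv: "node_vals S gs = F [] gs" by (simp add: node_vals_def F_def)
  let ?u = "F [] (take j gs)"
  have l: "length ?u = j" using assms by (simp add: F_def length_foldl_append)
  have "gs = take j gs @ gs ! j # drop (Suc j) gs" using assms by (simp add: id_take_nth_drop)
  then have "F [] gs = F [] (take j gs @ gs ! j # drop (Suc j) gs)" by simp
  then have e: "F [] gs = F (?u @ [gate_val S ?u (gs ! j)]) (drop (Suc j) gs)" by (simp add: F_def)
  have t: "take i (F vs xs) = take i vs" if "i \<le> length vs" for i vs xs
    using that by (simp add: F_def take_foldl_append)
  have a: "take j (F [] gs) = ?u" unfolding e using t[of j "?u @ [gate_val S ?u (gs ! j)]"] l by simp
  have b: "take (Suc j) (F [] gs) = ?u @ [gate_val S ?u (gs ! j)]"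
    unfolding e using t[of "Suc j" "?u @ [gate_val S ?u (gs ! j)]"] l by simp
  have "F [] gs ! j = take (Suc j) (F [] gs) ! j" by simp
  also have "\<dots> = gate_val S ?u (gs ! j)" unfolding b using l by (simp add: nth_append)
  finally show ?thesis unfolding nv a .
qed

lemma length_node_vals [simp]: "length (node_vals S gs) = length gs"
  by (simp add: node_vals_def length_foldl_append)

lemma node_vals_cases:
  assumes "wf_gates gs" "j < length gs"
  shows "node_vals S gs ! j \<longleftrightarrow> (case gs ! j of Input \<Rightarrow> j \<in> S | Neg i \<Rightarrow> \<not> node_vals S gs ! i
    | Conj js \<Rightarrow> (\<forall>i\<in>set js. node_vals S gs ! i) | Disj js \<Rightarrow> (\<exists>i\<in>set js. node_vals S gs ! i))"
  using wf_preds[OF assms] assms(2) by (subst node_vals_nth) (auto split: gate.split)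

text \<open>A value \<open>b\<close> of node \<open>j\<close> as a disjunction of conjunctions of values of other nodes. The
  expansion stops at inputs and at large gates all of whose in-neighbours must have the value \<open>b\<close>.
  Large gates that need only one such in-neighbour, and small gates, are expanded.\<close>

fun dnf :: "nat \<Rightarrow> gate list \<Rightarrow> nat \<Rightarrow> bool \<Rightarrow> (nat \<times> bool) list list" where
  "dnf 0 gs j b = [[(j, b)]]"
| "dnf (Suc d) gs j b =
    (if gtag (gate_at gs j) = 0 then [[(j, b)]]
     else if gtag (gate_at gs j) = 1 then concat (map (\<lambda>i. dnf d gs i (\<not> b)) (preds (gate_at gs j)))
     else if b = (gtag (gate_at gs j) = 2) then
       (if large (gate_at gs j) then [[(j, b)]]
        else concat (map (\<lambda>x. map (\<lambda>y. x @ y) (dnf d gs (nthd 0 (preds (gate_at gs j)) 1) b))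
          (dnf d gs (nthd 0 (preds (gate_at gs j)) 0) b)))
     else concat (map (\<lambda>i. dnf d gs i b) (preds (gate_at gs j))))"

lemma pt_dnf: "pt (\<lambda>p. dnf d (fst p) (fst (snd p)) (snd (snd p)))"
proof (induction d)
  case (Suc d)
  show ?case unfolding dnf.simps by (intro pt_intros pt_comp3[where g = "dnf d", OF Suc])
qed (unfold dnf.simps, intro pt_intros)

text \<open>This is why the product of two expansions in \<open>dnf\<close> accounts for all
  in-neighbours of a small gate.\<close>

lemma not_large_two:
  assumes "wf_gate j g" "\<not> large g" "2 \<le> gtag g"
  shows "set (preds g) = {nthd 0 (preds g) 0, nthd 0 (preds g) 1}"
proof -
  have "length (preds g) = 2" using assms by (cases g) (auto simp: large_def)
  then obtain x y where "preds g = [x, y]" by (auto simp: numeral_2_eq_2 length_Suc_conv)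
  then show ?thesis by (auto simp: nthd_def)
qed

lemma dnf_correct:
  assumes "wf_gates gs" "j < length gs"
  shows "node_vals S gs ! j = b \<longleftrightarrow> (\<exists>Z\<in>set (dnf d gs j b). \<forall>(i, c)\<in>set Z. node_vals S gs ! i = c)"
  using assms(2)
proof (induction d arbitrary: j b)
  case (Suc d)
  let ?g = "gs ! j" and ?v = "\<lambda>i. node_vals S gs ! i"
  let ?T = "\<lambda>Z. \<forall>(i, c)\<in>set Z. ?v i = c"
  have wg: "wf_gate j ?g" using wf_gates_nth[OF assms(1) Suc.prems] .
  have IH: "?v i = c \<longleftrightarrow> (\<exists>Z\<in>set (dnf d gs i c). ?T Z)" if "i \<in> set (preds ?g)" for i c
    using wf_preds[OF assms(1) Suc.prems that] Suc.prems by (intro Suc.IH) simp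
  note c = node_vals_cases[OF assms(1) Suc.prems, of S]
  have C: "?v j = (\<forall>i\<in>set (preds ?g). ?v i)" if "gtag ?g = 2"
    using c that by (cases ?g) auto
  have D: "?v j = (\<exists>i\<in>set (preds ?g). ?v i)" if "2 \<le> gtag ?g" "gtag ?g \<noteq> 2"
    using c that by (cases ?g) auto
  \<comment> \<open>\<open>b = (gtag ?g = 2)\<close> singles out the value that the gate takes only
    if all in-neighbours take it: true for a conjunction, false for a disjunction. The opposite
    value needs just one in-neighbour.\<close>
  consider "gtag ?g = 0" | "gtag ?g = 1" | (all) "2 \<le> gtag ?g" "b = (gtag ?g = 2)" "large ?g"
    | (small) "2 \<le> gtag ?g" "b = (gtag ?g = 2)" "\<not> large ?g"
    | (some) "2 \<le> gtag ?g" "b \<noteq> (gtag ?g = 2)" by linarith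
  then show ?case
  proof cases
    case 2
    then obtain i where i: "?g = Neg i" by (cases ?g) auto
    then have "?v j = b \<longleftrightarrow> ?v i = (\<not> b)" using c by auto
    then show ?thesis using IH[of i "\<not> b"] i Suc.prems by simp
  next
    case small
    let ?x = "nthd 0 (preds ?g) 0" and ?y = "nthd 0 (preds ?g) 1"
    note p = not_large_two[OF wg small(3,1)]
    have "?v j = b \<longleftrightarrow> (\<forall>i\<in>set (preds ?g). ?v i = b)"
      using C D small(1,2) by (cases b) auto
    also have "\<dots> \<longleftrightarrow> ?v ?x = b \<and> ?v ?y = b" unfolding p by simp
    also have "\<dots> \<longleftrightarrow> (\<exists>Z\<in>set (dnf d gs ?x b). ?T Z) \<and> (\<exists>Z\<in>set (dnf d gs ?y b). ?T Z)"
      using IH[of ?x b] IH[of ?y b] p by simp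
    also have "\<dots> \<longleftrightarrow> (\<exists>Z\<in>set (dnf (Suc d) gs j b). ?T Z)"
      using small Suc.prems by (auto simp: ball_Un)
    finally show ?thesis .
  next
    case some
    have "?v j = b \<longleftrightarrow> (\<exists>i\<in>set (preds ?g). ?v i = b)"
      using C D some by (cases b) auto
    also have "\<dots> \<longleftrightarrow> (\<exists>i\<in>set (preds ?g). \<exists>Z\<in>set (dnf d gs i b). ?T Z)"
      using IH by blast
    also have "\<dots> \<longleftrightarrow> (\<exists>Z\<in>set (dnf (Suc d) gs j b). ?T Z)"
      using some Suc.prems by auto
    finally show ?thesis .
  qed (use Suc.prems in auto)
qed auto

text \<open>Conjunctions are joined only at small gates, two at a time, so the length at most
  doubles per level.\<close>

lemma length_dnf:
  assumes "wf_gates gs" "j < length gs"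
  shows "Z \<in> set (dnf d gs j b) \<Longrightarrow> length Z \<le> 2 ^ d"
  using assms(2)
proof (induction d arbitrary: j b Z)
  case (Suc d)
  let ?g = "gs ! j"
  have IH: "length Z \<le> 2 ^ d" if "i \<in> set (preds ?g)" "Z \<in> set (dnf d gs i c)" for i c Z
    using wf_preds[OF assms(1) Suc.prems(2) that(1)] Suc.prems by (intro Suc.IH[OF that(2)]) simp
  have le: "n \<le> 2 ^ d \<Longrightarrow> n \<le> 2 ^ Suc d" for n :: nat by simp
  show ?case
  proof (cases "2 \<le> gtag ?g \<and> b = (gtag ?g = 2) \<and> \<not> large ?g")
    case True
    note p = not_large_two[OF wf_gates_nth[OF assms(1) Suc.prems(2)]]
    obtain x y where xy: "Z = x @ y" "x \<in> set (dnf d gs (nthd 0 (preds ?g) 0) b)"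
        "y \<in> set (dnf d gs (nthd 0 (preds ?g) 1) b)"
      using True Suc.prems by auto
    have "length x \<le> 2 ^ d" "length y \<le> 2 ^ d" using IH xy p True by auto
    then show ?thesis using xy by simp
  next
    case False
    then have "Z = [(j, b)] \<or> (\<exists>i\<in>set (preds ?g). \<exists>c. Z \<in> set (dnf d gs i c))"
      using Suc.prems by (cases ?g) (auto split: if_splits)
    then show ?thesis
      by (elim disjE bexE exE) (simp, blast intro: le IH)
  qed
qed auto

text \<open>Entries found one level down can thereby be reported with the depth of the current level
  in \<open>dnf_entries\<close>.\<close>

lemma weft_depth_Suc: "weft_depth d c gs j \<Longrightarrow> weft_depth (Suc d) c gs j"
proof (induction d arbitrary: c j)
  case (Suc d)
  show ?case unfolding weft_depth.simps(2)[of "Suc d"]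
    using Suc.prems[unfolded weft_depth.simps(2)] Suc.IH
    by (auto split: if_splits simp del: weft_depth.simps)
qed (auto simp: large_def)

text \<open>Without large gates nothing stops the expansion before the inputs, and depth
  \<open>d\<close> is enough to reach them.\<close>

lemma dnf_no_large:
  assumes "wf_gates gs" "j < length gs" "weft_depth d 0 gs j"
  shows "Z \<in> set (dnf d gs j b) \<Longrightarrow> (i, c) \<in> set Z \<Longrightarrow> i < length gs \<and> gs ! i = Input"
  using assms(2,3)
proof (induction d arbitrary: j b Z)
  case 0
  then show ?case using wf_Input[OF assms(1)] by auto
next
  case (Suc d)
  let ?g = "gs ! j"
  have nl: "\<not> large ?g" using Suc.prems by auto
  have IH: "i < length gs \<and> gs ! i = Input" if "i' \<in> set (preds ?g)" "Z \<in> set (dnf d gs i' b)" "(i, c) \<in> set Z" for i' b Z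
    using wf_preds[OF assms(1) Suc.prems(3) that(1)] Suc.prems that nl by (intro Suc.IH[OF that(2,3)]) auto
  note p = not_large_two[OF wf_gates_nth[OF assms(1) Suc.prems(3)] nl]
  show ?case
  proof (cases "2 \<le> gtag ?g \<and> b = (gtag ?g = 2)")
    case True
    obtain x y where xy: "Z = x @ y" "x \<in> set (dnf d gs (nthd 0 (preds ?g) 0) b)"
        "y \<in> set (dnf d gs (nthd 0 (preds ?g) 1) b)"
      using True nl Suc.prems by auto
    then show ?thesis using IH xy p True Suc.prems(2) by auto
  next
    case False
    then have "?g = Input \<and> Z = [(j, b)] \<or> (\<exists>i\<in>set (preds ?g). \<exists>c. Z \<in> set (dnf d gs i c))"
      using Suc.prems nl by (cases ?g) (auto split: if_splits)
    then show ?thesis using IH Suc.prems by auto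
  qed
qed

text \<open>The expansion stops early only at large gates whose value requires all in-neighbours;
  these retain their weft for a later expansion of the negation. Beyond an expanded large gate the
  weft is spent, and \<open>dnf_no_large\<close> leaves only inputs.\<close>

lemma dnf_entries:
  assumes "wf_gates gs" "j < length gs" "weft_depth d 1 gs j"
  shows "Z \<in> set (dnf d gs j b) \<Longrightarrow> (i, c) \<in> set Z \<Longrightarrow> i < length gs \<and> (gs ! i = Input \<or>
    large (gs ! i) \<and> 2 \<le> gtag (gs ! i) \<and> c = (gtag (gs ! i) = 2) \<and> weft_depth d 1 gs i)"
  using assms(2,3)
proof (induction d arbitrary: j b Z)
  case 0
  then show ?case using wf_Input[OF assms(1)] by auto
next
  case (Suc d)
  let ?g = "gs ! j"
  let ?Q = "\<lambda>d i c. i < length gs \<and> (gs ! i = Input \<or>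
    large (gs ! i) \<and> 2 \<le> gtag (gs ! i) \<and> c = (gtag (gs ! i) = 2) \<and> weft_depth d 1 gs i)"
  have "Z = [(j, b)] \<and> ?Q (Suc d) j b \<or> (\<exists>x y. Z = x @ y \<and>
      (\<forall>z\<in>{x, y}. z = [] \<or> (\<exists>i\<in>set (preds ?g). \<exists>c. z \<in> set (dnf d gs i c))))"
  proof (cases "2 \<le> gtag ?g \<and> b = (gtag ?g = 2) \<and> \<not> large ?g")
    case True
    obtain x y where xy: "Z = x @ y" "x \<in> set (dnf d gs (nthd 0 (preds ?g) 0) b)"
        "y \<in> set (dnf d gs (nthd 0 (preds ?g) 1) b)"
      using True Suc.prems by auto
    then show ?thesis using True not_large_two[OF wf_gates_nth[OF assms(1) Suc.prems(3)]] by blast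
  next
    case False
    then have "Z = [(j, b)] \<and> ?Q (Suc d) j b \<or> (\<exists>i\<in>set (preds ?g). \<exists>c. Z \<in> set (dnf d gs i c))"
      using Suc.prems by (cases ?g) (auto split: if_splits)
    then show ?thesis by force
  qed
  then show ?case
  proof (elim disjE exE conjE)
    fix x y assume Z: "Z = x @ y"
      and xy: "\<forall>z\<in>{x, y}. z = [] \<or> (\<exists>i\<in>set (preds ?g). \<exists>c. z \<in> set (dnf d gs i c))"
    obtain z where z: "z \<in> {x, y}" "(i, c) \<in> set z" using Suc.prems(2) Z by auto
    then obtain i' b' where i': "i' \<in> set (preds ?g)" "z \<in> set (dnf d gs i' b')" using xy by fastforce
    have l: "i' < length gs" using wf_preds[OF assms(1) Suc.prems(3) i'(1)] Suc.prems(3) by simp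
    show ?thesis
    proof (cases "large ?g")
      case True
      then have "weft_depth d 0 gs i'" using Suc.prems i'(1) by auto
      then show ?thesis using dnf_no_large[OF assms(1) l _ i'(2) z(2)] by simp
    next
      case False
      then have "weft_depth d 1 gs i'" using Suc.prems i'(1) by auto
      then show ?thesis using Suc.IH[OF i'(2) z(2) l] weft_depth_Suc by blast
    qed
  qed (use Suc.prems in auto)
qed

text \<open>A member of \<open>obstacles\<close> belongs to one conjunction of the normal form of the output and
  lists the ways in which that conjunction can fail, each a conjunction of literals.\<close>

definition obstacles :: "nat \<Rightarrow> gate list \<Rightarrow> nat \<Rightarrow> (nat \<times> bool) list list list" where
  "obstacles d gs out = map (\<lambda>Z. concat (map (\<lambda>(j, b). dnf d gs j (\<not> b)) Z)) (dnf d gs out True)"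

lemma pt_obstacles [pt_intros]:
  assumes "pt gs" "pt out" shows "pt (\<lambda>a. obstacles d (gs a) (out a))"
  unfolding obstacles_def
  by (intro pt_intros pt_comp3[where g = "dnf d", OF pt_dnf] pt_comp[OF assms(1)] pt_comp[OF assms(2)])

text \<open>Negating the value of an unexpanded large gate yields one that needs a single
  in-neighbour, and this \<open>dnf\<close> does expand. That uses up the weft, so only input
  literals remain.\<close>

lemma obstacles_literals:
  assumes "wf_gates gs" "out < length gs" "weft_depth d 1 gs out"
    and "X \<in> set (obstacles d gs out)" "P \<in> set X"
  shows "length P \<le> 2 ^ d" "(i, c) \<in> set P \<Longrightarrow> i < length gs \<and> gs ! i = Input"
proof -
  obtain Z j b where Z: "Z \<in> set (dnf d gs out True)" "(j, b) \<in> set Z" "P \<in> set (dnf d gs j (\<not> b))"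
    using assms(4,5) by (auto simp: obstacles_def)
  note e = dnf_entries[OF assms(1-3) Z(1,2)]
  show "length P \<le> 2 ^ d" using length_dnf[OF assms(1) _ Z(3)] e by simp
  assume ic: "(i, c) \<in> set P"
  show "i < length gs \<and> gs ! i = Input"
  proof (cases "gs ! j = Input")
    case True
    then have "dnf d gs j (\<not> b) = [[(j, \<not> b)]]" using e by (cases d) auto
    then show ?thesis using Z(3) ic e True by auto
  next
    case False
    with e have j: "j < length gs" "large (gs ! j)" "2 \<le> gtag (gs ! j)" "b = (gtag (gs ! j) = 2)"
      "weft_depth d 1 gs j" by auto
    then obtain d' where d: "d = Suc d'" by (cases d) (auto simp: large_def)
    have "P \<in> set (concat (map (\<lambda>i. dnf d' gs i (\<not> b)) (preds (gs ! j))))"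
      using Z(3) j unfolding d by simp
    then obtain i' where i': "i' \<in> set (preds (gs ! j))" "P \<in> set (dnf d' gs i' (\<not> b))" by auto
    have "weft_depth d' 0 gs i'" using j i' unfolding d by auto
    moreover have "i' < length gs" using wf_preds[OF assms(1) j(1) i'(1)] j(1) by simp
    ultimately show ?thesis using dnf_no_large[OF assms(1) _ _ i'(2) ic] by blast
  qed
qed

lemma satisfies_iff_obstacles:
  assumes "wf_gates gs" "out < length gs" "weft_depth d 1 gs out"
  shows "satisfies S (gs, out) \<longleftrightarrow>
    (\<exists>X\<in>set (obstacles d gs out). \<forall>P\<in>set X. \<exists>(i, c)\<in>set P. (i \<in> S) \<noteq> c)"
proof -
  let ?v = "\<lambda>i. node_vals S gs ! i"
  let ?T = "\<lambda>Z. \<forall>(i, c)\<in>set Z. ?v i = c"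
  have "satisfies S (gs, out) \<longleftrightarrow> (\<exists>Z\<in>set (dnf d gs out True). ?T Z)"
    using dnf_correct[OF assms(1,2), of S True d] by (simp add: satisfies_def)
  \<comment> \<open>Each entry is treated through its negation: it holds iff every conjunction in
    the normal form of the opposite value fails.\<close>
  also have "\<dots> \<longleftrightarrow> (\<exists>Z\<in>set (dnf d gs out True). \<forall>(j, b)\<in>set Z. \<forall>P\<in>set (dnf d gs j (\<not> b)). \<not> ?T P)"
  proof (rule bex_cong[OF refl], rule ball_cong[OF refl], clarify)
    fix Z j b assume "Z \<in> set (dnf d gs out True)" "(j, b) \<in> set Z"
    then have "j < length gs" using dnf_entries[OF assms] by blast
    then show "?v j = b \<longleftrightarrow> (\<forall>P\<in>set (dnf d gs j (\<not> b)). \<not> ?T P)"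
      using dnf_correct[OF assms(1), of j S "\<not> b" d] by auto
  qed
  also have "\<dots> \<longleftrightarrow> (\<exists>X\<in>set (obstacles d gs out). \<forall>P\<in>set X. \<not> ?T P)"
    by (fastforce simp: obstacles_def)
  also have "\<dots> \<longleftrightarrow> (\<exists>X\<in>set (obstacles d gs out). \<forall>P\<in>set X. \<exists>(i, c)\<in>set P. (i \<in> S) \<noteq> c)"
  proof (intro bex_cong ball_cong refl)
    fix X P assume XP: "X \<in> set (obstacles d gs out)" "P \<in> set X"
    have "?v i \<longleftrightarrow> i \<in> S" if "(i, c) \<in> set P" for i c
      using node_vals_cases[OF assms(1), of i S] obstacles_literals(2)[OF assms XP that] by simp
    then have "?T P \<longleftrightarrow> (\<forall>(i, c)\<in>set P. (i \<in> S) = c)" by (intro ball_cong refl) auto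
    then show "\<not> ?T P \<longleftrightarrow> (\<exists>(i, c)\<in>set P. (i \<in> S) \<noteq> c)" by auto
  qed
  finally show ?thesis .
qed


section \<open>Saturated stars\<close>

text \<open>A single bag with all vertices is a tree decomposition.\<close>

lemma treewidth_le:
  assumes "finite (verts G)" "\<forall>e\<in>edges G. e \<subseteq> verts G"
  shows "treewidth G \<le> card (verts G) - 1"
proof -
  let ?T = "\<lparr>verts = {0::nat}, edges = {}\<rparr>" and ?B = "\<lambda>_::nat. verts G"
  have "is_path ?T 0 [0] 0" by (simp add: is_path_def path_edges_def)
  then have p: "\<exists>p. is_path ?T 0 p 0" by blast
  have "is_tree ?T"
    using p by (auto simp: is_tree_def simple_graph_def connected_def has_cycle_def)
  moreover have "induced ?T {x. v \<in> ?B x} = ?T" if "v \<in> verts G" for v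
    using that by (simp add: induced_def)
  moreover have "connected ?T" using p by (simp add: connected_def)
  ultimately have "tree_decomposition G ?T ?B"
    using assms by (auto simp: tree_decomposition_def)
  moreover have "decomposition_width ?T ?B = card (verts G) - 1"
    by (simp add: decomposition_width_def)
  ultimately show ?thesis unfolding treewidth_def by (intro Least_le) blast
qed

lemma max_degree_le:
  assumes "finite (edges G)" "finite (verts G)" shows "max_degree G \<le> card (edges G)"
  unfolding max_degree_def using assms by (auto intro: card_mono)

section \<open>Instances on stars\<close>

definition star_code :: "nat \<Rightarrow> nat \<Rightarrow> nat task list \<Rightarrow> uf_code" where
  "star_code M c ts = (Suc M, map (\<lambda>v. (v, M, c)) [0..<M], ts, M * c, 2)"

definition touches :: "nat \<Rightarrow> nat task \<Rightarrow> bool" where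
  "touches v x \<longleftrightarrow> v = fst x \<or> v = fst (snd x)"

definition demand :: "nat task \<Rightarrow> nat" where "demand x = fst (snd (snd x))"

definition star_task :: "nat \<Rightarrow> nat \<Rightarrow> nat \<Rightarrow> nat \<Rightarrow> nat task" where
  "star_task M s t d = (s, t, d, d * ((if s < M then 1 else 0) + (if t < M then 1 else 0)))"

abbreviation star_graph :: "nat \<Rightarrow> nat ugraph" where
  "star_graph M \<equiv> \<lparr>verts = {..<Suc M}, edges = (\<lambda>v. {v, M}) ` {..<M}\<rparr>"

lemma uf_graph_star [simp]: "uf_graph (uf_of_code (star_code M c ts)) = star_graph M"
  by (auto simp: star_code_def image_image atLeast0LessThan)

lemma uf_simps_star [simp]:
  "uf_tasks (uf_of_code (star_code M c ts)) = set ts"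
  "uf_target (uf_of_code (star_code M c ts)) = M * c"
  "uf_bound (uf_of_code (star_code M c ts)) = 2"
  by (simp_all add: star_code_def)

lemma map_of_const: "k \<in> set ks \<Longrightarrow> map_of (map (\<lambda>x. (x, c)) ks) k = Some c"
  by (induction ks) auto

lemma uf_cap_star: "v < M \<Longrightarrow> uf_cap (uf_of_code (star_code M c ts)) {v, M} = c"
proof -
  assume "v < M"
  have e: "map (\<lambda>(u, v, c). ({u, v}, c)) (map (\<lambda>v. (v, M, c)) [0..<M]) =
      map (\<lambda>x. (x, c)) (map (\<lambda>v. {v, M}) [0..<M])" by simp
  have "map_of (map (\<lambda>x. (x, c)) (map (\<lambda>v. {v, M}) [0..<M])) {v, M} = Some c"
    by (rule map_of_const) (use \<open>v < M\<close> in auto)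
  then show ?thesis by (simp add: star_code_def e[simplified] comp_def)
qed

lemma uf_valid_star:
  assumes "distinct ts" "\<forall>x\<in>set ts. fst x \<le> M \<and> fst (snd x) \<le> M"
  shows "uf_valid (star_code M c ts)"
proof -
  have "uf_instance (uf_of_code (star_code M c ts))"
    using assms(2) by (auto simp: uf_instance_def simple_graph_def less_Suc_eq_le)
  moreover have "distinct (map (\<lambda>v. {v, M}) [0..<M])"
    by (auto simp: distinct_map inj_on_def doubleton_eq_iff)
  ultimately show ?thesis using assms(1) by (simp add: star_code_def comp_def)
qed

text \<open>Treewidth and degree contribute at most \<open>M\<close> each, the route length 2,
  whatever the tasks and capacities are.\<close>

lemma uf_param_star: "uf_param (uf_of_code (star_code M c ts)) \<le> 2 * M + 2"
proof -
  have "treewidth (star_graph M) \<le> card (verts (star_graph M)) - 1" by (rule treewidth_le) auto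
  moreover have "max_degree (star_graph M) \<le> card (edges (star_graph M))" by (rule max_degree_le) auto
  moreover have "card (edges (star_graph M)) \<le> M"
    using card_image_le[of "{..<M}" "\<lambda>v. {v, M}"] by simp
  ultimately show ?thesis by (simp add: uf_param_def)
qed

text \<open>Every edge contains the centre, so a leaf can be left or entered only through its own
  edge; the first and last edges of the path show this.\<close>

lemma path_in_star:
  assumes "is_path (star_graph M) s p t" "s \<noteq> t"
  shows "s < M \<Longrightarrow> {s, M} \<in> path_edges p" "t < M \<Longrightarrow> {t, M} \<in> path_edges p"
proof -
  have p: "p \<noteq> []" "hd p = s" "last p = t" "path_edges p \<subseteq> (\<lambda>v. {v, M}) ` {..<M}"
    using assms by (auto simp: is_path_def)
  then have l: "Suc 0 < length p" using assms(2) by (cases p) auto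
  have "{p ! 0, p ! 1} \<in> path_edges p" using l by (auto simp: path_edges_def)
  moreover have "p ! 0 = s" using p by (simp add: hd_conv_nth)
  ultimately show "s < M \<Longrightarrow> {s, M} \<in> path_edges p" using p(4) by (auto simp: doubleton_eq_iff)
  have "Suc (length p - 2) < length p" "Suc (length p - 2) = length p - 1" using l by auto
  then have "{p ! (length p - 2), p ! (length p - 1)} \<in> path_edges p"
    unfolding path_edges_def by (auto intro!: exI[of _ "length p - 2"])
  moreover have "p ! (length p - 1) = t" using p by (simp add: last_conv_nth)
  ultimately show "t < M \<Longrightarrow> {t, M} \<in> path_edges p" using p(4) by (auto simp: doubleton_eq_iff)
qed

text \<open>The profit of a task is its demand times the number of leaf edges on its route, so the
  target can only be reached by saturating every edge.\<close>

lemma uf_yes_star: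
  assumes ts: "\<And>x. x \<in> set ts \<Longrightarrow> \<exists>s t d. x = star_task M s t d \<and> s \<noteq> t \<and> s \<le> M \<and> t \<le> M"
  shows "uf_yes (uf_of_code (star_code M c ts)) \<longleftrightarrow>
    (\<exists>T\<subseteq>set ts. \<forall>v<M. sum demand {x \<in> T. touches v x} = c)"
proof -
  let ?I = "uf_of_code (star_code M c ts)"
  let ?w = "\<lambda>x::nat task. snd (snd (snd x))"
  have yes: "uf_yes ?I \<longleftrightarrow> (\<exists>T\<subseteq>set ts. (\<exists>\<rho>. flow_routing (star_graph M) (uf_cap ?I) 2 T \<rho>) \<and>
      M * c \<le> sum ?w T)"
    by (simp add: uf_yes_def case_prod_beta)
  have flow: "flow_routing (star_graph M) (uf_cap ?I) 2 T \<rho> \<longleftrightarrow>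
      (\<forall>x\<in>T. is_path (star_graph M) (fst x) (\<rho> x) (fst (snd x)) \<and> path_length (\<rho> x) \<le> 2) \<and>
      (\<forall>v<M. sum demand {x \<in> T. {v, M} \<in> path_edges (\<rho> x)} \<le> c)" for T \<rho>
    by (auto simp: flow_routing_def case_prod_beta uf_cap_star demand_def)
  \<comment> \<open>Double counting: a task contributes its demand once to each of its leaf
    endpoints.\<close>
  have profit: "sum ?w T = (\<Sum>v<M. sum demand {x \<in> T. touches v x})" if T: "T \<subseteq> set ts" for T
  proof -
    have fin: "finite T" using T finite_subset by blast
    have "?w x = (\<Sum>v<M. if touches v x then demand x else 0)" if x: "x \<in> T" for x
    proof -
      obtain s t d where x: "x = star_task M s t d" "s \<noteq> t" "s \<le> M" "t \<le> M" using ts x T by blast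
      have "(\<Sum>v<M. if touches v x then demand x else 0) = (\<Sum>v\<in>{v. v < M \<and> touches v x}. d)"
        by (rule sum.mono_neutral_cong_right) (auto simp: x star_task_def demand_def)
      also have "\<dots> = d * card {v. v < M \<and> touches v x}" by simp
      also have "{v. v < M \<and> touches v x} = (if s < M then {s} else {}) \<union> (if t < M then {t} else {})"
        by (auto simp: x touches_def star_task_def)
      also have "card \<dots> = (if s < M then 1 else 0) + (if t < M then 1 else 0)" using x(2) by auto
      finally show ?thesis by (simp add: x star_task_def)
    qed
    then have "sum ?w T = (\<Sum>x\<in>T. \<Sum>v<M. if touches v x then demand x else 0)" by simp
    also have "\<dots> = (\<Sum>v<M. \<Sum>x\<in>T. if touches v x then demand x else 0)" by (rule sum.swap)
    also have "\<dots> = (\<Sum>v<M. sum demand {x \<in> T. touches v x})"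
      using fin by (simp add: sum.inter_filter)
    finally show ?thesis .
  qed
  show ?thesis
  proof
    assume "uf_yes ?I"
    then obtain T \<rho> where T: "T \<subseteq> set ts" "flow_routing (star_graph M) (uf_cap ?I) 2 T \<rho>" "M * c \<le> sum ?w T"
      unfolding yes by blast
    have fin: "finite T" using T finite_subset by blast
    have le: "sum demand {x \<in> T. touches v x} \<le> c" if v: "v < M" for v
    proof -
      have "{x \<in> T. touches v x} \<subseteq> {x \<in> T. {v, M} \<in> path_edges (\<rho> x)}"
      proof safe
        fix s t d w assume x: "(s, t, d, w) \<in> T" "touches v (s, t, d, w)"
        have "s \<noteq> t" using ts[of "(s, t, d, w)"] x T(1) by (auto simp: star_task_def)
        moreover have "is_path (star_graph M) s (\<rho> (s, t, d, w)) t"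
          using T(2) x(1) unfolding flow by fastforce
        ultimately show "{v, M} \<in> path_edges (\<rho> (s, t, d, w))"
          using path_in_star x(2) v unfolding touches_def by fastforce
      qed
      then have "sum demand {x \<in> T. touches v x} \<le> sum demand {x \<in> T. {v, M} \<in> path_edges (\<rho> x)}"
        using fin by (intro sum_mono2) auto
      also have "\<dots> \<le> c" using T(2) v unfolding flow by blast
      finally show ?thesis .
    qed
    have "sum demand {x \<in> T. touches v x} = c" if v: "v < M" for v
    proof (rule ccontr)
      assume "sum demand {x \<in> T. touches v x} \<noteq> c"
      with le[OF v] have "sum demand {x \<in> T. touches v x} < c" by (rule le_neq_implies_less)
      then have "(\<Sum>v<M. sum demand {x \<in> T. touches v x}) < (\<Sum>v<M. c)"
        using le v by (intro sum_strict_mono_ex1) (auto intro!: bexI[of _ v])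
      then show False using T(3) profit[OF T(1)] by simp
    qed
    then show "\<exists>T\<subseteq>set ts. \<forall>v<M. sum demand {x \<in> T. touches v x} = c" using T(1) by blast
  next
    assume "\<exists>T\<subseteq>set ts. \<forall>v<M. sum demand {x \<in> T. touches v x} = c"
    then obtain T where T: "T \<subseteq> set ts" and c: "\<forall>v<M. sum demand {x \<in> T. touches v x} = c" by blast
    \<comment> \<open>A task ending at the centre takes its leaf edge alone, since a detour would
      repeat the centre.\<close>
    define \<rho> :: "nat task \<Rightarrow> nat list" where
      "\<rho> x = (if fst x = M \<or> fst (snd x) = M then [fst x, fst (snd x)] else [fst x, M, fst (snd x)])" for x
    have pe: "path_edges [a, b] = {{a, b}}" "path_edges [a, b, e] = {{a, b}, {b, e}}" for a b e :: nat
      by (auto simp: path_edges_def less_Suc_eq nth_Cons' intro: exI[of _ 0] exI[of _ "Suc 0"])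
    have "is_path (star_graph M) (fst x) (\<rho> x) (fst (snd x)) \<and> path_length (\<rho> x) \<le> 2 \<and>
        (\<forall>v<M. {v, M} \<in> path_edges (\<rho> x) \<longleftrightarrow> touches v x)" if xT: "x \<in> T" for x
    proof -
      obtain s t d where x: "x = star_task M s t d" "s \<noteq> t" "s \<le> M" "t \<le> M" using ts xT T by blast
      then have "s < M \<or> s = M" "t < M \<or> t = M" by auto
      then show ?thesis using x
        by (auto simp: \<rho>_def is_path_def path_length_def pe touches_def star_task_def doubleton_eq_iff insert_commute)
    qed
    then have "flow_routing (star_graph M) (uf_cap ?I) 2 T \<rho>"
      unfolding flow using c by (auto cong: conj_cong)
    moreover have "M * c \<le> sum ?w T" using profit[OF T] c by simp
    ultimately show "uf_yes ?I" unfolding yes using T by blast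
  qed
qed


section \<open>Binary constraints on a grid\<close>

text \<open>Remainders modulo \<open>B\<close> give the digits one by one. Thus a single equation
  between demands and a capacity acts as five independent equations.\<close>

lemma digits_unique:
  fixes B :: nat
  assumes "(\<Sum>h<k. x h * B ^ h) = (\<Sum>h<k. y h * B ^ h)" "\<And>h. h < k \<Longrightarrow> x h < B" "\<And>h. h < k \<Longrightarrow> y h < B"
  shows "\<forall>h<k. x h = y h"
  using assms
proof (induction k arbitrary: x y)
  case (Suc k)
  have e: "(\<Sum>h<Suc k. z h * B ^ h) = z 0 + B * (\<Sum>h<k. z (Suc h) * B ^ h)" for z :: "nat \<Rightarrow> nat"
    by (subst sum.lessThan_Suc_shift) (simp add: sum_distrib_left mult_ac)
  have lt: "x 0 < B" "y 0 < B" using Suc.prems by auto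
  have eq: "x 0 + B * (\<Sum>h<k. x (Suc h) * B ^ h) = y 0 + B * (\<Sum>h<k. y (Suc h) * B ^ h)"
    using Suc.prems(1) unfolding e .
  from arg_cong[OF eq, of "\<lambda>n. n mod B"] have 0: "x 0 = y 0" using lt by simp
  then have "(\<Sum>h<k. x (Suc h) * B ^ h) = (\<Sum>h<k. y (Suc h) * B ^ h)" using eq lt by simp
  then have "\<forall>h<k. x (Suc h) = y (Suc h)" using Suc.prems by (intro Suc.IH) auto
  then show ?case using 0 by (auto simp: less_Suc_eq_0_disj)
qed simp

definition csp :: "nat \<Rightarrow> nat \<Rightarrow> (nat \<Rightarrow> nat \<Rightarrow> nat \<Rightarrow> nat \<Rightarrow> bool) \<Rightarrow> bool" where
  "csp m n P \<longleftrightarrow> (\<exists>y. (\<forall>i<m. y i < n) \<and> (\<forall>i<m. \<forall>j<m. P i j (y i) (y j)))"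

text \<open>At most \<open>4 * n + n * n\<close> labels meet a cell, each with digits at most
  \<open>2 * n\<close>; the remaining summands keep the base above the capacity digits too. Hence
  digit sums never carry.\<close>

definition base :: "nat \<Rightarrow> nat" where
  "base n = 2 * n * (4 * n + n * n) + 3 * n + 2"

text \<open>The offset \<open>n\<close> keeps one task below \<open>2 * n\<close> and makes any two
  reach it, so a digit reveals that exactly one was chosen. The parity of \<open>t\<close> separates
  the tasks on the two sides of a cell.\<close>

definition row_task :: "nat \<Rightarrow> nat \<Rightarrow> nat \<Rightarrow> nat \<Rightarrow> nat \<Rightarrow> nat task" where
  "row_task m n i t a = star_task (m * m) (if t = 0 then m * m else i * m + (t - 1))
     (if t = m then m * m else i * m + t) ((n + a) * (if odd t then base n else 1))"

definition col_task :: "nat \<Rightarrow> nat \<Rightarrow> nat \<Rightarrow> nat \<Rightarrow> nat \<Rightarrow> nat task" where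
  "col_task m n j t b = star_task (m * m) (if t = 0 then m * m else (t - 1) * m + j)
     (if t = m then m * m else t * m + j) ((n + b) * (if odd t then base n ^ 3 else base n ^ 2))"

text \<open>\<open>2 * n - a\<close> complements the \<open>n + a\<close> of the row task on either
  side to \<open>3 * n\<close>, and likewise \<open>b\<close> for the columns.\<close>

definition cell_task :: "nat \<Rightarrow> nat \<Rightarrow> nat \<Rightarrow> nat \<Rightarrow> nat \<Rightarrow> nat \<Rightarrow> nat task" where
  "cell_task m n i j a b = star_task (m * m) (i * m + j) (m * m)
     ((2 * n - a) * (1 + base n) + (2 * n - b) * (base n ^ 2 + base n ^ 3) + base n ^ 4)"

definition csp_cap :: "nat \<Rightarrow> nat" where
  "csp_cap n = 3 * n * (1 + base n + base n ^ 2 + base n ^ 3) + base n ^ 4"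

text \<open>Equal pairs on the diagonal tie row \<open>i\<close> and column \<open>i\<close> to the
  same variable; \<open>remdups\<close> meets the distinctness demanded of instance codes.\<close>

definition csp_tasks :: "nat \<Rightarrow> nat \<Rightarrow> (nat \<Rightarrow> nat \<Rightarrow> nat \<Rightarrow> nat \<Rightarrow> bool) \<Rightarrow> nat task list" where
  "csp_tasks m n P = remdups
    (concat (map (\<lambda>i. concat (map (\<lambda>t. map (\<lambda>a. row_task m n i t a) [0..<n]) [0..<Suc m])) [0..<m]) @
     concat (map (\<lambda>j. concat (map (\<lambda>t. map (\<lambda>b. col_task m n j t b) [0..<n]) [0..<Suc m])) [0..<m]) @
     concat (map (\<lambda>i. concat (map (\<lambda>j. concat (map (\<lambda>a. map (\<lambda>b. cell_task m n i j a b)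
        (filter (\<lambda>b. P i j a b \<and> (i = j \<longrightarrow> a = b)) [0..<n])) [0..<n])) [0..<m])) [0..<m]))"

text \<open>The label \<open>Row i t a\<close> stands for the task that carries value \<open>a\<close> of variable \<open>i\<close> from cell
  \<open>(i, t - 1)\<close> to cell \<open>(i, t)\<close>, where the centre replaces cells outside the grid; dually for
  \<open>Col\<close>. Demands are read in base \<open>base n\<close>: digits 0 and 1 belong to row tasks of even and odd
  \<open>t\<close>, digits 2 and 3 to column tasks, and digit 4 counts the cell tasks.\<close>

datatype label = Row nat nat nat | Col nat nat nat | Cell nat nat nat nat

fun label_ok :: "nat \<Rightarrow> nat \<Rightarrow> (nat \<Rightarrow> nat \<Rightarrow> nat \<Rightarrow> nat \<Rightarrow> bool) \<Rightarrow> label \<Rightarrow> bool" where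
  "label_ok m n P (Row i t a) \<longleftrightarrow> i < m \<and> t \<le> m \<and> a < n"
| "label_ok m n P (Col j t b) \<longleftrightarrow> j < m \<and> t \<le> m \<and> b < n"
| "label_ok m n P (Cell i j a b) \<longleftrightarrow> i < m \<and> j < m \<and> a < n \<and> b < n \<and> P i j a b \<and> (i = j \<longrightarrow> a = b)"

fun task_of :: "nat \<Rightarrow> nat \<Rightarrow> label \<Rightarrow> nat task" where
  "task_of m n (Row i t a) = row_task m n i t a"
| "task_of m n (Col j t b) = col_task m n j t b"
| "task_of m n (Cell i j a b) = cell_task m n i j a b"

fun at_cell :: "nat \<Rightarrow> nat \<Rightarrow> label \<Rightarrow> bool" where
  "at_cell i j (Row i' t a) \<longleftrightarrow> i' = i \<and> (t = j \<or> t = Suc j)"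
| "at_cell i j (Col j' t b) \<longleftrightarrow> j' = j \<and> (t = i \<or> t = Suc i)"
| "at_cell i j (Cell i' j' a b) \<longleftrightarrow> i' = i \<and> j' = j"

fun digit :: "nat \<Rightarrow> nat \<Rightarrow> label \<Rightarrow> nat" where
  "digit n h (Row i t a) = (if h = t mod 2 then n + a else 0)"
| "digit n h (Col j t b) = (if h = 2 + t mod 2 then n + b else 0)"
| "digit n h (Cell i j a b) = (if h < 2 then 2 * n - a else if h < 4 then 2 * n - b else 1)"

lemma set_csp_tasks: "set (csp_tasks m n P) = task_of m n ` Collect (label_ok m n P)"
proof -
  have "Collect (label_ok m n P) = (\<Union>i<m. \<Union>t\<le>m. Row i t ` {..<n}) \<union> (\<Union>j<m. \<Union>t\<le>m. Col j t ` {..<n}) \<union>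
    (\<Union>i<m. \<Union>j<m. \<Union>a<n. Cell i j a ` {b \<in> {..<n}. P i j a b \<and> (i = j \<longrightarrow> a = b)})" (is "_ = ?L")
  proof (rule set_eqI)
    show "l \<in> Collect (label_ok m n P) \<longleftrightarrow> l \<in> ?L" for l by (cases l) (auto simp: image_iff)
  qed
  then show ?thesis
    by (simp add: csp_tasks_def image_Un image_UN image_image atLeast0LessThan lessThan_Suc_atMost Un_assoc
        del: upt_Suc)
qed

lemma cell_less: "i < m \<Longrightarrow> j < m \<Longrightarrow> i * m + j < m * (m::nat)"
proof -
  assume "i < m" "j < m"
  then have "i * m + j < i * m + m" by simp
  also have "\<dots> = Suc i * m" by simp
  also have "\<dots> \<le> m * m" using \<open>i < m\<close> by (intro mult_right_mono) auto
  finally show ?thesis .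
qed

lemma cell_inj: "j < m \<Longrightarrow> j' < m \<Longrightarrow> i * m + j = i' * m + (j'::nat) \<longleftrightarrow> i = i' \<and> j = j'"
  by (metis add.commute div_mult_self3 div_less add_0 mod_mult_self3 mod_less gr_implies_not0)

lemma touches_cell:
  assumes l: "label_ok m n P l" and ij: "i < m" "j < m"
  shows "touches (i * m + j) (task_of m n l) \<longleftrightarrow> at_cell i j l"
proof -
  note less = cell_less[OF ij]
  show ?thesis
  proof (cases l)
    case (Row i' t a)
    then show ?thesis using l ij less cell_inj[of j m t i i'] cell_inj[of j m "t - 1" i i']
      by (cases t) (auto simp: touches_def row_task_def star_task_def split: if_splits)
  next
    case (Col j' t b)
    then show ?thesis using l ij less cell_inj[of j m j' i t] cell_inj[of j m j' i "t - 1"]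
      by (cases t) (auto simp: touches_def col_task_def star_task_def split: if_splits)
  next
    case (Cell i' j' a b)
    then show ?thesis using l ij less cell_inj[of j m j' i i']
      by (auto simp: touches_def cell_task_def star_task_def)
  qed
qed

text \<open>\<open>t = 0\<close> and \<open>t = m\<close> exclude each other once some index lies
  below \<open>m\<close>, so a row or column task never has both ends at the centre.\<close>

lemma task_of_star_task:
  assumes "label_ok m n P l"
  shows "\<exists>s t d. task_of m n l = star_task (m * m) s t d \<and> s \<noteq> t \<and> s \<le> m * m \<and> t \<le> m * m"
proof (cases l)
  case (Row i t a)
  let ?s = "if t = 0 then m * m else i * m + (t - 1)" and ?t = "if t = m then m * m else i * m + t"
  have i: "i < m" "t \<le> m" using assms Row by auto
  then have "?s \<noteq> ?t \<and> ?s \<le> m * m \<and> ?t \<le> m * m"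
    using cell_less[of i m t] cell_less[of i m "t - 1"] by (cases t) auto
  then show ?thesis unfolding Row task_of.simps row_task_def by blast
next
  case (Col j t b)
  let ?s = "if t = 0 then m * m else (t - 1) * m + j" and ?t = "if t = m then m * m else t * m + j"
  have i: "j < m" "t \<le> m" using assms Col by auto
  then have "?s \<noteq> ?t \<and> ?s \<le> m * m \<and> ?t \<le> m * m"
    using cell_less[of t m j] cell_less[of "t - 1" m j] by (cases t) auto
  then show ?thesis unfolding Col task_of.simps col_task_def by blast
next
  case (Cell i j a b)
  then have "i * m + j < m * m" using assms by (intro cell_less) auto
  then show ?thesis unfolding Cell task_of.simps cell_task_def by (metis le_refl less_imp_le nat_neq_iff)
qed

section \<open>Digits of demands and capacities\<close>

lemma sum_lessThan_5: "(\<Sum>h<5::nat. f h) = f 0 + f 1 + f 2 + f 3 + (f 4 :: nat)"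
  by (simp add: eval_nat_numeral)

lemma demand_task_of: "demand (task_of m n l) = (\<Sum>h<5. digit n h l * base n ^ h)"
proof -
  have "t mod 2 = 0 \<or> t mod 2 = 1" for t :: nat by auto
  then show ?thesis
    by (cases l) (auto simp: sum_lessThan_5 demand_def row_task_def col_task_def cell_task_def
      star_task_def odd_iff_mod_2_eq_one add_mult_distrib2)
qed

lemma digit_le: "label_ok m n P l \<Longrightarrow> digit n h l \<le> 2 * n"
  by (cases l) auto

lemma digit_less_base: "label_ok m n P l \<Longrightarrow> digit n h l < base n"
  using digit_le[of m n P l h] by (simp add: base_def)

definition cap_digit :: "nat \<Rightarrow> nat \<Rightarrow> nat" where
  "cap_digit n h = (if h < 4 then 3 * n else 1)"

lemma csp_cap_digits: "csp_cap n = (\<Sum>h<5. cap_digit n h * base n ^ h)"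
  by (simp add: sum_lessThan_5 csp_cap_def cap_digit_def algebra_simps)

text \<open>The empty set gives 0 and two elements give at least \<open>2 * n\<close>; neither
  equals \<open>n + a\<close> when \<open>a < n\<close>.\<close>

lemma sum_singleton_unique:
  fixes n a :: nat
  assumes "finite R" "(\<Sum>x\<in>R. n + x) = n + a" "a < n"
  shows "R = {a}"
proof -
  have "R \<noteq> {}" using assms by auto
  then obtain x where x: "x \<in> R" by blast
  have s: "(\<Sum>x\<in>R. n + x) = n + x + (\<Sum>x\<in>R - {x}. n + x)" using assms(1) x by (simp add: sum.remove)
  have "R - {x} = {}"
  proof (rule ccontr)
    assume "R - {x} \<noteq> {}"
    then obtain z where z: "z \<in> R - {x}" by blast
    then have "n + z \<le> (\<Sum>x\<in>R - {x}. n + x)" using assms(1) by (intro member_le_sum) auto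
    then show False using s assms(2,3) by simp
  qed
  then have "R = {x}" using x by blast
  then show ?thesis using assms(2) by simp
qed

text \<open>Digit 4 admits exactly one cell task. It completes each other digit to
  \<open>3 * n\<close> only if exactly one task on that side is chosen and carries the matching
  value. Opposite sides therefore carry the same value, which is how it passes through the
  cell.\<close>

lemma cell_digits:
  assumes A: "A \<subseteq> Collect (label_ok m n P)" and ij: "i < m" "j < m"
    and sum: "(\<Sum>l\<in>{l\<in>A. at_cell i j l}. demand (task_of m n l)) = csp_cap n"
  shows "\<exists>a b. a < n \<and> b < n \<and> P i j a b \<and> (i = j \<longrightarrow> a = b) \<and>
    (\<forall>t\<in>{j, Suc j}. {a'. Row i t a' \<in> A} = {a}) \<and> (\<forall>t\<in>{i, Suc i}. {b'. Col j t b' \<in> A} = {b})"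
proof -
  let ?A = "{l\<in>A. at_cell i j l}"
  let ?U = "Row i j ` {..<n} \<union> Row i (Suc j) ` {..<n} \<union> Col j i ` {..<n} \<union> Col j (Suc i) ` {..<n} \<union>
    (\<lambda>(a, b). Cell i j a b) ` ({..<n} \<times> {..<n})"
  have ok: "label_ok m n P l" if "l \<in> ?A" for l using that A by blast
  have "l \<in> ?U" if "l \<in> ?A" for l using ok[OF that] that by (cases l) auto
  then have sub: "?A \<subseteq> ?U" by blast
  have fin: "finite ?A" by (rule finite_subset[OF sub]) simp
  have "card ?A \<le> card ?U" by (rule card_mono[OF _ sub]) simp
  also have "\<dots> \<le> n + n + n + n + n * n"
    by (intro card_Un_le[THEN order_trans] add_mono card_image_le[THEN order_trans]) auto
  finally have card: "card ?A \<le> 4 * n + n * n" by simp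
  have "(\<Sum>h<5. (\<Sum>l\<in>?A. digit n h l) * base n ^ h) = (\<Sum>h<5. cap_digit n h * base n ^ h)"
    using sum unfolding demand_task_of csp_cap_digits
    by (subst (asm) sum.swap) (simp add: sum_distrib_right)
  \<comment> \<open>Since nothing carries, the equation splits into one per digit.\<close>
  then have digits: "\<forall>h<5. (\<Sum>l\<in>?A. digit n h l) = cap_digit n h"
  proof (rule digits_unique)
    fix h :: nat
    have "(\<Sum>l\<in>?A. digit n h l) \<le> card ?A * (2 * n)"
      using sum_bounded_above[of ?A "\<lambda>l. digit n h l" "2 * n"] digit_le ok by fastforce
    also have "\<dots> \<le> (4 * n + n * n) * (2 * n)" using card by (rule mult_right_mono) simp
    also have "\<dots> < base n" by (simp add: base_def algebra_simps)
    finally show "(\<Sum>l\<in>?A. digit n h l) < base n" .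
    show "cap_digit n h < base n" by (simp add: cap_digit_def base_def)
  qed
  let ?C = "{l\<in>?A. \<exists>a b. l = Cell i j a b}"
  have "(\<Sum>l\<in>?A. digit n 4 l) = (\<Sum>l\<in>?C. 1)"
  proof (rule sum.mono_neutral_cong_right[OF fin])
    show "\<forall>l\<in>?A - ?C. digit n 4 l = 0"
    proof
      fix l assume "l \<in> ?A - ?C"
      then show "digit n 4 l = 0" by (cases l) auto
    qed
  qed auto
  then have "card ?C = 1" using digits by (simp add: cap_digit_def)
  then obtain c where c: "?C = {c}" by (auto simp: card_1_singleton_iff)
  then obtain a b where "c = Cell i j a b" by blast
  then have C: "?C = {Cell i j a b}" using c by simp
  then have ab: "Cell i j a b \<in> A" by blast
  then have abn: "a < n" "b < n" "P i j a b" "i = j \<longrightarrow> a = b" using A by auto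
  have only: "a' = a \<and> b' = b" if "Cell i j a' b' \<in> A" for a' b'
  proof -
    have "Cell i j a' b' \<in> ?C" using that by auto
    then show ?thesis unfolding C by simp
  qed
  have row: "{a'. Row i t a' \<in> A} = {a}" if t: "t \<in> {j, Suc j}" for t
  proof -
    let ?R = "{a'. Row i t a' \<in> A}"
    have R: "?R \<subseteq> {..<n}" using A by auto
    then have fR: "finite ?R" by (rule finite_subset) simp
    have h: "t mod 2 < 2" by simp
    have "3 * n = (\<Sum>l\<in>?A. digit n (t mod 2) l)" using digits h by (simp add: cap_digit_def)
    also have "\<dots> = (\<Sum>l\<in>insert (Cell i j a b) (Row i t ` ?R). digit n (t mod 2) l)"
    proof (rule sum.mono_neutral_right[OF fin])
      show "\<forall>l\<in>?A - insert (Cell i j a b) (Row i t ` ?R). digit n (t mod 2) l = 0"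
      proof
        fix l assume l: "l \<in> ?A - insert (Cell i j a b) (Row i t ` ?R)"
        show "digit n (t mod 2) l = 0"
        proof (cases l)
          case (Row i' t' a')
          then have "t' \<noteq> t" "t' \<in> {j, Suc j}" using l by auto
          \<comment> \<open>The other row position lies on the opposite side of the cell and has the
            opposite parity.\<close>
          then have "t mod 2 \<noteq> t' mod 2" using t by (auto simp: mod_Suc split: if_splits)
          then show ?thesis using Row by simp
        next
          case (Col j' t' b')
          have "t mod 2 \<noteq> 2 + t' mod 2" using h by linarith
          then show ?thesis using Col by simp
        next
          case (Cell i' j' a' b')
          then show ?thesis using l only by auto
        qed
      qed
    qed (use ab t in auto)
    also have "\<dots> = (2 * n - a) + (\<Sum>a'\<in>?R. n + a')"
      using fR h by (subst sum.insert) (auto simp: sum.reindex inj_on_def)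
    finally have "(\<Sum>a'\<in>?R. n + a') = n + a" using abn by simp
    then show ?thesis using fR abn by (intro sum_singleton_unique)
  qed
  have col: "{b'. Col j t b' \<in> A} = {b}" if t: "t \<in> {i, Suc i}" for t
  proof -
    let ?R = "{b'. Col j t b' \<in> A}"
    have R: "?R \<subseteq> {..<n}" using A by auto
    then have fR: "finite ?R" by (rule finite_subset) simp
    have h: "2 + t mod 2 < 4" "\<not> 2 + t mod 2 < 2" by simp_all
    have "3 * n = (\<Sum>l\<in>?A. digit n (2 + t mod 2) l)" using digits h by (simp add: cap_digit_def)
    also have "\<dots> = (\<Sum>l\<in>insert (Cell i j a b) (Col j t ` ?R). digit n (2 + t mod 2) l)"
    proof (rule sum.mono_neutral_right[OF fin])
      show "\<forall>l\<in>?A - insert (Cell i j a b) (Col j t ` ?R). digit n (2 + t mod 2) l = 0"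
      proof
        fix l assume l: "l \<in> ?A - insert (Cell i j a b) (Col j t ` ?R)"
        show "digit n (2 + t mod 2) l = 0"
        proof (cases l)
          case (Col j' t' b')
          then have "t' \<noteq> t" "t' \<in> {i, Suc i}" using l by auto
          then have "t mod 2 \<noteq> t' mod 2" using t by (auto simp: mod_Suc split: if_splits)
          then show ?thesis using Col by simp
        next
          case (Row i' t' a')
          have "t' mod 2 < 2" by simp
          then have "2 + t mod 2 \<noteq> t' mod 2" by linarith
          then show ?thesis using Row by simp
        next
          case (Cell i' j' a' b')
          then show ?thesis using l only by auto
        qed
      qed
    qed (use ab t in auto)
    also have "\<dots> = (2 * n - b) + (\<Sum>b'\<in>?R. n + b')"
      using fR h by (subst sum.insert) (auto simp: sum.reindex inj_on_def)
    finally have "(\<Sum>b'\<in>?R. n + b') = n + b" using abn by simp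
    then show ?thesis using fR abn by (intro sum_singleton_unique)
  qed
  show ?thesis
    by (rule exI[of _ a], rule exI[of _ b]) (use abn row col in simp)
qed

lemma saturated_iff_csp:
  "(\<exists>T\<subseteq>set (csp_tasks m n P). \<forall>v<m * m. sum demand {x \<in> T. touches v x} = csp_cap n) \<longleftrightarrow> csp m n P"
proof
  assume "\<exists>T\<subseteq>set (csp_tasks m n P). \<forall>v<m * m. sum demand {x \<in> T. touches v x} = csp_cap n"
  then obtain T where T: "T \<subseteq> task_of m n ` Collect (label_ok m n P)"
    "\<forall>v<m * m. sum demand {x \<in> T. touches v x} = csp_cap n" unfolding set_csp_tasks by blast
  \<comment> \<open>With one label for each chosen task, \<open>task_of\<close> is injective on
    \<open>A\<close> and sums over tasks become sums over labels.\<close>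
  obtain A where A: "A \<subseteq> Collect (label_ok m n P)" "inj_on (task_of m n) A" "T = task_of m n ` A"
    using T(1) unfolding subset_image_inj by blast
  let ?g = "\<lambda>i j a b. a < n \<and> b < n \<and> P i j a b \<and> (i = j \<longrightarrow> a = b) \<and>
    (\<forall>t\<in>{j, Suc j}. {a'. Row i t a' \<in> A} = {a}) \<and> (\<forall>t\<in>{i, Suc i}. {b'. Col j t b' \<in> A} = {b})"
  have ex: "\<exists>a b. ?g i j a b" if ij: "i < m" "j < m" for i j
  proof (rule cell_digits[OF A(1) ij])
    have e: "{x \<in> T. touches (i * m + j) x} = task_of m n ` {l\<in>A. at_cell i j l}"
      using touches_cell[OF _ ij] A(1,3) by auto
    have "(\<Sum>l\<in>{l\<in>A. at_cell i j l}. demand (task_of m n l)) = sum demand {x \<in> T. touches (i * m + j) x}"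
      unfolding e using A(2) by (subst sum.reindex) (auto simp: inj_on_def)
    also have "\<dots> = csp_cap n" using T(2) cell_less[OF ij] by blast
    finally show "(\<Sum>l\<in>{l\<in>A. at_cell i j l}. demand (task_of m n l)) = csp_cap n" .
  qed
  define F where "F i j = (SOME p. ?g i j (fst p) (snd p))" for i j
  define f g where "f i j = fst (F i j)" and "g i j = snd (F i j)" for i j
  have fg: "?g i j (f i j) (g i j)" if ij: "i < m" "j < m" for i j
  proof -
    obtain a b where "?g i j a b" using ex[OF ij] by blast
    then have "?g i j (fst (a, b)) (snd (a, b))" by simp
    then show ?thesis unfolding f_def g_def F_def by (rule someI)
  qed
  \<comment> \<open>The task between cells \<open>(i, j)\<close> and \<open>(i, Suc j)\<close> loads
    both of them, so both read the same value.\<close>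
  have f: "f i j = f i 0" if "i < m" "j < m" for i j
    using that(2)
  proof (induction j)
    case (Suc j)
    have "{a'. Row i (Suc j) a' \<in> A} = {f i (Suc j)}" "{a'. Row i (Suc j) a' \<in> A} = {f i j}"
      using fg[OF that(1), of "Suc j"] fg[OF that(1), of j] Suc.prems by auto
    then show ?case using Suc by auto
  qed simp
  have g: "g i j = g 0 j" if "i < m" "j < m" for i j
    using that(1)
  proof (induction i)
    case (Suc i)
    have "{a'. Col j (Suc i) a' \<in> A} = {g (Suc i) j}" "{a'. Col j (Suc i) a' \<in> A} = {g i j}"
      using fg[OF _ that(2), of "Suc i"] fg[OF _ that(2), of i] Suc.prems by auto
    then show ?case using Suc by auto
  qed simp
  \<comment> \<open>The diagonal cell admits only equal values for its row and its column.\<close>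
  have diag: "f i 0 = g 0 i" if "i < m" for i using fg[OF that that] f[OF that that] g[OF that that] by auto
  have "P i j (f i 0) (f j 0)" if "i < m" "j < m" for i j
  proof -
    have "P i j (f i j) (g i j)" using fg[OF that] by blast
    then show ?thesis unfolding f[OF that] g[OF that] diag[OF that(2)] .
  qed
  moreover have "f i 0 < n" if "i < m" for i
  proof -
    have "f i i < n" using fg[OF that that] by blast
    then show ?thesis unfolding f[OF that that] .
  qed
  ultimately show "csp m n P" unfolding csp_def by (intro exI[of _ "\<lambda>i. f i 0"]) simp
next
  assume "csp m n P"
  then obtain y where y: "\<And>i. i < m \<Longrightarrow> y i < n" "\<And>i j. i < m \<Longrightarrow> j < m \<Longrightarrow> P i j (y i) (y j)"
    unfolding csp_def by blast
  define A where "A = {l. (\<exists>i<m. \<exists>t\<le>m. l = Row i t (y i)) \<or> (\<exists>j<m. \<exists>t\<le>m. l = Col j t (y j)) \<or>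
    (\<exists>i<m. \<exists>j<m. l = Cell i j (y i) (y j))}"
  have A: "A \<subseteq> Collect (label_ok m n P)" using y by (auto simp: A_def)
  let ?T = "task_of m n ` A"
  have "sum demand {x \<in> ?T. touches v x} = csp_cap n" if v: "v < m * m" for v
  proof -
    define i j where "i = v div m" and "j = v mod m"
    have "0 < m" using v by (cases m) auto
    then have ij: "i < m" "j < m" "v = i * m + j"
      using v by (auto simp: i_def j_def less_mult_imp_div_less)
    let ?S = "{Row i j (y i), Row i (Suc j) (y i), Col j i (y j), Col j (Suc i) (y j), Cell i j (y i) (y j)}"
    have "{l\<in>A. at_cell i j l} = ?S" using ij by (auto simp: A_def)
    then have e: "{x \<in> ?T. touches v x} = task_of m n ` ?S"
      using touches_cell[OF _ ij(1,2)] A unfolding ij(3) by blast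
    have ok: "label_ok m n P l" if "l \<in> ?S" for l using that y ij by auto
    have par: "j mod 2 = 0 \<and> Suc j mod 2 = 1 \<or> j mod 2 = 1 \<and> Suc j mod 2 = 0"
      "i mod 2 = 0 \<and> Suc i mod 2 = 1 \<or> i mod 2 = 1 \<and> Suc i mod 2 = 0" by (auto simp: mod_Suc)
    have n: "y i < n" "y j < n" using y ij by auto
    \<comment> \<open>Each row or column task has a digit among 0 to 3 to itself within these four,
      and only the cell task has digit 4.\<close>
    have inj: "inj_on (task_of m n) ?S"
    proof (rule inj_onI)
      fix l l' assume l: "l \<in> ?S" "l' \<in> ?S" "task_of m n l = task_of m n l'"
      then have "(\<Sum>h<5. digit n h l * base n ^ h) = (\<Sum>h<5. digit n h l' * base n ^ h)"
        by (metis demand_task_of)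
      then have "\<forall>h<5. digit n h l = digit n h l'"
        by (rule digits_unique) (use digit_less_base ok l in blast)+
      then have dg: "digit n 0 l = digit n 0 l' \<and> digit n 1 l = digit n 1 l' \<and> digit n 2 l = digit n 2 l' \<and>
        digit n 3 l = digit n 3 l' \<and> digit n 4 l = digit n 4 l'" by simp
      show "l = l'"
        by (rule par(1)[THEN disjE]; rule par(2)[THEN disjE]; insert l(1,2) dg n; elim insertE emptyE; simp)
    qed
    have "sum demand {x \<in> ?T. touches v x} = (\<Sum>l\<in>?S. \<Sum>h<5. digit n h l * base n ^ h)"
      unfolding e using inj by (simp only: sum.reindex comp_def demand_task_of)
    also have "\<dots> = (\<Sum>h<5. (\<Sum>l\<in>?S. digit n h l) * base n ^ h)"
      by (subst sum.swap) (simp only: sum_distrib_right)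
    also have "\<dots> = (\<Sum>h<5. cap_digit n h * base n ^ h)"
    proof (rule sum.cong[OF refl])
      fix h :: nat assume "h \<in> {..<5}"
      then have h: "h = 0 \<or> h = 1 \<or> h = 2 \<or> h = 3 \<or> h = 4" by auto
      have "(\<Sum>l\<in>?S. digit n h l) = digit n h (Row i j (y i)) + digit n h (Row i (Suc j) (y i)) +
        digit n h (Col j i (y j)) + digit n h (Col j (Suc i) (y j)) + digit n h (Cell i j (y i) (y j))"
        by simp
      also have "\<dots> = cap_digit n h" using h par n by (auto simp: cap_digit_def)
      finally show "(\<Sum>l\<in>?S. digit n h l) * base n ^ h = cap_digit n h * base n ^ h" by simp
    qed
    finally show ?thesis unfolding csp_cap_digits .
  qed
  then show "\<exists>T\<subseteq>set (csp_tasks m n P). \<forall>v<m * m. sum demand {x \<in> T. touches v x} = csp_cap n"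
    unfolding set_csp_tasks using A by (intro exI[of _ ?T]) blast
qed

definition csp_code :: "nat \<Rightarrow> nat \<Rightarrow> (nat \<Rightarrow> nat \<Rightarrow> nat \<Rightarrow> nat \<Rightarrow> bool) \<Rightarrow> uf_code" where
  "csp_code m n P = star_code (m * m) (csp_cap n) (csp_tasks m n P)"

lemma csp_tasks_star:
  "x \<in> set (csp_tasks m n P) \<Longrightarrow>
    \<exists>s t d. x = star_task (m * m) s t d \<and> s \<noteq> t \<and> s \<le> m * m \<and> t \<le> m * m"
  unfolding set_csp_tasks using task_of_star_task by auto

lemma uf_yes_csp: "uf_yes (uf_of_code (csp_code m n P)) \<longleftrightarrow> csp m n P"
  unfolding csp_code_def by (subst uf_yes_star[OF csp_tasks_star]) (assumption, rule saturated_iff_csp)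

lemma uf_valid_csp: "uf_valid (csp_code m n P)"
  unfolding csp_code_def
proof (rule uf_valid_star)
  show "distinct (csp_tasks m n P)" by (simp add: csp_tasks_def)
  show "\<forall>x\<in>set (csp_tasks m n P). fst x \<le> m * m \<and> fst (snd x) \<le> m * m"
    using csp_tasks_star by (force simp: star_task_def)
qed

lemma uf_param_csp: "uf_param (uf_of_code (csp_code m n P)) \<le> 2 * (m * m) + 2"
  unfolding csp_code_def by (rule uf_param_star)


section \<open>From circuits to binary constraints\<close>

text \<open>A weight-\<open>k\<close> input set is described by slots \<open>0, \<dots>, k + 1\<close>: slots \<open>1, \<dots>, k\<close> hold its members
  in increasing order, shifted by one, between the sentinels 0 and \<open>length gs + 1\<close>. Slot \<open>k + 2\<close>
  holds an index into the list \<open>Xs\<close> of obstacles. A fact \<open>(s, a)\<close> says that slot \<open>s\<close> holds \<open>a\<close>.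
  The order makes non-membership visible from two consecutive slots.\<close>

definition shown :: "nat \<Rightarrow> (nat \<times> nat) list \<Rightarrow> nat \<Rightarrow> bool \<Rightarrow> bool" where
  "shown k K v c \<longleftrightarrow>
    (if c then \<exists>e\<in>set K. fst e \<le> Suc k \<and> snd e = Suc v
     else \<exists>e\<in>set K. \<exists>f\<in>set K. fst f = Suc (fst e) \<and> fst f \<le> Suc k \<and> snd e < Suc v \<and> Suc v < snd f)"

text \<open>Sentinels and members are judged by the fact alone; a chosen alternative is refuted once
  \<open>K\<close> shows all literals of one of its obstacles.\<close>

definition bad_fact :: "gate list \<Rightarrow> nat \<Rightarrow> (nat \<times> bool) list list list \<Rightarrow> (nat \<times> nat) list \<Rightarrow> nat \<times> nat \<Rightarrow> bool" where
  "bad_fact gs k Xs K e \<longleftrightarrow> fst e = 0 \<and> snd e \<noteq> 0 \<or> fst e = Suc k \<and> snd e \<noteq> Suc (length gs) \<or>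
    1 \<le> fst e \<and> fst e \<le> k \<and>
      \<not> (1 \<le> snd e \<and> snd e \<le> length gs \<and> gtag (gate_at gs (snd e - 1)) = 0) \<or>
    fst e = k + 2 \<and> (length Xs \<le> snd e \<or>
      (\<exists>P\<in>set (nthd [] Xs (snd e)). \<forall>l\<in>set P. shown k K (fst l) (snd l)))"

text \<open>The first case makes overlapping tuples agree; the second forces strictly increasing
  slots, so that the \<open>k\<close> members are distinct.\<close>

definition bad_pair :: "nat \<Rightarrow> nat \<times> nat \<Rightarrow> nat \<times> nat \<Rightarrow> bool" where
  "bad_pair k e f \<longleftrightarrow> fst e = fst f \<and> snd e \<noteq> snd f \<or>
    fst f = Suc (fst e) \<and> fst f \<le> Suc k \<and> snd f \<le> snd e"

definition contra :: "gate list \<Rightarrow> nat \<Rightarrow> (nat \<times> bool) list list list \<Rightarrow> (nat \<times> nat) list \<Rightarrow> bool" where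
  "contra gs k Xs K \<longleftrightarrow> (\<exists>e\<in>set K. bad_fact gs k Xs K e) \<or> (\<exists>e\<in>set K. \<exists>f\<in>set K. bad_pair k e f)"

lemma shown_mono: "set K \<subseteq> set K' \<Longrightarrow> shown k K v c \<Longrightarrow> shown k K' v c"
  unfolding shown_def by (cases c) (simp; blast)+

text \<open>Facts are used only positively, so a contradiction survives further facts. This permits
  padding short lists and restricting total assignments.\<close>

lemma contra_mono:
  assumes "set K \<subseteq> set K'" "contra gs k Xs K" shows "contra gs k Xs K'"
proof -
  have "bad_fact gs k Xs K' e" if "bad_fact gs k Xs K e" for e
    using that shown_mono[OF assms(1)] unfolding bad_fact_def by blast
  then show ?thesis using assms unfolding contra_def by blast
qed

definition facts :: "(nat \<Rightarrow> nat) \<Rightarrow> nat list \<Rightarrow> (nat \<times> nat) list" where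
  "facts Y L = map (\<lambda>s. (s, Y s)) L"

lemma zip_map_facts: "zip L (map Y L) = facts Y L"
  unfolding facts_def by (induction L) auto

section \<open>Tuples of slots as variables\<close>

definition slots :: "nat \<Rightarrow> nat \<Rightarrow> nat list list" where
  "slots r k = List.n_lists r [0..<k + 3]"

definition vals :: "nat \<Rightarrow> nat \<Rightarrow> nat list list" where
  "vals r N = List.n_lists r [0..<N]"

definition compatible ::
    "nat \<Rightarrow> gate list \<Rightarrow> nat \<Rightarrow> (nat \<times> bool) list list list \<Rightarrow> nat \<Rightarrow> nat \<Rightarrow> nat \<Rightarrow> nat \<Rightarrow> nat \<Rightarrow> bool" where
  "compatible r gs k Xs N i j a b \<longleftrightarrow> \<not> contra gs k Xs
    (zip (nthd [] (slots r k) i) (nthd [] (vals r N) a) @ zip (nthd [] (slots r k) j) (nthd [] (vals r N) b))"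

text \<open>Comparison with the constant tuples makes every tuple a restriction of one assignment
  \<open>Y\<close>. A list of at most \<open>r\<close> slots then occurs, after padding, as a tuple
  that was checked against itself.\<close>

lemma csp_imp_short:
  assumes "0 < r" and csp: "csp (length (slots r k)) (length (vals r N)) (compatible r gs k Xs N)"
  shows "\<exists>Y. \<forall>L. L \<noteq> [] \<longrightarrow> length L \<le> r \<longrightarrow> set L \<subseteq> {..<k + 3} \<longrightarrow> \<not> contra gs k Xs (facts Y L)"
proof -
  let ?S = "slots r k"
  obtain y where y: "\<And>i. i < length ?S \<Longrightarrow> y i < length (vals r N)"
    "\<And>i j. i < length ?S \<Longrightarrow> j < length ?S \<Longrightarrow> compatible r gs k Xs N i j (y i) (y j)"
    using csp unfolding csp_def by blast
  define ix where "ix xs = (SOME i. i < length ?S \<and> ?S ! i = xs)" for xs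
  have ix: "ix xs < length ?S \<and> ?S ! ix xs = xs" if "xs \<in> set ?S" for xs
    unfolding ix_def by (rule someI_ex) (use that in \<open>auto simp: in_set_conv_nth\<close>)
  define w where "w xs = vals r N ! y (ix xs)" for xs
  have w: "length (w xs) = r" if "xs \<in> set ?S" for xs
  proof -
    have "w xs \<in> set (vals r N)" using y(1) ix[OF that] unfolding w_def by (intro nth_mem) blast
    then show ?thesis by (auto simp: vals_def set_n_lists)
  qed
  have ok: "\<not> contra gs k Xs (zip xs (w xs) @ zip zs (w zs))" if "xs \<in> set ?S" "zs \<in> set ?S" for xs zs
    using y(2)[of "ix xs" "ix zs"] y(1) ix[OF that(1)] ix[OF that(2)] unfolding compatible_def w_def by simp
  have S: "xs \<in> set ?S \<longleftrightarrow> length xs = r \<and> set xs \<subseteq> {..<k + 3}" for xs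
    by (auto simp: slots_def set_n_lists)
  \<comment> \<open>The constant tuple of slot \<open>s\<close> decides its value; it has an entry 0
    because \<open>r\<close> is positive.\<close>
  define Y where "Y s = w (replicate r s) ! 0" for s
  have eq: "zip xs (w xs) = facts Y xs" if xs: "xs \<in> set ?S" for xs
  proof -
    have "w xs ! p = Y (xs ! p)" if p: "p < r" for p
    proof (rule ccontr)
      assume n: "w xs ! p \<noteq> Y (xs ! p)"
      let ?zs = "replicate r (xs ! p)"
      have l: "length xs = r" "xs ! p < k + 3" using xs S p nth_mem by fastforce+
      then have zs: "?zs \<in> set ?S" unfolding S by auto
      have 1: "(xs ! p, w xs ! p) \<in> set (zip xs (w xs) @ zip ?zs (w ?zs))"
        using l p w[OF xs] by (auto simp: in_set_zip)
      have "zip ?zs (w ?zs) ! 0 = (xs ! p, Y (xs ! p))" "0 < length (zip ?zs (w ?zs))"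
        using assms(1) w[OF zs] by (simp_all add: Y_def)
      then have 2: "(xs ! p, Y (xs ! p)) \<in> set (zip xs (w xs) @ zip ?zs (w ?zs))"
        by (metis UnCI nth_mem set_append)
      have "bad_pair k (xs ! p, w xs ! p) (xs ! p, Y (xs ! p))" using n by (simp add: bad_pair_def)
      then show False using ok[OF xs zs] 1 2 unfolding contra_def by blast
    qed
    then have "w xs = map Y xs" using w[OF xs] xs S by (intro nth_equalityI) auto
    then show ?thesis by (simp add: zip_map_facts)
  qed
  have "\<not> contra gs k Xs (facts Y L)" if L: "L \<noteq> []" "length L \<le> r" "set L \<subseteq> {..<k + 3}" for L
  proof -
    \<comment> \<open>Repeating the head reaches length \<open>r\<close> without adding a
      fact.\<close>
    let ?xs = "L @ replicate (r - length L) (hd L)"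
    have "?xs \<in> set ?S" unfolding S using L by (cases L) (auto split: if_splits)
    from ok[OF this this] have "\<not> contra gs k Xs (facts Y ?xs @ facts Y ?xs)" unfolding eq[OF \<open>?xs \<in> set ?S\<close>] .
    then show ?thesis using contra_mono[of "facts Y L" "facts Y ?xs @ facts Y ?xs"] by (auto simp: facts_def)
  qed
  then show ?thesis by blast
qed

lemma full_imp_csp:
  assumes "\<And>s. s < k + 3 \<Longrightarrow> Y s < N" "\<not> contra gs k Xs (facts Y [0..<k + 3])"
  shows "csp (length (slots r k)) (length (vals r N)) (compatible r gs k Xs N)"
proof -
  let ?S = "slots r k"
  define y where "y i = (SOME a. a < length (vals r N) \<and> vals r N ! a = map Y (?S ! i))" for i
  have S: "length (?S ! i) = r" "set (?S ! i) \<subseteq> {..<k + 3}" if "i < length ?S" for i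
    using nth_mem[OF that] by (auto simp: slots_def set_n_lists)
  have y: "y i < length (vals r N) \<and> vals r N ! y i = map Y (?S ! i)" if i: "i < length ?S" for i
  proof -
    have "map Y (?S ! i) \<in> set (vals r N)"
      using S[OF i] assms(1) by (auto simp: vals_def set_n_lists)
    then obtain a where "a < length (vals r N) \<and> vals r N ! a = map Y (?S ! i)"
      by (auto simp: in_set_conv_nth)
    then show ?thesis unfolding y_def by (rule someI)
  qed
  have "compatible r gs k Xs N i j (y i) (y j)" if ij: "i < length ?S" "j < length ?S" for i j
  proof -
    have "set (facts Y (?S ! i) @ facts Y (?S ! j)) \<subseteq> set (facts Y [0..<k + 3])"
      using S[OF ij(1)] S[OF ij(2)] by (auto simp: facts_def)
    then have "\<not> contra gs k Xs (facts Y (?S ! i) @ facts Y (?S ! j))"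
      using assms(2) contra_mono by blast
    then show ?thesis
      using y[OF ij(1)] y[OF ij(2)] ij unfolding compatible_def by (simp add: zip_map_facts)
  qed
  then show ?thesis unfolding csp_def using y by blast
qed

section \<open>Assignments and satisfying input sets\<close>

lemma steps_mono:
  fixes Y :: "nat \<Rightarrow> nat"
  assumes "\<And>i. i \<le> k \<Longrightarrow> Y i < Y (Suc i)" "i < j" "j \<le> Suc k"
  shows "Y i < Y j"
  using assms(2,3)
proof (induction j)
  case (Suc j)
  then show ?case using assms(1)[of j] by (cases "i = j") auto
qed simp

text \<open>\<open>Y\<close> is known to be consistent on short lists only, but each way of missing
  a satisfying set is visible on one: a single slot, two consecutive slots, or the index slot with
  the slots that settle the literals of one obstacle.\<close>

lemma short_imp_sat:
  assumes wf: "wf_gates gs" "out < length gs" "weft_depth d 1 gs out"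
    and Y: "\<forall>L. L \<noteq> [] \<longrightarrow> length L \<le> 2 * 2 ^ d + 1 \<longrightarrow> set L \<subseteq> {..<k + 3} \<longrightarrow>
      \<not> contra gs k (obstacles d gs out) (facts Y L)"
  shows "\<exists>S\<subseteq>inputs (gs, out). card S = k \<and> satisfies S (gs, out)"
proof -
  let ?Xs = "obstacles d gs out"
  have two: "Suc (Suc 0) \<le> 2 * 2 ^ d + 1" by simp
  have one: "\<not> bad_fact gs k ?Xs (facts Y [s]) (s, Y s)" if "s < k + 3" for s
    using Y[rule_format, of "[s]"] that by (auto simp: contra_def facts_def)
  have pair: "\<not> bad_pair k (i, Y i) (Suc i, Y (Suc i))" if "i \<le> k" for i
    using Y[rule_format, of "[i, Suc i]"] that two by (auto simp: contra_def facts_def)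
  have Y0: "Y 0 = 0" using one[of 0] by (simp add: bad_fact_def)
  have Yk: "Y (Suc k) = Suc (length gs)" using one[of "Suc k"] by (simp add: bad_fact_def)
  have Yin: "1 \<le> Y i \<and> Y i \<le> length gs \<and> gs ! (Y i - 1) = Input" if "1 \<le> i" "i \<le> k" for i
  proof -
    have "1 \<le> Y i \<and> Y i \<le> length gs \<and> gtag (gate_at gs (Y i - 1)) = 0"
      using one[of i] that by (auto simp: bad_fact_def)
    then show ?thesis by (cases "gs ! (Y i - 1)") auto
  qed
  have Yz: "Y (k + 2) < length ?Xs" using one[of "k + 2"] by (auto simp: bad_fact_def)
  have step: "Y i < Y (Suc i)" if "i \<le> k" for i using pair[OF that] that by (auto simp: bad_pair_def)
  note mono = steps_mono[of k Y, OF step]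
  define S where "S = (\<lambda>i. Y i - 1) ` {1..k}"
  have "inj_on (\<lambda>i. Y i - 1) {1..k}"
  proof (rule linorder_inj_onI')
    fix i j assume "i \<in> {1..k}" "j \<in> {1..k}" "i < j"
    then show "Y i - 1 \<noteq> Y j - 1" using mono[of i j] Yin[of i] by auto
  qed
  then have "card S = k" unfolding S_def by (simp add: card_image)
  moreover have "S \<subseteq> inputs (gs, out)" using Yin by (fastforce simp: S_def inputs_def)
  moreover have "satisfies S (gs, out)"
  proof -
    let ?X = "?Xs ! Y (k + 2)"
    have X: "?X \<in> set ?Xs" using Yz by simp
    have "\<exists>(i, c)\<in>set P. (i \<in> S) \<noteq> c" if P: "P \<in> set ?X" for P
    proof (rule ccontr)
      assume "\<not> (\<exists>(i, c)\<in>set P. (i \<in> S) \<noteq> c)"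
      then have all: "v \<in> S \<longleftrightarrow> c" if "(v, c) \<in> set P" for v c using that by blast
      have "\<exists>L. length L \<le> 2 \<and> set L \<subseteq> {..<k + 3} \<and> shown k (facts Y L) (fst l) (snd l)" if l: "l \<in> set P" for l
      proof -
        obtain v c where vc: "l = (v, c)" by (cases l)
        have v: "v < length gs" using obstacles_literals(2)[OF wf X P, of v c] l vc by blast
        show ?thesis
        proof (cases c)
          case True
          then obtain i where i: "i \<in> {1..k}" "v = Y i - 1" using all l vc unfolding S_def by blast
          then have "shown k (facts Y [i]) v True" using Yin[of i] by (auto simp: shown_def facts_def)
          then show ?thesis using i vc True by (intro exI[of _ "[i]"]) auto
        next
          case False
          then have nS: "v \<notin> S" using all l vc by blast
          \<comment> \<open>Slot values are shifted, so \<open>Y i \<le> v\<close> means below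
            \<open>Suc v\<close>. The lower sentinel guarantees such a slot, and the upper one keeps
            it at most \<open>k\<close>.\<close>
          define i where "i = (GREATEST i. i \<le> Suc k \<and> Y i \<le> v)"
          have i: "i \<le> Suc k \<and> Y i \<le> v" unfolding i_def
            by (rule GreatestI_nat[of _ 0 "Suc k"]) (use Y0 in auto)
          then have ik: "i \<le> k" using Yk v by (cases "i = Suc k") auto
          have "\<not> Y (Suc i) \<le> v"
            using Greatest_le_nat[of "\<lambda>i. i \<le> Suc k \<and> Y i \<le> v" "Suc i" "Suc k"] ik
            unfolding i_def[symmetric] by auto
          moreover have "Y (Suc i) \<noteq> Suc v"
          proof
            assume e: "Y (Suc i) = Suc v"
            then have "Suc i \<le> k" using Yk v ik by (cases "i = k") auto
            then have "v \<in> S" unfolding S_def using e by (intro image_eqI[of _ _ "Suc i"]) auto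
            then show False using nS by blast
          qed
          ultimately have "Suc v < Y (Suc i)" by simp
          then have "shown k (facts Y [i, Suc i]) v False"
            using i ik by (auto simp: shown_def facts_def)
          then show ?thesis using ik vc False by (intro exI[of _ "[i, Suc i]"]) auto
        qed
      qed
      then have "\<forall>l\<in>set P. \<exists>L. length L \<le> 2 \<and> set L \<subseteq> {..<k + 3} \<and> shown k (facts Y L) (fst l) (snd l)"
        by blast
      from bchoice[OF this] obtain sl where sl: "\<And>l. l \<in> set P \<Longrightarrow> length (sl l) \<le> 2 \<and>
          set (sl l) \<subseteq> {..<k + 3} \<and> shown k (facts Y (sl l)) (fst l) (snd l)" by blast
      \<comment> \<open>One index slot and at most two slots per literal stay within
        \<open>2 * 2 ^ d + 1\<close>.\<close>
      define L where "L = (k + 2) # concat (map sl P)"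
      have "length (concat (map sl Q)) \<le> 2 * length Q" if "set Q \<subseteq> set P" for Q
        using that
      proof (induction Q)
        case (Cons l Q)
        then show ?case using sl[of l] by simp
      qed simp
      from this[of P] have "length L \<le> 2 * 2 ^ d + 1" using obstacles_literals(1)[OF wf X P] by (simp add: L_def)
      moreover have "set L \<subseteq> {..<k + 3}" using sl by (auto simp: L_def)
      ultimately have "\<not> contra gs k ?Xs (facts Y L)" using Y by (simp add: L_def)
      moreover have sh: "shown k (facts Y L) (fst l) (snd l)" if "l \<in> set P" for l
        by (rule shown_mono[of "facts Y (sl l)"]) (use sl[OF that] that in \<open>auto simp: facts_def L_def\<close>)
      have "\<exists>P\<in>set (nthd [] ?Xs (Y (k + 2))). \<forall>l\<in>set P. shown k (facts Y L) (fst l) (snd l)"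
        unfolding nthd_nth[OF Yz] using P sh by blast
      then have "bad_fact gs k ?Xs (facts Y L) (k + 2, Y (k + 2))"
        unfolding bad_fact_def fst_conv snd_conv by blast
      then have "contra gs k ?Xs (facts Y L)" unfolding contra_def facts_def L_def by auto
      ultimately show False by blast
    qed
    then show ?thesis unfolding satisfies_iff_obstacles[OF wf] by (intro bexI[OF _ X] ballI)
  qed
  ultimately show ?thesis by blast
qed

lemma sat_imp_full:
  assumes wf: "wf_gates gs" "out < length gs" "weft_depth d 1 gs out"
    and S: "S \<subseteq> inputs (gs, out)" "card S = k" "satisfies S (gs, out)"
  shows "\<exists>Y. (\<forall>s<k + 3. Y s < length gs + 2 + length (obstacles d gs out)) \<and>
    \<not> contra gs k (obstacles d gs out) (facts Y [0..<k + 3])"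
proof -
  let ?Xs = "obstacles d gs out"
  obtain X where X: "X \<in> set ?Xs" "\<forall>P\<in>set X. \<exists>(i, c)\<in>set P. (i \<in> S) \<noteq> c"
    using S(3) unfolding satisfies_iff_obstacles[OF wf] by blast
  then obtain z where z: "z < length ?Xs" "?Xs ! z = X" by (auto simp: in_set_conv_nth)
  have fin: "finite S" using S(1) by (rule finite_subset) (simp add: inputs_def)
  define xs where "xs = sorted_list_of_set S"
  have xs: "length xs = k" "set xs = S" "sorted_wrt (<) xs"
    using fin S(2) by (auto simp: xs_def)
  define Y where "Y s = (if s = 0 then 0 else if s \<le> k then Suc (xs ! (s - 1))
    else if s = Suc k then Suc (length gs) else z)" for s
  have elem: "xs ! (s - 1) < length gs \<and> gs ! (xs ! (s - 1)) = Input" if "1 \<le> s" "s \<le> k" for s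
  proof -
    have "xs ! (s - 1) \<in> set xs" using that xs(1) by (intro nth_mem) simp
    then have "xs ! (s - 1) \<in> S" using xs(2) by simp
    then show ?thesis using S(1) by (auto simp: inputs_def)
  qed
  have step: "Y i < Y (Suc i)" if "i \<le> k" for i
  proof (cases "i = 0 \<or> i = k")
    case True
    then show ?thesis using elem[of k] by (cases k) (auto simp: Y_def)
  next
    case False
    then show ?thesis using that xs sorted_wrt_nth_less[OF xs(3), of "i - 1" i] by (auto simp: Y_def)
  qed
  note mono = steps_mono[of k Y, OF step]
  have mem: "v \<in> S \<longleftrightarrow> (\<exists>s. 1 \<le> s \<and> s \<le> k \<and> Y s = Suc v)" for v
  proof
    assume "v \<in> S"
    then obtain p where "p < k" "xs ! p = v" using xs(1,2) by (metis in_set_conv_nth)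
    then show "\<exists>s. 1 \<le> s \<and> s \<le> k \<and> Y s = Suc v" by (intro exI[of _ "Suc p"]) (simp add: Y_def)
  next
    assume "\<exists>s. 1 \<le> s \<and> s \<le> k \<and> Y s = Suc v"
    then obtain s where "1 \<le> s" "s \<le> k" "Y s = Suc v" by blast
    then show "v \<in> S" using xs nth_mem[of "s - 1" xs] by (auto simp: Y_def)
  qed
  let ?K = "facts Y [0..<k + 3]"
  have K: "e \<in> set ?K \<longleftrightarrow> fst e < k + 3 \<and> snd e = Y (fst e)" for e by (cases e) (auto simp: facts_def)
  \<comment> \<open>A gap between neighbouring slots really excludes \<open>v\<close>, because
    \<open>Y\<close> increases strictly from slot 0 to slot \<open>Suc k\<close>.\<close>
  have sound: "(v \<in> S) = c" if sh: "shown k ?K v c" and v: "v < length gs" for v c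
  proof (cases c)
    case True
    then obtain s where "s \<le> Suc k" "Y s = Suc v" using sh by (auto simp: shown_def K Bex_def)
    moreover from this have "s \<noteq> 0" "s \<noteq> Suc k" using v by (auto simp: Y_def intro!: gr0I)
    ultimately have "v \<in> S" unfolding mem by (intro exI[of _ s]) auto
    then show ?thesis using True by simp
  next
    case False
    then obtain s where s: "Suc s \<le> Suc k" "Y s < Suc v" "Suc v < Y (Suc s)"
      using sh by (auto simp: shown_def K Bex_def)
    have "v \<notin> S"
    proof
      assume "v \<in> S"
      then obtain p where p: "1 \<le> p" "p \<le> k" "Y p = Suc v" unfolding mem by blast
      consider "p < s" | "p = s" | "p = Suc s" | "Suc s < p" by linarith
      then show False
        by cases (use s p mono[of p s] mono[of "Suc s" p] in auto)
    qed
    then show ?thesis using False by simp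
  qed
  have "\<not> bad_pair k e f" if "e \<in> set ?K" "f \<in> set ?K" for e f
    using that step[of "fst e"] unfolding bad_pair_def K by auto
  moreover have "\<not> bad_fact gs k ?Xs ?K e" if e: "e \<in> set ?K" for e
  proof -
    have "\<not> (\<forall>l\<in>set P. shown k ?K (fst l) (snd l))" if P: "P \<in> set X" for P
    proof
      assume a: "\<forall>l\<in>set P. shown k ?K (fst l) (snd l)"
      obtain i c where ic: "(i, c) \<in> set P" "(i \<in> S) \<noteq> c" using X(2) P by blast
      then show False using sound[of i c] a obstacles_literals(2)[OF wf X(1) P ic(1)] by force
    qed
    moreover have "1 \<le> Y s \<and> Y s \<le> length gs \<and> gtag (gate_at gs (Y s - 1)) = 0" if "1 \<le> s" "s \<le> k" for s
      using elem[OF that] that by (simp add: Y_def)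
    moreover have "Y 0 = 0" "Y (Suc k) = Suc (length gs)" "Y (k + 2) = z" by (simp_all add: Y_def)
    moreover have "nthd [] ?Xs z = X" using z by simp
    moreover have "snd e = Y (fst e)" using e unfolding K by blast
    ultimately show ?thesis using z(1) unfolding bad_fact_def by (auto simp del: nthd_nth intro!: gr0I)
  qed
  ultimately have "\<not> contra gs k ?Xs ?K" unfolding contra_def by blast
  moreover have "Y s < length gs + 2 + length ?Xs" for s
    using z elem[of s] by (auto simp: Y_def)
  ultimately show ?thesis by blast
qed

text \<open>\<open>length gs + 2\<close> covers the shifted nodes and both sentinels,
  \<open>length Xs\<close> the obstacle indices; the sum bounds either kind of value.\<close>

definition circuit_code :: "nat \<Rightarrow> gate list \<Rightarrow> nat \<Rightarrow> nat \<Rightarrow> uf_code" where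
  "circuit_code d gs out k = (let r = 2 * 2 ^ d + 1; Xs = obstacles d gs out; N = length gs + 2 + length Xs in
     csp_code (length (slots r k)) (length (vals r N)) (compatible r gs k Xs N))"

lemma uf_yes_circuit:
  assumes "wf_gates gs" "out < length gs" "weft_depth d 1 gs out"
  shows "uf_yes (uf_of_code (circuit_code d gs out k)) \<longleftrightarrow>
    (\<exists>S\<subseteq>inputs (gs, out). card S = k \<and> satisfies S (gs, out))"
  unfolding circuit_code_def Let_def uf_yes_csp
proof
  assume "csp (length (slots (2 * 2 ^ d + 1) k))
      (length (vals (2 * 2 ^ d + 1) (length gs + 2 + length (obstacles d gs out))))
      (compatible (2 * 2 ^ d + 1) gs k (obstacles d gs out) (length gs + 2 + length (obstacles d gs out)))"
  from csp_imp_short[OF _ this] obtain Y where "\<forall>L. L \<noteq> [] \<longrightarrow> length L \<le> 2 * 2 ^ d + 1 \<longrightarrow>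
      set L \<subseteq> {..<k + 3} \<longrightarrow> \<not> contra gs k (obstacles d gs out) (facts Y L)" by auto
  then show "\<exists>S\<subseteq>inputs (gs, out). card S = k \<and> satisfies S (gs, out)" by (rule short_imp_sat[OF assms])
next
  assume "\<exists>S\<subseteq>inputs (gs, out). card S = k \<and> satisfies S (gs, out)"
  then obtain Y where "\<forall>s<k + 3. Y s < length gs + 2 + length (obstacles d gs out)"
    "\<not> contra gs k (obstacles d gs out) (facts Y [0..<k + 3])" using sat_imp_full[OF assms] by blast
  then show "csp (length (slots (2 * 2 ^ d + 1) k))
      (length (vals (2 * 2 ^ d + 1) (length gs + 2 + length (obstacles d gs out))))
      (compatible (2 * 2 ^ d + 1) gs k (obstacles d gs out) (length gs + 2 + length (obstacles d gs out)))"
    by (intro full_imp_csp) auto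
qed

text \<open>There are \<open>(k + 3) ^ r\<close> tuples of slots, and the square of this number
  counts the leaves of the star.\<close>

definition param_bound :: "nat \<Rightarrow> nat \<Rightarrow> nat" where
  "param_bound d k = 2 * ((k + 3) ^ (2 * 2 ^ d + 1) * (k + 3) ^ (2 * 2 ^ d + 1)) + 2"

lemma uf_param_circuit: "uf_param (uf_of_code (circuit_code d gs out k)) \<le> param_bound d k"
proof -
  have "length (slots r k) = (k + 3) ^ r" for r by (simp add: slots_def length_n_lists)
  then show ?thesis unfolding circuit_code_def Let_def param_bound_def by (metis uf_param_csp)
qed

lemma uf_valid_circuit: "uf_valid (circuit_code d gs out k)"
  unfolding circuit_code_def Let_def by (rule uf_valid_csp)


section \<open>The reduction\<close>

lemma pt_comp5:
  assumes "pt (\<lambda>p. g (fst p) (fst (snd p)) (fst (snd (snd p))) (fst (snd (snd (snd p)))) (snd (snd (snd (snd p)))))"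
    "pt f1" "pt f2" "pt f3" "pt f4" "pt f5"
  shows "pt (\<lambda>a. g (f1 a) (f2 a) (f3 a) (f4 a) (f5 a))"
  using pt_comp[OF assms(1) pt_pair[OF assms(2) pt_pair[OF assms(3) pt_pair[OF assms(4) pt_pair[OF assms(5,6)]]]]]
  by simp

text \<open>All numbers occurring are polynomial in \<open>m\<close> and \<open>n\<close>, so unary
  arithmetic computes them and the conversion by \<open>binary\<close> comes last.\<close>

lemma pt_csp_code:
  fixes P :: "'a::encodable \<Rightarrow> nat \<Rightarrow> nat \<Rightarrow> nat \<Rightarrow> nat \<Rightarrow> bool"
  assumes m: "pt m" and n: "pt n"
    and P: "pt (\<lambda>p. P (fst p) (fst (snd p)) (fst (snd (snd p))) (fst (snd (snd (snd p)))) (snd (snd (snd (snd p)))))"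
  shows "pt (\<lambda>x. enc_uf (csp_code (m x) (n x) (P x)))"
proof -
  note [pt_intros] = pt_comp[OF m] pt_comp[OF n] pt_comp5[where g = P, OF P]
  have task: "enc_task x = Node (tr (fst x)) (Node (tr (fst (snd x)))
      (Node (binary (fst (snd (snd x)))) (binary (snd (snd (snd x))))))" for x by (cases x) simp
  have edge: "enc_edge x = Node (tr (fst x)) (Node (tr (fst (snd x))) (tr (snd (snd x))))" for x by (cases x) simp
  have trees: "enc_list f xs = tr (map f xs)" for f :: "'b \<Rightarrow> tree" and xs by (induction xs) auto
  show ?thesis
    unfolding csp_code_def star_code_def csp_tasks_def row_task_def col_task_def cell_task_def star_task_def
      csp_cap_def base_def enc_uf.simps trees task edge tr_nat_def[symmetric]
    by (intro pt_intros)
qed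

lemma pt_contra [pt_intros]:
  assumes "pt gs" "pt k" "pt Xs" "pt K" shows "pt (\<lambda>a. contra (gs a) (k a) (Xs a) (K a))"
  unfolding contra_def bad_fact_def bad_pair_def shown_def
  by (intro pt_intros pt_comp[OF assms(1)] pt_comp[OF assms(2)] pt_comp[OF assms(3)] pt_comp[OF assms(4)])

lemma pt_circuit_code:
  assumes gs: "pt gs" and out: "pt out" and k: "pt k"
  shows "pt (\<lambda>a. enc_uf (circuit_code d (gs a) (out a) (k a)))"
  unfolding circuit_code_def Let_def slots_def vals_def compatible_def
  by (rule pt_csp_code)
     (intro pt_intros pt_comp[OF gs] pt_comp[OF out] pt_comp[OF k])+

text \<open>Re-encoding detects trees that encode no circuit with weight. Everything invalid goes to
  \<open>Leaf\<close>, which encodes no flow instance and so is a no-instance with parameter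
  0.\<close>

definition uf_reduction :: "nat \<Rightarrow> tree \<Rightarrow> tree" where
  "uf_reduction d t =
    (if enc_wcs ((gates_of t, out_of t), weight_of t) = t \<and> wf_circuit (gates_of t, out_of t) \<and>
        weft_depth d 1 (gates_of t) (out_of t)
     then enc_uf (circuit_code d (gates_of t) (out_of t) (weight_of t)) else Leaf)"

lemma pt_uf_reduction: "pt (uf_reduction d)"
  unfolding uf_reduction_def[abs_def]
  by (intro pt_intros pt_enc_wcs pt_wf_circuit pt_circuit_code pt_comp2[where g = "weft_depth d 1", OF pt_weft_depth])

lemma fst_pproblem_of:
  assumes "inj enc" "valid I"
  shows "enc I \<in> fst (pproblem_of enc valid yes param) \<longleftrightarrow> yes I"
  using assms by (auto simp: pproblem_of_def dest: injD)

lemma uf_reduction_correct: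
  "(uf_reduction d t \<in> fst unsplittable_flow \<longleftrightarrow> t \<in> fst (WCS 1 d)) \<and>
    snd unsplittable_flow (uf_reduction d t) \<le> param_bound d (snd (WCS 1 d) t)"
proof -
  let ?gs = "gates_of t" and ?out = "out_of t" and ?k = "weight_of t"
  let ?valid = "\<lambda>(C, k::nat). wf_circuit C \<and> weft_le 1 C \<and> depth_le d C"
  let ?yes = "\<lambda>(C, k). \<exists>S\<subseteq>inputs C. card S = k \<and> satisfies S C"
  have v: "?valid ((gs, out), k) \<longleftrightarrow> wf_circuit (gs, out) \<and> weft_depth d 1 gs out" for gs out k
    using weft_depth_circuit[of gs out 1 d] by auto
  show ?thesis
  proof (cases "enc_wcs ((?gs, ?out), ?k) = t \<and> wf_circuit (?gs, ?out) \<and> weft_depth d 1 ?gs ?out")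
    case True
    let ?I = "((?gs, ?out), ?k)" and ?J = "circuit_code d ?gs ?out ?k"
    have t: "t = enc_wcs ?I" using True by simp
    have val: "?valid ?I" using True v by blast
    have wf: "wf_gates ?gs" "?out < length ?gs" "weft_depth d 1 ?gs ?out"
      using True by (auto simp: wf_gates_def)
    have r: "uf_reduction d t = enc_uf ?J" using True by (simp add: uf_reduction_def)
    have "t \<in> fst (WCS 1 d) \<longleftrightarrow> ?yes ?I"
      unfolding WCS_def by (subst t, rule fst_pproblem_of[of enc_wcs ?valid ?I ?yes, OF enc_wcs_inj val])
    moreover have "uf_reduction d t \<in> fst unsplittable_flow \<longleftrightarrow> uf_yes (uf_of_code ?J)"
      unfolding unsplittable_flow_def r by (rule fst_pproblem_of[of enc_uf uf_valid, OF enc_uf_inj uf_valid_circuit])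
    moreover have "snd (WCS 1 d) t = ?k"
      unfolding WCS_def by (subst t, subst snd_pproblem_of[of enc_wcs ?valid ?I, OF enc_wcs_inj val]) simp
    moreover have "snd unsplittable_flow (uf_reduction d t) = uf_param (uf_of_code ?J)"
      unfolding unsplittable_flow_def r by (rule snd_pproblem_of[of enc_uf uf_valid, OF enc_uf_inj uf_valid_circuit])
    ultimately show ?thesis using uf_yes_circuit[OF wf, of ?k] uf_param_circuit[of d ?gs ?out ?k] by simp
  next
    case False
    have n: "\<nexists>I. ?valid I \<and> enc_wcs I = t"
    proof
      assume "\<exists>I. ?valid I \<and> enc_wcs I = t"
      then obtain gs out k where I: "?valid ((gs, out), k)" "enc_wcs ((gs, out), k) = t" by (metis surj_pair)
      have "?gs = gs" "?out = out" "?k = k" unfolding I(2)[symmetric] by (rule of_enc_wcs)+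
      then show False using False I v by blast
    qed
    have r: "uf_reduction d t = Leaf" using False by (auto simp: uf_reduction_def)
    have l: "enc_uf J \<noteq> Leaf" for J by (cases J) auto
    have "t \<notin> fst (WCS 1 d)" using n by (auto simp: WCS_def pproblem_of_def)
    moreover have "Leaf \<notin> fst unsplittable_flow" "snd unsplittable_flow Leaf = 0"
      using l by (auto simp: unsplittable_flow_def pproblem_of_def)
    ultimately show ?thesis unfolding r by simp
  qed
qed

text \<open>The second program tolerates arbitrary contents outside variable 0, so it can start
  among the leftovers of the first.\<close>

lemma computable_comp:
  assumes "computable f" "pt h" shows "computable (\<lambda>n. h (f n :: nat) :: nat)"
proof -
  obtain c where c: "\<And>n. \<exists>t. runs c (unary n) t (unary (f n))" using assms(1) by (auto simp: computable_def)
  obtain c' K b where c': "\<And>a s. s 0 = tr a \<Longrightarrow> run c' s (b (sz a)) (\<lambda>s'. s' 0 = tr (h a) \<and> (\<forall>v\<ge>K. s' v = s v))"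
    using assms(2) by (rule ptE) blast
  have "\<exists>t. runs (Seq c c') (unary n) t (unary (h (f n)))" for n
  proof -
    obtain t s where s: "exec c ((\<lambda>_. Leaf)(0 := unary n)) t s" "s 0 = unary (f n)"
      using c[of n] by (auto simp: runs_def)
    then obtain t' s' where "exec c' s t' s'" "s' 0 = unary (h (f n))"
      using c'[of s "f n"] by (auto simp: run_def)
    then show ?thesis using exec.Seq[OF s(1)] unfolding runs_def by blast
  qed
  then show ?thesis by (auto simp: computable_def)
qed

text \<open>The parameter of the intermediate instance is bounded only from above by
  \<open>g1\<close>, hence the monotone \<open>g\<close>.\<close>

lemma fpt_reducible_trans_pt:
  assumes PQ: "P \<le>\<^sub>f\<^sub>p\<^sub>t Q" and R: "pt R" and g: "pt g" "mono g"
    and QR: "\<And>x. (R x \<in> fst U \<longleftrightarrow> x \<in> fst Q) \<and> snd U (R x) \<le> g (snd Q x)"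
  shows "P \<le>\<^sub>f\<^sub>p\<^sub>t U"
proof -
  obtain R1 c1 f1 p1 g1 where 1: "computable f1" "computable g1"
    "\<And>x. R1 x \<in> fst Q \<longleftrightarrow> x \<in> fst P" "\<And>x. snd Q (R1 x) \<le> g1 (snd P x)"
    "\<And>x. \<exists>t. runs c1 x t (R1 x) \<and> t \<le> f1 (snd P x) * tsize x ^ p1"
    using PQ unfolding fpt_reducible_def by blast
  obtain c2 K b where 2: "polyb b"
    "\<And>a s. s 0 = tr a \<Longrightarrow> run c2 s (b (sz a)) (\<lambda>s'. s' 0 = tr (R a) \<and> (\<forall>v\<ge>K. s' v = s v))"
    using R by (rule ptE) blast
  obtain q where q: "\<And>n. b n \<le> q * (n + 1) ^ q" using 2(1) by (auto simp: polyb_def)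
  \<comment> \<open>With \<open>u\<close> the parameter factor and \<open>n\<close> the input size,
    \<open>(u + 2) * n ^ (p1 + 1)\<close> bounds the intermediate size plus one. Its
    \<open>q\<close>-th power yields \<open>(u + 2) ^ q\<close> here and \<open>(p1 + 1) * q\<close>
    in \<open>p\<close>; the summands \<open>u\<close> and \<open>p1\<close> pay for the first
    program.\<close>
  define h where "h u = u + q * (u + 2) ^ q" for u :: nat
  define p where "p = p1 + (p1 + 1) * q"
  have "pt h" unfolding h_def[abs_def] by (intro pt_intros)
  have run: "\<exists>t. runs (Seq c1 c2) x t (R (R1 x)) \<and> t \<le> h (f1 (snd P x)) * tsize x ^ p" for x
  proof -
    let ?u = "f1 (snd P x)" and ?n = "tsize x"
    obtain t1 s1 where s1: "exec c1 ((\<lambda>_. Leaf)(0 := x)) t1 s1" "s1 0 = R1 x" "t1 \<le> ?u * ?n ^ p1"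
      using 1(5)[of x] by (auto simp: runs_def)
    obtain t2 s2 where s2: "exec c2 s1 t2 s2" "s2 0 = R (R1 x)" "t2 \<le> b (tsize (R1 x))"
      using 2(2)[of s1 "R1 x"] s1(2) by (auto simp: run_def)
    have n1: "1 \<le> ?n" using tsize_pos[of x] by linarith
    have "tsize (R1 x) + 1 \<le> ?n + ?u * ?n ^ p1 + 1"
      using tsize_exec[OF s1(1), of 0] s1(2,3) by simp
    also have "\<dots> \<le> (?u + 2) * ?n ^ (p1 + 1)"
    proof -
      have "?n \<le> ?n ^ (p1 + 1)" "?n ^ p1 \<le> ?n ^ (p1 + 1)" "1 \<le> ?n ^ (p1 + 1)"
        using n1 self_le_power[of ?n "p1 + 1"] power_increasing[of p1 "p1 + 1" ?n] by auto
      then have "?n + ?u * ?n ^ p1 + 1 \<le> ?n ^ (p1 + 1) + ?u * ?n ^ (p1 + 1) + ?n ^ (p1 + 1)"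
        by (intro add_mono mult_left_mono) auto
      then show ?thesis by (simp add: algebra_simps)
    qed
    finally have "(tsize (R1 x) + 1) ^ q \<le> ((?u + 2) * ?n ^ (p1 + 1)) ^ q" by (rule power_mono) simp
    also have "\<dots> = (?u + 2) ^ q * ?n ^ ((p1 + 1) * q)" by (simp only: power_mult_distrib power_mult)
    finally have "t2 \<le> q * ((?u + 2) ^ q * ?n ^ ((p1 + 1) * q))"
      using s2(3) q[of "tsize (R1 x)"] by (meson le_trans mult_le_mono2)
    also have "\<dots> \<le> q * ((?u + 2) ^ q * ?n ^ p)"
      using n1 by (intro mult_left_mono power_increasing) (auto simp: p_def)
    finally have t2: "t2 \<le> q * (?u + 2) ^ q * ?n ^ p" by (simp add: mult.assoc)
    have "t1 \<le> ?u * ?n ^ p"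
      using s1(3) by (rule order_trans) (use n1 in \<open>intro mult_left_mono power_increasing; simp add: p_def\<close>)
    from add_mono[OF this t2] have "t1 + t2 \<le> h ?u * ?n ^ p" by (simp only: h_def add_mult_distrib)
    moreover have "runs (Seq c1 c2) x (t1 + t2) (R (R1 x))"
      unfolding runs_def using exec.Seq[OF s1(1) s2(1)] s2(2) by blast
    ultimately show ?thesis by blast
  qed
  have par: "snd U (R (R1 x)) \<le> g (g1 (snd P x))" for x
    using QR[of "R1 x"] monoD[OF g(2) 1(4)[of x]] by simp
  show ?thesis unfolding fpt_reducible_def
    by (rule exI[of _ "\<lambda>x. R (R1 x)"], rule exI[of _ "Seq c1 c2"], rule exI[of _ "\<lambda>n. h (f1 n)"],
        rule exI[of _ p], rule exI[of _ "\<lambda>n. g (g1 n)"])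
       (use computable_comp[OF 1(1) \<open>pt h\<close>] computable_comp[OF 1(2) g(1)] QR 1(3) par run in simp)
qed

theorem theorem5: "W_hard 1 unsplittable_flow"
  unfolding W_hard_def
proof
  fix Q assume "Q \<in> W 1"
  then obtain d where "Q \<le>\<^sub>f\<^sub>p\<^sub>t WCS 1 d" unfolding W_def by blast
  moreover have "pt (param_bound d)" unfolding param_bound_def[abs_def] by (intro pt_intros)
  moreover have "mono (param_bound d)"
    unfolding param_bound_def by (intro monoI add_mono mult_mono power_mono) auto
  ultimately show "Q \<le>\<^sub>f\<^sub>p\<^sub>t unsplittable_flow"
    using fpt_reducible_trans_pt[OF _ pt_uf_reduction _ _ uf_reduction_correct] by blast
qed

end
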